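(* Let $\{X_n, n\ge 1\}$ be a sequence of independent random variables, identically distributed as $X$, in the sublinear expectation space $(\Omega,\mathcal{H},\mathbb{E})$. Let $p>0$, $r>1$, $q>\frac12$, $-q<\beta<-q/r<0$, and suppose that $\mathbb{E}X=-\mathbb{E}(-X)=0$ in the case $\frac12<q\le 1$. Suppose that $\{a_{ni}, 1\le i\le n, n\ge 1\}$ is a triangular array of real numbers with $a_{ni}\approx (i/n)^{\beta}(1/n^{q})$. Then the condition that, for every $\epsilon>0$, $$\sum_{n=1}^{\infty}n^{r-2}\,C_{\mathbb{V}}\left(\left(\max_{1\le k\le n}\left|\sum_{i=1}^{k}a_{ni}X_{i}\right|^p-\epsilon\right)^{+}\right)<\infty$$ is equivalent to $$\begin{cases} C_{\mathbb{V}}\left(|X|^{p}\right)<\infty, & \text{if } p>(r-1)/(q+\beta),\\ C_{\mathbb{V}}\left(|X|^{(r-1)/(q+\beta)}\ln|X|\right)<\infty, & \text{if } p=(r-1)/(q+\beta),\\ C_{\mathbb{V}}\left(|X|^{(r-1)/(q+\beta)}\right)<\infty, & \text{if } p<(r-1)/(q+\beta).\end{cases}$$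
   Context: Setting. $(\Omega,\mathcal{F})$ is a measurable space and $\mathcal{H}$ is a set of real random variables on $(\Omega,\mathcal{F})$ such that $I_A\in\mathcal{H}$ for all $A\in\mathcal{F}$ and such that $X_1,\dots,X_n\in\mathcal{H}$ implies $\varphi(X_1,\dots,X_n)\in\mathcal{H}$ for every $\varphi\in C_{l,Lip}(\mathbb{R}^n)$, the space of functions satisfying $|\varphi(\mathbf{x})-\varphi(\mathbf{y})|\le C(1+|\mathbf{x}|^m+|\mathbf{y}|^m)|\mathbf{x}-\mathbf{y}|$ for all $\mathbf{x},\mathbf{y}\in\mathbb{R}^n$, with some $C>0$, $m\in\mathbb{N}$ depending on $\varphi$. A sublinear expectation is a functional $\mathbb{E}:\mathcal{H}\to[-\infty,\infty]$ such that for all $X,Y\in\mathcal{H}$: (a) $X\ge Y$ implies $\mathbb{E}[X]\ge\mathbb{E}[Y]$; (b) $\mathbb{E}[c]=c$ for $c\in\mathbb{R}$; (c) $\mathbb{E}[\lambda X]=\lambda\mathbb{E}[X]$ for $\lambda\ge0$; (d) $\mathbb{E}[X+Y]\le\mathbb{E}[X]+\mathbb{E}[Y]$ whenever the right side is not of the form $\infty-\infty$ or $-\infty+\infty$. Then $(\Omega,\mathcal{H},\mathbb{E})$ is a sublinear expectation space. Standing assumption: $\mathbb{E}$ is countably sub-additive, i.e. $\mathbb{E}(X)\le\sum_{n=1}^\infty\mathbb{E}(X_n)$ whenever $X\le\sum_{n=1}^\infty X_n$ with $X,X_n\in\mathcal{H}$, $X\ge0$, $X_n\ge0$. The capacity is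 $\mathbb{V}(A):=\mathbb{E}[I_A]$ for $A\in\mathcal{F}$, and the Choquet expectation of a random variable $X$ is $C_{\mathbb{V}}(X):=\int_0^\infty\mathbb{V}(X>x)\,dx+\int_{-\infty}^0(\mathbb{V}(X>x)-1)\,dx$. Independence. A random vector $\mathbf{Y}=(Y_1,\dots,Y_n)$, $Y_i\in\mathcal{H}$, is independent of $\mathbf{X}=(X_1,\dots,X_m)$, $X_i\in\mathcal{H}$, if for each Borel-measurable $\psi$ on $\mathbb{R}^m\times\mathbb{R}^n$ with $\psi(\mathbf{X},\mathbf{Y})\in\mathcal{H}$ and $\psi(\mathbf{x},\mathbf{Y})\in\mathcal{H}$ for each $\mathbf{x}\in\mathbb{R}^m$, one has $\mathbb{E}[\psi(\mathbf{X},\mathbf{Y})]=\mathbb{E}\big[\mathbb{E}[\psi(\mathbf{x},\mathbf{Y})]|_{\mathbf{x}=\mathbf{X}}\big]$ whenever $\bar\psi(\mathbf{x}):=\mathbb{E}[|\psi(\mathbf{x},\mathbf{Y})|]<\infty$ for each $\mathbf{x}$ and $\mathbb{E}[|\bar\psi(\mathbf{X})|]<\infty$. A sequence $(X_n)$ is a sequence of independent random variables if $X_{n+1}$ is independent of $(X_1,\dots,X_n)$ for each $n\ge1$. Identical distribution. $X$ and $Y$ are identically distributed if $\mathbb{E}[\psi(X)]=\mathbb{E}[\psi(Y)]$ for every Borel-measurable $\psi$ with $\psi(X),\psi(Y)\in\mathcal{H}$, whenever these sublinear expectations are finite. Notation. $x^+=\max\{x,0\}$. For the array, $a_{ni}\approx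 b_{ni}$ (with $b_{ni}>0$) means there is a constant $C\ge1$, independent of $i$ and $n$, with $C^{-1}b_{ni}\le a_{ni}\le C b_{ni}$ for all indices $i$ of the $n$-th row and all sufficiently large $n$. The expression $|X|^{s}\ln|X|$ ($s>0$) is read as $0$ where $X=0$. *)

theory Defs
  imports "HOL-Analysis.Analysis"
begin

text \<open>
  The measurable space \<open>(\<Omega>, \<F>)\<close> is given by \<open>space M\<close> and \<open>sets M\<close>; the measure carried by \<open>M\<close> is
  never used. Vectors in \<open>\<real>\<^sup>n\<close> are functions on the index set \<open>{1..n}\<close>, undefined elsewhere.
  The sigma-algebra of \<open>borel_vec n\<close> is the Borel sigma-algebra of \<open>\<real>\<^sup>n\<close>.
\<close>

abbreviation borel_vec :: "nat \<Rightarrow> (nat \<Rightarrow> real) measure" where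
  "borel_vec n \<equiv> Pi\<^sub>M {1..n} (\<lambda>_. borel)"

definition rvec :: "nat \<Rightarrow> (nat \<Rightarrow> 'a \<Rightarrow> real) \<Rightarrow> 'a \<Rightarrow> (nat \<Rightarrow> real)" where
  "rvec n X \<omega> = (\<lambda>i\<in>{1..n}. X i \<omega>)"

definition vnorm :: "nat \<Rightarrow> (nat \<Rightarrow> real) \<Rightarrow> real" where
  "vnorm n x = sqrt (\<Sum>i=1..n. (x i)\<^sup>2)"

definition C_l_Lip :: "nat \<Rightarrow> ((nat \<Rightarrow> real) \<Rightarrow> real) set" where
  "C_l_Lip n = {\<phi>. \<exists>C>0. \<exists>m::nat. \<forall>x\<in>space (borel_vec n). \<forall>y\<in>space (borel_vec n).
     \<bar>\<phi> x - \<phi> y\<bar> \<le> C * (1 + vnorm n x ^ m + vnorm n y ^ m) * vnorm n (\<lambda>i. x i - y i)}"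

text \<open>
  Random variables on \<open>\<Omega>\<close> are total functions of which only the values on \<open>space M\<close> matter;
  this is what \<open>H_cong\<close> expresses. That \<open>E\<close> ignores the other values follows from \<open>E_mono\<close>.
  Nothing is assumed about the values of \<open>E\<close> outside \<open>H\<close>.
\<close>

locale sublinear_expectation_space =
  fixes M :: "'a measure" and H :: "('a \<Rightarrow> real) set" and E :: "('a \<Rightarrow> real) \<Rightarrow> ereal"
  assumes H_measurable: "H \<subseteq> borel_measurable M"
    and H_cong: "\<lbrakk>X \<in> H; \<And>\<omega>. \<omega> \<in> space M \<Longrightarrow> Y \<omega> = X \<omega>\<rbrakk> \<Longrightarrow> Y \<in> H"
    and H_indicator: "A \<in> sets M \<Longrightarrow> indicator A \<in> H"
    and H_C_l_Lip: "\<lbrakk>n \<ge> 1; \<And>i. i \<in> {1..n} \<Longrightarrow> Xs i \<in> H; \<phi> \<in> C_l_Lip n\<rbrakk>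
          \<Longrightarrow> (\<lambda>\<omega>. \<phi> (rvec n Xs \<omega>)) \<in> H"
    and E_mono: "\<lbrakk>X \<in> H; Y \<in> H; \<And>\<omega>. \<omega> \<in> space M \<Longrightarrow> Y \<omega> \<le> X \<omega>\<rbrakk> \<Longrightarrow> E Y \<le> E X"
    and E_const: "E (\<lambda>_. c) = ereal c"
    and E_pos_homogeneous: "\<lbrakk>X \<in> H; 0 \<le> l\<rbrakk> \<Longrightarrow> E (\<lambda>\<omega>. l * X \<omega>) = ereal l * E X"
    and E_subadditive: "\<lbrakk>X \<in> H; Y \<in> H; \<not> (E X = \<infinity> \<and> E Y = -\<infinity>); \<not> (E X = -\<infinity> \<and> E Y = \<infinity>)\<rbrakk>
          \<Longrightarrow> E (\<lambda>\<omega>. X \<omega> + Y \<omega>) \<le> E X + E Y"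

definition countably_subadditive_expectation ::
    "'a measure \<Rightarrow> ('a \<Rightarrow> real) set \<Rightarrow> (('a \<Rightarrow> real) \<Rightarrow> ereal) \<Rightarrow> bool" where
  "countably_subadditive_expectation M H E \<longleftrightarrow>
     (\<forall>X Xs. X \<in> H \<and> (\<forall>n::nat. Xs n \<in> H) \<and>
        (\<forall>\<omega>\<in>space M. 0 \<le> X \<omega> \<and> (\<forall>n. 0 \<le> Xs n \<omega>) \<and> ereal (X \<omega>) \<le> (\<Sum>n. ereal (Xs n \<omega>)))
        \<longrightarrow> E X \<le> (\<Sum>n. E (Xs n)))"

definition capacity :: "(('a \<Rightarrow> real) \<Rightarrow> ereal) \<Rightarrow> 'a set \<Rightarrow> ereal" where
  "capacity E A = E (indicator A)"

text \<open>
  The capacity takes values in \<open>[0, 1]\<close>, so both integrands below are nonnegative. The second integral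
  is that of \<open>1 - V(X > x)\<close> and is therefore subtracted. (The undefined case of two infinite
  integrals evaluates to \<open>\<infinity>\<close>; it cannot occur when \<open>X\<close> is bounded below.)
\<close>

definition choquet ::
    "'a measure \<Rightarrow> (('a \<Rightarrow> real) \<Rightarrow> ereal) \<Rightarrow> ('a \<Rightarrow> real) \<Rightarrow> ereal" where
  "choquet M E X =
     enn2ereal (\<integral>\<^sup>+x\<in>{0..}. e2ennreal (capacity E {\<omega>\<in>space M. X \<omega> > x}) \<partial>lborel)
     - enn2ereal (\<integral>\<^sup>+x\<in>{..0}. e2ennreal (1 - capacity E {\<omega>\<in>space M. X \<omega> > x}) \<partial>lborel)"

text \<open>
  \<open>indep_vec H E n Y m X\<close>: \<open>(Y\<^sub>1, \<dots>, Y\<^sub>n)\<close> is independent of \<open>(X\<^sub>1, \<dots>, X\<^sub>m)\<close>. Since \<open>E\<close> is only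
  meaningful on \<open>H\<close>, the identity is required for those \<open>\<psi>\<close> for which the two random variables
  obtained by substituting \<open>X\<close> into an expectation belong to \<open>H\<close>. Under the finiteness conditions the
  inner expectations are finite, so \<open>real_of_ereal\<close> loses nothing.
\<close>

definition indep_vec ::
    "('a \<Rightarrow> real) set \<Rightarrow> (('a \<Rightarrow> real) \<Rightarrow> ereal) \<Rightarrow>
     nat \<Rightarrow> (nat \<Rightarrow> 'a \<Rightarrow> real) \<Rightarrow> nat \<Rightarrow> (nat \<Rightarrow> 'a \<Rightarrow> real) \<Rightarrow> bool" where
  "indep_vec H E n Y m X \<longleftrightarrow>
     (\<forall>\<psi> \<in> borel_measurable (borel_vec m \<Otimes>\<^sub>M borel_vec n).
        let inner = (\<lambda>x. E (\<lambda>\<omega>. \<psi> (x, rvec n Y \<omega>)));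
            psibar = (\<lambda>x. E (\<lambda>\<omega>. \<bar>\<psi> (x, rvec n Y \<omega>)\<bar>));
            inner_X = (\<lambda>\<omega>. real_of_ereal (inner (rvec m X \<omega>)));
            psibar_X = (\<lambda>\<omega>. real_of_ereal (psibar (rvec m X \<omega>)))
        in (\<lambda>\<omega>. \<psi> (rvec m X \<omega>, rvec n Y \<omega>)) \<in> H \<longrightarrow>
           (\<forall>x\<in>space (borel_vec m). (\<lambda>\<omega>. \<psi> (x, rvec n Y \<omega>)) \<in> H) \<longrightarrow>
           (\<forall>x\<in>space (borel_vec m). psibar x < \<infinity>) \<longrightarrow>
           psibar_X \<in> H \<longrightarrow> E (\<lambda>\<omega>. \<bar>psibar_X \<omega>\<bar>) < \<infinity> \<longrightarrow>
           inner_X \<in> H \<longrightarrow>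
           E (\<lambda>\<omega>. \<psi> (rvec m X \<omega>, rvec n Y \<omega>)) = E inner_X)"

text \<open>Sequences are indexed from 1; the value at index 0 is irrelevant.\<close>

definition indep_seq ::
    "('a \<Rightarrow> real) set \<Rightarrow> (('a \<Rightarrow> real) \<Rightarrow> ereal) \<Rightarrow> (nat \<Rightarrow> 'a \<Rightarrow> real) \<Rightarrow> bool" where
  "indep_seq H E Xs \<longleftrightarrow> (\<forall>n\<ge>1. indep_vec H E 1 (\<lambda>_. Xs (n + 1)) n Xs)"

definition ident_distributed ::
    "('a \<Rightarrow> real) set \<Rightarrow> (('a \<Rightarrow> real) \<Rightarrow> ereal) \<Rightarrow> ('a \<Rightarrow> real) \<Rightarrow> ('a \<Rightarrow> real) \<Rightarrow> bool" where
  "ident_distributed H E X Y \<longleftrightarrow>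
     (\<forall>\<psi> \<in> borel_measurable borel.
        (\<lambda>\<omega>. \<psi> (X \<omega>)) \<in> H \<longrightarrow> (\<lambda>\<omega>. \<psi> (Y \<omega>)) \<in> H \<longrightarrow>
        \<bar>E (\<lambda>\<omega>. \<psi> (X \<omega>))\<bar> \<noteq> \<infinity> \<longrightarrow> \<bar>E (\<lambda>\<omega>. \<psi> (Y \<omega>))\<bar> \<noteq> \<infinity> \<longrightarrow>
        E (\<lambda>\<omega>. \<psi> (X \<omega>)) = E (\<lambda>\<omega>. \<psi> (Y \<omega>)))"

definition array_approx :: "(nat \<Rightarrow> nat \<Rightarrow> real) \<Rightarrow> (nat \<Rightarrow> nat \<Rightarrow> real) \<Rightarrow> bool" where
  "array_approx a b \<longleftrightarrow>
     (\<exists>C\<ge>1. \<forall>\<^sub>F n in sequentially. \<forall>i\<in>{1..n}. inverse C * b n i \<le> a n i \<and> a n i \<le> C * b n i)"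

end

theory Submission
  imports Defs
begin

text \<open>
  Write \<open>\<alpha> = q + \<beta>\<close>, \<open>b = -\<beta>\<close> and \<open>s = (r - 1) / \<alpha>\<close>, so that \<open>a n i\<close> is comparable to
  \<open>i\<^sup>-\<^sup>b n\<^sup>-\<^sup>\<alpha>\<close> with \<open>\<alpha>, b > 0\<close>. The hypothesis \<open>\<beta> < - q / r\<close> says exactly \<open>b s > 1\<close>: the first summands
  of a row dominate, because \<open>i\<^sup>-\<^sup>b\<^sup>s\<close> is summable. The series in the theorem therefore has the
  size of the series for the single summand \<open>i = 1\<close>, and summing the powers of \<open>n\<close> in
  \<open>\<Sum>\<^sub>n n\<^sup>r\<^sup>-\<^sup>2 ((u n\<^sup>-\<^sup>\<alpha>)\<^sup>p - \<epsilon>)\<^sup>+\<close> gives, up to constants, the function \<open>growth p s u\<close>: this is \<open>u\<^sup>p\<close>,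
  \<open>u\<^sup>s ln u\<close> or \<open>u\<^sup>s\<close>, according to whether \<open>n = 1\<close> dominates, all scales \<open>n < u\<^sup>1\<^sup>/\<^sup>\<alpha>\<close> contribute equally,
  or \<open>n\<close> of order \<open>u\<^sup>1\<^sup>/\<^sup>\<alpha>\<close> dominates. The three conditions of the theorem say that \<open>growth p s |X|\<close> has
  a finite Choquet integral.

  The Choquet integral is not linear, but on increasing functions of \<open>|X|\<close> it is: with \<open>T\<close> the quantile
  function of \<open>|X|\<close> under the capacity, the integral of \<open>\<phi> |X|\<close> is the Lebesgue integral of \<open>\<phi> (T l)\<close> over
  \<open>0 < l < 1\<close> (\<open>quantile_representation\<close>). Sums over \<open>n\<close> and \<open>i\<close> may then be interchanged with the
  integral, and every comparison reduces to an inequality between functions of one real variable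
  (\<open>growth_le_row_series\<close>, \<open>weighted_rows_le_growth\<close>).

  Necessity keeps from the maximum over \<open>k\<close> the term \<open>k = 1\<close>, which is \<open>|a n 1 X 1|\<^sup>p\<close>.

  Sufficiency needs an upper bound for the capacity of \<open>max\<^sub>k |S k| > y\<close>, where \<open>S k\<close> are the partial sums
  of a row. Truncate each summand at the level \<open>z = y / (2 N)\<close>. The untruncated summands contribute
  \<open>\<Sum>\<^sub>i V(|a n i X| > z)\<close>, which leads to the series above. For the truncated ones, independence makes the
  stopped products of \<open>exp (\<lambda> Y i)\<close>, suitably normalised, behave like a supermartingale
  (\<open>stopped_prod_maximal_inequality\<close>), and an optimal \<open>\<lambda>\<close> gives a bound of order
  \<open>(\<Sum>\<^sub>i |a n i|\<^sup>\<theta> / z\<^sup>\<theta>)\<^sup>N\<close> (\<open>weighted_sum_maximal_bound\<close>), for an exponent \<open>\<theta>\<close> below \<open>s\<close>. Since \<open>s > 1 / q\<close>,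
  one may take \<open>\<theta> > 1 / q\<close>, and then the sum of the \<open>|a n i|\<^sup>\<theta>\<close> decays like a negative power of \<open>n\<close>; a large \<open>N\<close>
  makes this part summable. If \<open>q > 1\<close>, then \<open>\<theta>\<close> can be taken below \<open>1\<close>; otherwise \<open>1 \<le> \<theta> \<le> 2\<close>, and the vanishing
  means remove the linear term of the exponential.
\<close>

section \<open>Random variables, expectation and capacity\<close>

context sublinear_expectation_space
begin

text \<open>
  Membership in \<open>H\<close> is granted for locally Lipschitz functions of members. The instances below
  (Lipschitz functions of one variable, sums and products) together with the indicators make \<open>H\<close> an
  algebra that contains the simple functions; this suffices to check the membership conditions in
  the definition of independence.
\<close>

lemma H_lipschitz:
  assumes X: "X \<in> H" and lip: "\<And>x y. \<bar>g x - g y\<bar> \<le> L * \<bar>x - y\<bar>"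
  shows "(\<lambda>\<omega>. g (X \<omega>)) \<in> H"
proof -
  have "(\<lambda>v. g (v 1)) \<in> C_l_Lip 1"
    unfolding C_l_Lip_def
  proof (intro CollectI exI[of _ "\<bar>L\<bar> + 1"] conjI exI[of _ 0] ballI)
    fix x y :: "nat \<Rightarrow> real"
    have "\<bar>g (x 1) - g (y 1)\<bar> \<le> L * \<bar>x 1 - y 1\<bar>" by (rule lip)
    also have "\<dots> \<le> (\<bar>L\<bar> + 1) * (1 + vnorm 1 x ^ 0 + vnorm 1 y ^ 0) * \<bar>x 1 - y 1\<bar>"
      by (intro mult_right_mono) auto
    finally show "\<bar>g (x 1) - g (y 1)\<bar> \<le>
        (\<bar>L\<bar> + 1) * (1 + vnorm 1 x ^ 0 + vnorm 1 y ^ 0) * vnorm 1 (\<lambda>i. x i - y i)"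
      by (simp add: vnorm_def)
  qed auto
  from H_C_l_Lip[of 1 "\<lambda>_. X", OF _ _ this] X show ?thesis
    by (simp add: rvec_def)
qed

lemma H_const [simp]: "(\<lambda>_. c) \<in> H"
  using H_lipschitz[OF H_indicator[OF sets.top], of "\<lambda>_. c" 0] by simp

lemma H_cmult: "X \<in> H \<Longrightarrow> (\<lambda>\<omega>. c * X \<omega>) \<in> H"
  by (rule H_lipschitz[of X "\<lambda>x. c * x" "\<bar>c\<bar>"]) (auto simp flip: abs_mult right_diff_distrib)

lemma H_two:
  assumes X: "X \<in> H" and Y: "Y \<in> H" and C: "C > 0"
    and lip: "\<And>x y x' y'. \<bar>g x y - g x' y'\<bar>
       \<le> C * (1 + sqrt (x\<^sup>2 + y\<^sup>2) + sqrt (x'\<^sup>2 + y'\<^sup>2)) * sqrt ((x - x')\<^sup>2 + (y - y')\<^sup>2)"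
  shows "(\<lambda>\<omega>. g (X \<omega>) (Y \<omega>)) \<in> H"
proof -
  have two: "{1..2::nat} = {1, 2}" by auto
  have "(\<lambda>v. g (v 1) (v 2)) \<in> C_l_Lip 2"
    unfolding C_l_Lip_def vnorm_def two using C lip
    by (intro CollectI exI[of _ C] conjI exI[of _ 1] ballI) auto
  from H_C_l_Lip[of 2 "\<lambda>i. if i = 1 then X else Y", OF _ _ this] X Y show ?thesis
    by (simp add: rvec_def)
qed

lemma H_add:
  assumes "X \<in> H" "Y \<in> H" shows "(\<lambda>\<omega>. X \<omega> + Y \<omega>) \<in> H"
proof (rule H_two[OF assms, of 2])
  fix x y x' y' :: real
  let ?d = "sqrt ((x - x')\<^sup>2 + (y - y')\<^sup>2)"
  have "\<bar>(x + y) - (x' + y')\<bar> \<le> \<bar>x - x'\<bar> + \<bar>y - y'\<bar>" by simp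
  also have "\<dots> \<le> ?d + ?d"
    by (intro add_mono real_le_rsqrt) auto
  also have "\<dots> \<le> 2 * (1 + sqrt (x\<^sup>2 + y\<^sup>2) + sqrt (x'\<^sup>2 + y'\<^sup>2)) * ?d"
    using mult_right_mono[of 2 "2 * (1 + sqrt (x\<^sup>2 + y\<^sup>2) + sqrt (x'\<^sup>2 + y'\<^sup>2))" ?d] by simp
  finally show "\<bar>(x + y) - (x' + y')\<bar> \<le> 2 * (1 + sqrt (x\<^sup>2 + y\<^sup>2) + sqrt (x'\<^sup>2 + y'\<^sup>2)) * ?d" .
qed simp

lemma H_mult:
  assumes "X \<in> H" "Y \<in> H" shows "(\<lambda>\<omega>. X \<omega> * Y \<omega>) \<in> H"
proof (rule H_two[OF assms, of 1])
  fix x y x' y' :: real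
  let ?d = "sqrt ((x - x')\<^sup>2 + (y - y')\<^sup>2)"
  have le: "\<bar>u\<bar> \<le> sqrt (u\<^sup>2 + v\<^sup>2)" "\<bar>v\<bar> \<le> sqrt (u\<^sup>2 + v\<^sup>2)" for u v :: real
    by (auto intro!: real_le_rsqrt)
  have "x * y - x' * y' = x * (y - y') + y' * (x - x')" by algebra
  then have "\<bar>x * y - x' * y'\<bar> \<le> \<bar>x\<bar> * \<bar>y - y'\<bar> + \<bar>y'\<bar> * \<bar>x - x'\<bar>"
    by (metis abs_mult abs_triangle_ineq)
  also have "\<dots> \<le> sqrt (x\<^sup>2 + y\<^sup>2) * ?d + sqrt (x'\<^sup>2 + y'\<^sup>2) * ?d"
    by (intro add_mono mult_mono le) auto
  also have "\<dots> \<le> 1 * (1 + sqrt (x\<^sup>2 + y\<^sup>2) + sqrt (x'\<^sup>2 + y'\<^sup>2)) * ?d"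
    by (simp add: algebra_simps)
  finally show "\<bar>x * y - x' * y'\<bar> \<le> 1 * (1 + sqrt (x\<^sup>2 + y\<^sup>2) + sqrt (x'\<^sup>2 + y'\<^sup>2)) * ?d" .
qed simp

lemma H_meas: "X \<in> H \<Longrightarrow> X \<in> borel_measurable M"
  using H_measurable by auto

lemma E_cong: "X \<in> H \<Longrightarrow> (\<And>\<omega>. \<omega> \<in> space M \<Longrightarrow> X \<omega> = Y \<omega>) \<Longrightarrow> E X = E Y"
  using H_cong[of X Y] E_mono[of X Y] E_mono[of Y X] by (metis antisym order_refl)

lemma E_le_const: "X \<in> H \<Longrightarrow> (\<And>\<omega>. \<omega> \<in> space M \<Longrightarrow> X \<omega> \<le> c) \<Longrightarrow> E X \<le> ereal c"
  using E_mono[of "\<lambda>_. c" X] by (simp add: E_const)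

lemma E_ge_const: "X \<in> H \<Longrightarrow> (\<And>\<omega>. \<omega> \<in> space M \<Longrightarrow> c \<le> X \<omega>) \<Longrightarrow> ereal c \<le> E X"
  using E_mono[of X "\<lambda>_. c"] by (simp add: E_const)

text \<open>
  One inequality is subadditivity with the constant \<open>c\<close>, the other is subadditivity with \<open>- c\<close>.
\<close>

lemma E_add_const:
  assumes "X \<in> H" shows "E (\<lambda>\<omega>. X \<omega> + c) = E X + ereal c"
proof (rule antisym)
  show "E (\<lambda>\<omega>. X \<omega> + c) \<le> E X + ereal c"
    using E_subadditive[of X "\<lambda>_. c"] assms by (simp add: E_const)
  have "E (\<lambda>\<omega>. (X \<omega> + c) + - c) \<le> E (\<lambda>\<omega>. X \<omega> + c) + ereal (- c)"
    using E_subadditive[of "\<lambda>\<omega>. X \<omega> + c" "\<lambda>_. - c"] H_add[OF assms H_const] by (simp add: E_const)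
  then show "E X + ereal c \<le> E (\<lambda>\<omega>. X \<omega> + c)"
    by (cases "E X"; cases "E (\<lambda>\<omega>. X \<omega> + c)") auto
qed

lemma capacity_nonneg: "A \<in> sets M \<Longrightarrow> 0 \<le> capacity E A"
  using E_ge_const[OF H_indicator, of A 0] by (simp add: capacity_def zero_ereal_def)

lemma capacity_le_1: "A \<in> sets M \<Longrightarrow> capacity E A \<le> 1"
  using E_le_const[OF H_indicator, of A 1] by (simp add: capacity_def one_ereal_def indicator_def)

lemma capacity_space: "capacity E (space M) = 1"
  using E_cong[OF H_indicator[OF sets.top], of "\<lambda>_. 1"] by (simp add: capacity_def E_const one_ereal_def)

lemma capacity_empty: "capacity E {} = 0"
  using E_const[of 0] by (simp add: capacity_def indicator_def[abs_def] zero_ereal_def)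

lemma capacity_mono: "A \<in> sets M \<Longrightarrow> B \<in> sets M \<Longrightarrow> A \<subseteq> B \<Longrightarrow> capacity E A \<le> capacity E B"
  unfolding capacity_def by (intro E_mono H_indicator) (auto simp: indicator_def)

lemma capacity_Un:
  assumes [measurable]: "A \<in> sets M" "B \<in> sets M"
  shows "capacity E (A \<union> B) \<le> capacity E A + capacity E B"
proof -
  have "capacity E (A \<union> B) \<le> E (\<lambda>\<omega>. indicator A \<omega> + indicator B \<omega>)"
    unfolding capacity_def by (intro E_mono H_add H_indicator) (auto simp: indicator_def)
  also have "\<dots> \<le> capacity E A + capacity E B"
    unfolding capacity_def
    using capacity_le_1[of A] capacity_le_1[of B]
    by (intro E_subadditive H_indicator) (auto simp: capacity_def)
  finally show ?thesis .
qed

lemma capacity_UN: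
  assumes "finite I" "\<And>i. i \<in> I \<Longrightarrow> A i \<in> sets M"
  shows "capacity E (\<Union>i\<in>I. A i) \<le> (\<Sum>i\<in>I. capacity E (A i))"
  using assms
proof (induction I)
  case empty then show ?case by (simp add: capacity_empty)
next
  case (insert i I)
  have "capacity E (A i \<union> (\<Union>i\<in>I. A i)) \<le> capacity E (A i) + capacity E (\<Union>i\<in>I. A i)"
    using insert by (intro capacity_Un) auto
  also have "\<dots> \<le> capacity E (A i) + (\<Sum>i\<in>I. capacity E (A i))"
    using insert by (intro add_left_mono) auto
  finally show ?case using insert by simp
qed

end

section \<open>Choquet integrals through quantiles\<close>

text \<open>
  Both sides are the area of the region below the decreasing graph of \<open>w\<close>, sliced vertically and
  horizontally. The boundary points \<open>x = c l\<close> form a null set of each slice.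
\<close>

lemma nn_integral_antitone_eq_quantile:
  fixes w c :: "real \<Rightarrow> real"
  assumes anti: "\<And>x y. 0 \<le> x \<Longrightarrow> x \<le> y \<Longrightarrow> w y \<le> w x"
    and range: "\<And>x. 0 \<le> x \<Longrightarrow> 0 \<le> w x \<and> w x \<le> 1"
    and c0: "\<And>l. 0 < l \<Longrightarrow> l < 1 \<Longrightarrow> 0 \<le> c l"
    and below: "\<And>x l. 0 < l \<Longrightarrow> l < 1 \<Longrightarrow> 0 \<le> x \<Longrightarrow> x < c l \<Longrightarrow> l < w x"
    and above: "\<And>x l. 0 < l \<Longrightarrow> l < 1 \<Longrightarrow> c l < x \<Longrightarrow> w x \<le> l"
  shows "(\<integral>\<^sup>+x\<in>{0..}. ennreal (w x) \<partial>lborel) = (\<integral>\<^sup>+l\<in>{0<..<1}. ennreal (c l) \<partial>lborel)"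
proof -
  define w' where "w' x = w (max 0 x)" for x
  have "mono (\<lambda>x. - w' x)"
    unfolding mono_def w'_def using anti by auto
  then have "(\<lambda>x. - w' x) \<in> borel_measurable borel" by (rule borel_measurable_mono)
  from borel_measurable_uminus[OF this] have [measurable]: "w' \<in> borel_measurable borel" by simp
  let ?f = "\<lambda>x l. indicator {0..} x * (indicator {0<..<1} l * (if l < w' x then 1 else 0)) :: ennreal"
  have 1: "(\<integral>\<^sup>+l. ?f x l \<partial>lborel) = ennreal (w x) * indicator {0..} x" for x :: real
  proof (cases "0 \<le> x")
    case True
    then have w: "0 \<le> w x" "w x \<le> 1" "w' x = w x" using range[of x] by (auto simp: w'_def)
    have "(\<integral>\<^sup>+l. ?f x l \<partial>lborel) = (\<integral>\<^sup>+l. indicator {0<..<w x} l \<partial>lborel)"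
      using True w by (intro nn_integral_cong) (auto simp: indicator_def)
    then show ?thesis using True w by simp
  qed simp
  have 2: "(\<integral>\<^sup>+x. ?f x l \<partial>lborel) = ennreal (c l) * indicator {0<..<1} l" for l :: real
  proof (cases "0 < l \<and> l < 1")
    case True
    have "AE x in lborel. x \<noteq> c l" by (rule AE_lborel_singleton)
    then have "AE x in lborel. ?f x l = indicator {0..<c l} x"
    proof eventually_elim
      case (elim x)
      then show ?case
        using True below[of l x] above[of l x] c0[of l]
        by (cases "0 \<le> x"; cases "x < c l") (auto simp: indicator_def w'_def max_def)
    qed
    then have "(\<integral>\<^sup>+x. ?f x l \<partial>lborel) = (\<integral>\<^sup>+x. indicator {0..<c l} x \<partial>lborel)"
      by (rule nn_integral_cong_AE)
    then show ?thesis using True c0[of l] by simp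
  qed auto
  have "(\<integral>\<^sup>+x. (\<integral>\<^sup>+l. ?f x l \<partial>lborel) \<partial>lborel) = (\<integral>\<^sup>+l. (\<integral>\<^sup>+x. ?f x l \<partial>lborel) \<partial>lborel)"
    by (rule lborel_pair.Fubini'[symmetric]) measurable
  then show ?thesis unfolding 1 2 .
qed

text \<open>
  This is the integral over the positive half line in the definition of the Choquet integral. It
  decides finiteness and equals the whole integral of a nonnegative function.
\<close>

definition choquet_pos :: "'a measure \<Rightarrow> (('a \<Rightarrow> real) \<Rightarrow> ereal) \<Rightarrow> ('a \<Rightarrow> real) \<Rightarrow> ennreal" where
  "choquet_pos M E f = (\<integral>\<^sup>+x\<in>{0..}. e2ennreal (capacity E {\<omega>\<in>space M. f \<omega> > x}) \<partial>lborel)"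

text \<open>
  \<open>T\<close> behaves like the quantile function of \<open>|X|\<close>, read from the top: for almost every \<open>t\<close>, the
  capacity of \<open>|X| > t\<close> is the length of the set of levels \<open>l\<close> in \<open>{0<..<1}\<close> with \<open>T l > t\<close>. What is
  recorded is the consequence that turns the Choquet integral of an increasing function of \<open>|X|\<close>
  into a Lebesgue integral, on which countable sums can be handled.
\<close>

definition is_quantile :: "'a measure \<Rightarrow> (('a \<Rightarrow> real) \<Rightarrow> ereal) \<Rightarrow> ('a \<Rightarrow> real) \<Rightarrow> (real \<Rightarrow> real) \<Rightarrow> bool" where
  "is_quantile M E X T \<longleftrightarrow> T \<in> borel_measurable borel \<and> (\<forall>l. 0 \<le> T l) \<and>
     (\<forall>\<phi>. continuous_on {0..} \<phi> \<longrightarrow> mono_on {0..} \<phi> \<longrightarrow> (\<forall>t\<ge>0. 0 \<le> \<phi> t) \<longrightarrow>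
        choquet_pos M E (\<lambda>\<omega>. \<phi> \<bar>X \<omega>\<bar>) = (\<integral>\<^sup>+l\<in>{0<..<1}. ennreal (\<phi> (T l)) \<partial>lborel))"

lemma is_quantileD:
  assumes "is_quantile M E X T"
  shows "T \<in> borel_measurable borel" "0 \<le> T l"
    and "continuous_on {0..} \<phi> \<Longrightarrow> mono_on {0..} \<phi> \<Longrightarrow> (\<And>t. 0 \<le> t \<Longrightarrow> 0 \<le> \<phi> t) \<Longrightarrow>
      choquet_pos M E (\<lambda>\<omega>. \<phi> \<bar>X \<omega>\<bar>) = (\<integral>\<^sup>+l\<in>{0<..<1}. ennreal (\<phi> (T l)) \<partial>lborel)"
  using assms unfolding is_quantile_def by auto

context sublinear_expectation_space
begin

text \<open>
  In \<open>ereal\<close> the difference \<open>\<infinity> - y\<close> is \<open>\<infinity>\<close>, so the integral over the negative half line can never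
  turn an infinite value into a finite one.
\<close>

lemma choquet_finite_iff_pos: "choquet M E f < \<infinity> \<longleftrightarrow> choquet_pos M E f < \<infinity>"
proof (cases "choquet_pos M E f = \<infinity>")
  case True
  then show ?thesis by (simp add: choquet_def choquet_pos_def)
next
  case False
  then have "enn2ereal (choquet_pos M E f) < \<infinity>" by (simp add: less_top)
  moreover have "enn2ereal (choquet_pos M E f) - enn2ereal J \<le> enn2ereal (choquet_pos M E f)" for J
    using ereal_diff_le_self[of "enn2ereal J" "enn2ereal (choquet_pos M E f)"] by simp
  ultimately have "choquet M E f < \<infinity>"
    unfolding choquet_def choquet_pos_def by (meson le_less_trans)
  with False show ?thesis by (simp add: less_top)
qed

lemma choquet_eq_pos:
  assumes [measurable]: "f \<in> borel_measurable M" and nn: "\<And>\<omega>. \<omega> \<in> space M \<Longrightarrow> 0 \<le> f \<omega>"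
  shows "choquet M E f = enn2ereal (choquet_pos M E f)"
proof -
  have "(\<integral>\<^sup>+x\<in>{..0}. e2ennreal (1 - capacity E {\<omega>\<in>space M. f \<omega> > x}) \<partial>lborel)
      = (\<integral>\<^sup>+x. 0 \<partial>(lborel :: real measure))"
  proof (rule nn_integral_cong_AE)
    have "AE x in lborel. x \<noteq> (0::real)" by (rule AE_lborel_singleton)
    then show "AE x in lborel. e2ennreal (1 - capacity E {\<omega>\<in>space M. f \<omega> > x}) * indicator {..0} x = 0"
    proof eventually_elim
      case (elim x)
      show ?case
      proof (cases "x < 0")
        case True
        then have "{\<omega>\<in>space M. f \<omega> > x} = space M" using nn by force
        then show ?thesis by (simp add: capacity_space e2ennreal_neg)
      qed (use elim in auto)
    qed
  qed
  then show ?thesis unfolding choquet_def choquet_pos_def by (simp add: zero_ennreal.rep_eq)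
qed

lemma capacity_eq_ereal:
  assumes "A \<in> sets M"
  obtains v where "capacity E A = ereal v" "0 \<le> v" "v \<le> 1"
  using capacity_nonneg[OF assms] capacity_le_1[OF assms] by (cases "capacity E A") auto

text \<open>
  The level \<open>l\<close> is exceeded by the capacity of \<open>|X| > t\<close> for \<open>t < T l\<close> and not for \<open>t > T l\<close>, where
  \<open>T l\<close> is the infimum of all \<open>t\<close> at which the capacity is at most \<open>l\<close>; tightness makes this infimum
  finite. Continuity of \<open>\<phi>\<close> carries the dichotomy over to the capacity of \<open>\<phi> |X| > x\<close> with threshold
  \<open>\<phi> (T l)\<close>, and the two ways of slicing give the claim.
\<close>

lemma quantile_representation:
  assumes X[measurable]: "X \<in> borel_measurable M"
    and tight: "\<And>l. 0 < l \<Longrightarrow> \<exists>t\<ge>0. capacity E {\<omega>\<in>space M. \<bar>X \<omega>\<bar> > t} \<le> ereal l"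
  obtains T where "is_quantile M E X T"
proof -
  define G where "G t = capacity E {\<omega>\<in>space M. \<bar>X \<omega>\<bar> > t}" for t :: real
  define S where "S l = {t. 0 \<le> t \<and> G t \<le> ereal l}" for l
  define T where "T l = (if 0 < l then Inf (S l) else 0)" for l
  have G_anti: "G t \<le> G t'" if "t' \<le> t" for t t'
    unfolding G_def using that by (intro capacity_mono) auto
  have ne: "S l \<noteq> {}" if "0 < l" for l using tight[OF that] by (auto simp: S_def G_def)
  have bdd: "bdd_below (S l)" for l by (auto simp: S_def intro: bdd_belowI[of _ 0])
  have T0: "0 \<le> T l" for l
    using ne[of l] by (auto simp: T_def S_def intro!: cInf_greatest)
  have below: "ereal l < G t" if "0 < l" "0 \<le> t" "t < T l" for l t
    using that cInf_lower[OF _ bdd[of l], of t] by (auto simp: T_def S_def not_less[symmetric])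
  have above: "G t \<le> ereal l" if l: "0 < l" "T l < t" for l t
  proof -
    obtain t' where "t' \<in> S l" "t' < t"
      using cInf_lessD[OF ne[OF l(1)], of t] l by (auto simp: T_def)
    then show ?thesis using G_anti[of t' t] by (auto simp: S_def)
  qed
  have T_anti: "T l' \<le> T l" if "0 < l" "l \<le> l'" for l l'
  proof -
    have "Inf (S l') \<le> Inf (S l)"
      using that ne[of l] bdd by (intro cInf_superset_mono) (auto simp: S_def intro: order_trans)
    then show ?thesis using that by (simp add: T_def)
  qed
  \<comment> \<open>\<open>T\<close> is decreasing on the positive half line, hence measurable.\<close>
  have "(\<lambda>l. - T l) \<in> borel_measurable (restrict_space borel {0<..})"
    by (rule borel_measurable_mono_on_fnc) (auto intro!: mono_onI T_anti)
  from borel_measurable_uminus[OF this]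
  have "T \<in> borel_measurable (restrict_space borel {0<..})" by simp
  then have "(\<lambda>l. indicator {0<..} l *\<^sub>R T l) \<in> borel_measurable borel"
    by (subst (asm) borel_measurable_restrict_space_iff) auto
  moreover have "(\<lambda>l. indicator {0<..} l *\<^sub>R T l) = T"
    by (auto simp: T_def indicator_def)
  ultimately have Tm: "T \<in> borel_measurable borel" by simp
  have "is_quantile M E X T"
    unfolding is_quantile_def
  proof (intro conjI allI impI Tm T0)
    fix \<phi> :: "real \<Rightarrow> real"
    assume cont: "continuous_on {0..} \<phi>" and mono: "mono_on {0..} \<phi>" and nn: "\<forall>t\<ge>0. 0 \<le> \<phi> t"
    define A where "A x = {\<omega>\<in>space M. \<phi> \<bar>X \<omega>\<bar> > x}" for x
    have [measurable]: "(\<lambda>\<omega>. \<phi> \<bar>X \<omega>\<bar>) \<in> borel_measurable M"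
    proof -
      have "(\<lambda>t. indicator {0..} t *\<^sub>R \<phi> t) \<in> borel_measurable borel"
        by (rule borel_measurable_continuous_on_indicator) (use cont in auto)
      from measurable_compose[OF _ this, of "\<lambda>\<omega>. \<bar>X \<omega>\<bar>" M] show ?thesis by simp
    qed
    have A[measurable]: "A x \<in> sets M" for x unfolding A_def by measurable
    define w where "w x = real_of_ereal (capacity E (A x))" for x
    have w: "capacity E (A x) = ereal (w x)" "0 \<le> w x" "w x \<le> 1" for x
      using capacity_eq_ereal[OF A[of x]] by (metis real_of_ereal.simps(1) w_def)+
    have wc: "continuous (at (T l) within {0..}) \<phi>" for l
      using cont T0[of l] by (auto simp: continuous_on_eq_continuous_within)
    have key: "(\<integral>\<^sup>+x\<in>{0..}. ennreal (w x) \<partial>lborel) = (\<integral>\<^sup>+l\<in>{0<..<1}. ennreal (\<phi> (T l)) \<partial>lborel)"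
    proof (rule nn_integral_antitone_eq_quantile)
      fix x y :: real assume "x \<le> y"
      then have "capacity E (A y) \<le> capacity E (A x)"
        by (intro capacity_mono A) (auto simp: A_def)
      then show "w y \<le> w x" by (simp add: w)
    next
      fix x l :: real assume l: "0 < l" "l < 1" and x: "0 \<le> x" "x < \<phi> (T l)"
      show "l < w x"
      proof (cases "T l = 0")
        case True
        have "x < \<phi> \<bar>X \<omega>\<bar>" for \<omega>
          using x True mono_onD[OF mono, of 0 "\<bar>X \<omega>\<bar>"] by simp
        then have "A x = space M" by (simp add: A_def)
        then have "w x = 1" using w(1)[of x] by (simp add: capacity_space one_ereal_def)
        then show ?thesis using l by simp
      next
        case False
        then have T: "0 < T l" using T0[of l] by simp
        obtain d where d: "d > 0" "\<And>t. 0 \<le> t \<Longrightarrow> \<bar>t - T l\<bar> < d \<Longrightarrow> \<bar>\<phi> t - \<phi> (T l)\<bar> < \<phi> (T l) - x"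
          using wc[of l, unfolded continuous_within_eps_delta, rule_format, of "\<phi> (T l) - x"] x
          by (auto simp: dist_real_def)
        define t where "t = T l - min (T l) (d/2)"
        have t: "0 \<le> t" "t < T l" "x < \<phi> t"
          using d(2)[of t] d(1) T by (auto simp: t_def min_def split: if_splits)
        have "ereal l < G t" using below l t by simp
        also have "\<dots> \<le> capacity E (A x)"
          unfolding G_def
        proof (intro capacity_mono A)
          show "{\<omega>\<in>space M. \<bar>X \<omega>\<bar> > t} \<subseteq> A x"
          proof
            fix \<omega> assume "\<omega> \<in> {\<omega>\<in>space M. \<bar>X \<omega>\<bar> > t}"
            then show "\<omega> \<in> A x" using t mono_onD[OF mono, of t "\<bar>X \<omega>\<bar>"] by (simp add: A_def)
          qed
        qed measurable
        finally show ?thesis by (simp add: w)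
      qed
    next
      fix x l :: real assume l: "0 < l" "l < 1" and x: "\<phi> (T l) < x"
      obtain d where d: "d > 0" "\<And>t. 0 \<le> t \<Longrightarrow> \<bar>t - T l\<bar> < d \<Longrightarrow> \<bar>\<phi> t - \<phi> (T l)\<bar> < x - \<phi> (T l)"
        using wc[of l, unfolded continuous_within_eps_delta, rule_format, of "x - \<phi> (T l)"] x
        by (auto simp: dist_real_def)
      define t where "t = T l + d/2"
      have t: "0 \<le> t" "T l < t" "\<phi> t < x"
        using d(2)[of t] d(1) T0[of l] by (auto simp: t_def)
      have "capacity E (A x) \<le> G t"
        unfolding G_def
      proof (intro capacity_mono A)
        show "A x \<subseteq> {\<omega>\<in>space M. \<bar>X \<omega>\<bar> > t}"
        proof
          fix \<omega> assume "\<omega> \<in> A x"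
          then show "\<omega> \<in> {\<omega>\<in>space M. \<bar>X \<omega>\<bar> > t}"
            using t mono_onD[OF mono, of "\<bar>X \<omega>\<bar>" t] by (auto simp: A_def not_less[symmetric])
        qed
      qed measurable
      also have "\<dots> \<le> ereal l" using above l t by simp
      finally show "w x \<le> l" by (simp add: w)
    qed (use w nn T0 in auto)
    then show "choquet_pos M E (\<lambda>\<omega>. \<phi> \<bar>X \<omega>\<bar>) = (\<integral>\<^sup>+l\<in>{0<..<1}. ennreal (\<phi> (T l)) \<partial>lborel)"
      unfolding choquet_pos_def A_def[symmetric] w(1) by simp
  qed
  then show ?thesis by (rule that)
qed

lemma capacity_tail_measurable:
  fixes f :: "'a \<Rightarrow> real"
  assumes [measurable]: "f \<in> borel_measurable M"
  shows "(\<lambda>x. e2ennreal (capacity E {\<omega>\<in>space M. f \<omega> > x})) \<in> borel_measurable borel"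
proof -
  define w where "w x = real_of_ereal (capacity E {\<omega>\<in>space M. f \<omega> > x})" for x
  have m: "{\<omega>\<in>space M. f \<omega> > x} \<in> sets M" for x by measurable
  have w: "capacity E {\<omega>\<in>space M. f \<omega> > x} = ereal (w x)" for x
    using capacity_eq_ereal[OF m[of x]] by (metis real_of_ereal.simps(1) w_def)
  have "w y \<le> w x" if "x \<le> y" for x y
  proof -
    have "ereal (w y) \<le> ereal (w x)" unfolding w[symmetric] using that by (intro capacity_mono m) auto
    then show ?thesis by simp
  qed
  then have "mono (\<lambda>x. - w x)" by (auto simp: mono_def)
  then have "(\<lambda>x. - w x) \<in> borel_measurable borel" by (rule borel_measurable_mono)
  from borel_measurable_uminus[OF this] have [measurable]: "w \<in> borel_measurable borel" by simp
  show ?thesis unfolding w by simp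
qed

text \<open>
  A bound on tails integrates to a bound on Choquet integrals; the Choquet integral itself need not
  be subadditive.
\<close>

lemma choquet_pos_bound:
  assumes f: "f \<in> borel_measurable M" and g: "\<And>i. i \<in> I \<Longrightarrow> g i \<in> borel_measurable M"
    and I: "finite I" and h[measurable]: "h \<in> borel_measurable borel" and h0: "\<And>x. 0 \<le> x \<Longrightarrow> 0 \<le> h x"
    and le: "\<And>x. 0 \<le> x \<Longrightarrow> capacity E {\<omega>\<in>space M. f \<omega> > x} \<le>
       (\<Sum>i\<in>I. capacity E {\<omega>\<in>space M. g i \<omega> > x}) + ereal (h x)"
  shows "choquet_pos M E f \<le> (\<Sum>i\<in>I. choquet_pos M E (g i)) + (\<integral>\<^sup>+x\<in>{0..}. ennreal (h x) \<partial>lborel)"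
proof -
  let ?G = "\<lambda>i x. e2ennreal (capacity E {\<omega>\<in>space M. g i \<omega> > x})"
  have m: "{\<omega>\<in>space M. g i \<omega> > x} \<in> sets M" if "i \<in> I" for i x
    using g[OF that] by measurable
  have [measurable]: "?G i \<in> borel_measurable borel" if "i \<in> I" for i
    by (rule capacity_tail_measurable[OF g[OF that]])
  have pt: "e2ennreal (capacity E {\<omega>\<in>space M. f \<omega> > x}) \<le> (\<Sum>i\<in>I. ?G i x) + ennreal (h x)" if x: "0 \<le> x" for x
  proof -
    define v where "v i = real_of_ereal (capacity E {\<omega>\<in>space M. g i \<omega> > x})" for i
    have v: "capacity E {\<omega>\<in>space M. g i \<omega> > x} = ereal (v i)" "0 \<le> v i" if "i \<in> I" for i
      using capacity_eq_ereal[OF m[OF that, of x]] by (metis real_of_ereal.simps(1) v_def)+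
    have "capacity E {\<omega>\<in>space M. f \<omega> > x} \<le> ereal ((\<Sum>i\<in>I. v i) + h x)"
    proof -
      have "(\<Sum>i\<in>I. capacity E {\<omega>\<in>space M. g i \<omega> > x}) = ereal (\<Sum>i\<in>I. v i)" using v by simp
      then show ?thesis using le[OF x] by simp
    qed
    then have "e2ennreal (capacity E {\<omega>\<in>space M. f \<omega> > x}) \<le> ennreal ((\<Sum>i\<in>I. v i) + h x)"
      using e2ennreal_mono by fastforce
    also have "\<dots> = (\<Sum>i\<in>I. ennreal (v i)) + ennreal (h x)"
      using v h0[OF x] by (simp add: sum_nonneg sum_ennreal)
    also have "\<dots> = (\<Sum>i\<in>I. ?G i x) + ennreal (h x)" using v by simp
    finally show ?thesis .
  qed
  have "choquet_pos M E f \<le> (\<integral>\<^sup>+x. (\<Sum>i\<in>I. ?G i x * indicator {0..} x) + ennreal (h x) * indicator {0..} x \<partial>lborel)"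
    unfolding choquet_pos_def using pt
    by (intro nn_integral_mono) (auto simp: indicator_def)
  also have "\<dots> = (\<integral>\<^sup>+x. (\<Sum>i\<in>I. ?G i x * indicator {0..} x) \<partial>lborel) + (\<integral>\<^sup>+x\<in>{0..}. ennreal (h x) \<partial>lborel)"
    by (intro nn_integral_add borel_measurable_sum) auto
  also have "(\<integral>\<^sup>+x. (\<Sum>i\<in>I. ?G i x * indicator {0..} x) \<partial>lborel) = (\<Sum>i\<in>I. choquet_pos M E (g i))"
    unfolding choquet_pos_def by (intro nn_integral_sum) auto
  finally show ?thesis .
qed

lemma choquet_pos_mono:
  assumes f[measurable]: "f \<in> borel_measurable M" and g[measurable]: "g \<in> borel_measurable M"
    and le: "\<And>\<omega>. \<omega> \<in> space M \<Longrightarrow> f \<omega> \<le> g \<omega>"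
  shows "choquet_pos M E f \<le> choquet_pos M E g"
  unfolding choquet_pos_def
proof (intro nn_integral_mono mult_right_mono e2ennreal_mono capacity_mono)
  fix x show "{\<omega>\<in>space M. f \<omega> > x} \<subseteq> {\<omega>\<in>space M. g \<omega> > x}" using le by force
qed auto

lemma choquet_pos_cong_tail:
  assumes "\<And>x. 0 \<le> x \<Longrightarrow> capacity E {\<omega>\<in>space M. f \<omega> > x} = capacity E {\<omega>\<in>space M. g \<omega> > x}"
  shows "choquet_pos M E f = choquet_pos M E g"
  unfolding choquet_pos_def using assms by (intro nn_integral_cong) (auto simp: indicator_def)

lemma choquet_pos_markov:
  assumes [measurable]: "f \<in> borel_measurable M" and x: "0 \<le> x"
  shows "ennreal x * e2ennreal (capacity E {\<omega>\<in>space M. f \<omega> > x}) \<le> choquet_pos M E f"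
proof -
  let ?W = "\<lambda>x. e2ennreal (capacity E {\<omega>\<in>space M. f \<omega> > x})"
  have "ennreal x * ?W x = (\<integral>\<^sup>+y. ?W x * indicator {0..<x} y \<partial>lborel)"
    using x by (subst nn_integral_cmult_indicator) (auto simp: mult.commute)
  also have "\<dots> \<le> choquet_pos M E f"
    unfolding choquet_pos_def
  proof (intro nn_integral_mono)
    fix y :: real
    have "?W x \<le> ?W y" if "y \<le> x" using that by (intro e2ennreal_mono capacity_mono) auto
    then show "?W x * indicator {0..<x} y \<le> ?W y * indicator {0..} y"
      by (auto simp: indicator_def)
  qed
  finally show ?thesis .
qed

text \<open>
  Markov inequality for \<open>\<phi> |X|\<close>; coercivity of \<open>\<phi>\<close> transfers it to \<open>|X|\<close>.
\<close>

lemma tight_of_choquet_pos: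
  fixes X :: "'a \<Rightarrow> real" and \<phi> :: "real \<Rightarrow> real"
  assumes [measurable]: "X \<in> borel_measurable M" "(\<lambda>\<omega>. \<phi> \<bar>X \<omega>\<bar>) \<in> borel_measurable M"
    and fin: "choquet_pos M E (\<lambda>\<omega>. \<phi> \<bar>X \<omega>\<bar>) < \<infinity>"
    and coercive: "\<And>x. \<exists>t\<ge>0. \<forall>u>t. x < \<phi> u" and l: "0 < l"
  shows "\<exists>t\<ge>0. capacity E {\<omega>\<in>space M. \<bar>X \<omega>\<bar> > t} \<le> ereal l"
proof -
  obtain I where I: "choquet_pos M E (\<lambda>\<omega>. \<phi> \<bar>X \<omega>\<bar>) = ennreal I" "0 \<le> I"
    using fin by (cases "choquet_pos M E (\<lambda>\<omega>. \<phi> \<bar>X \<omega>\<bar>)") auto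
  define x where "x = I / l + 1"
  have x: "0 < x" using I l by (simp add: x_def add_nonneg_pos)
  obtain t where t: "0 \<le> t" "\<And>u. t < u \<Longrightarrow> x < \<phi> u" using coercive by blast
  let ?A = "{\<omega>\<in>space M. \<phi> \<bar>X \<omega>\<bar> > x}"
  have A: "?A \<in> sets M" by measurable
  obtain v where v: "capacity E ?A = ereal v" "0 \<le> v" using capacity_eq_ereal[OF A] .
  have "ennreal x * ennreal v \<le> ennreal I"
    using choquet_pos_markov[of "\<lambda>\<omega>. \<phi> \<bar>X \<omega>\<bar>" x] x v I by simp
  then have "x * v \<le> I" using x v I by (simp flip: ennreal_mult)
  also have "\<dots> \<le> x * l" using l by (simp add: x_def field_simps)
  finally have "v \<le> l" using x by simp
  moreover have "capacity E {\<omega>\<in>space M. \<bar>X \<omega>\<bar> > t} \<le> capacity E ?A"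
    using t by (intro capacity_mono A) auto
  ultimately show ?thesis using t v by (intro exI[of _ t]) (auto intro: order_trans)
qed

end

section \<open>A maximal inequality for independent sequences\<close>

definition crossed :: "(nat \<Rightarrow> real \<Rightarrow> real) \<Rightarrow> real \<Rightarrow> nat \<Rightarrow> (nat \<Rightarrow> real) \<Rightarrow> bool" where
  "crossed h c n x \<longleftrightarrow> (\<exists>k\<in>{1..n}. (\<Prod>i=1..k. h i (x i)) > c)"

lemma crossed_Suc: "crossed h c (Suc n) x \<longleftrightarrow> crossed h c n x \<or> (\<Prod>i=1..Suc n. h i (x i)) > c"
  unfolding crossed_def by (metis atLeastAtMost_iff le_Suc_eq le_add1 plus_1_eq_Suc)

lemma crossed_cong:
  assumes "\<And>i. i \<in> {1..n} \<Longrightarrow> x i = y i"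
  shows "crossed h c n x = crossed h c n y"
proof -
  have "(\<Prod>i=1..k. h i (x i)) = (\<Prod>i=1..k. h i (y i))" if "k \<in> {1..n}" for k
    using assms that by (intro prod.cong) auto
  then show ?thesis unfolding crossed_def by auto
qed

lemma crossed_measurable:
  assumes "\<And>i. h i \<in> borel_measurable borel"
    and "\<And>i. i \<in> {1..n} \<Longrightarrow> (\<lambda>\<omega>. x \<omega> i) \<in> borel_measurable N"
  shows "{\<omega>\<in>space N. crossed h c n (x \<omega>)} \<in> sets N"
proof -
  have m: "(\<lambda>\<omega>. \<Prod>i=1..k. h i (x \<omega> i)) \<in> borel_measurable N" if "k \<in> {1..n}" for k
    using assms that by (intro borel_measurable_prod measurable_compose[of _ N borel "h _"]) auto
  have "{\<omega>\<in>space N. c < (\<Prod>i=1..k. h i (x \<omega> i))} \<in> sets N" if "k \<in> {1..n}" for k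
    by (rule borel_measurable_less[OF borel_measurable_const m[OF that]])
  then show ?thesis unfolding crossed_def by (intro sets.sets_Collect_finite_Ex) auto
qed

text \<open>
  The running product is frozen once a partial product has exceeded \<open>c\<close>. Freezing keeps the final
  value above \<open>c\<close> on the event that the running maximum exceeds \<open>c\<close>, so the maximum is controlled by
  one expectation.
\<close>

fun stopped_prod :: "(nat \<Rightarrow> real \<Rightarrow> real) \<Rightarrow> real \<Rightarrow> nat \<Rightarrow> (nat \<Rightarrow> real) \<Rightarrow> real" where
  "stopped_prod h c 0 x = 1"
| "stopped_prod h c (Suc n) x =
     stopped_prod h c n x * (if crossed h c n x then 1 else h (Suc n) (x (Suc n)))"

lemma stopped_prod_nonneg:
  "(\<And>i t. 0 \<le> h i t) \<Longrightarrow> 0 \<le> stopped_prod h c n x"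
  by (induction n) auto

lemma stopped_prod_not_crossed:
  "\<not> crossed h c n x \<Longrightarrow> stopped_prod h c n x = (\<Prod>i=1..n. h i (x i))"
  by (induction n) (auto simp: crossed_Suc)

lemma stopped_prod_crossed: "crossed h c n x \<Longrightarrow> stopped_prod h c n x > c"
proof (induction n)
  case (Suc n)
  then show ?case
    using stopped_prod_not_crossed[of h c n x] by (auto simp: crossed_Suc)
qed (simp add: crossed_def)

lemma stopped_prod_cong:
  "(\<And>i. i \<in> {1..n} \<Longrightarrow> x i = y i) \<Longrightarrow> stopped_prod h c n x = stopped_prod h c n y"
proof (induction n)
  case (Suc n)
  then show ?case using crossed_cong[of n x y h c] by simp
qed simp

lemma stopped_prod_measurable:
  assumes h: "\<And>i. h i \<in> borel_measurable borel"
    and x: "\<And>i. i \<in> {1..n} \<Longrightarrow> (\<lambda>\<omega>. x \<omega> i) \<in> borel_measurable N"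
  shows "(\<lambda>\<omega>. stopped_prod h c n (x \<omega>)) \<in> borel_measurable N"
  using x
proof (induction n)
  case (Suc n)
  have [measurable]: "Measurable.pred N (\<lambda>\<omega>. crossed h c n (x \<omega>))"
    unfolding pred_def by (rule crossed_measurable[OF h]) (use Suc.prems in auto)
  have [measurable]: "(\<lambda>\<omega>. h (Suc n) (x \<omega> (Suc n))) \<in> borel_measurable N"
    by (rule measurable_compose[OF _ h]) (rule Suc.prems, simp)
  have [measurable]: "(\<lambda>\<omega>. stopped_prod h c n (x \<omega>)) \<in> borel_measurable N"
    by (rule Suc.IH) (use Suc.prems in auto)
  show ?case by simp
qed simp

context sublinear_expectation_space
begin

text \<open>
  The inequality of Ville for the nonnegative supermartingale \<open>h 1 (X 1) \<dots> h k (X k)\<close>. Given the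
  first \<open>n
\<close>
  variables, the next factor of the stopped product is \<open>1\<close> if stopping has occurred and has expectation at most \<open>1\<close>
  otherwise; as the product so far is nonnegative, positive homogeneity lets independence conclude that
  the expectation of the stopped product never increases.\<close>

lemma stopped_prod_maximal_inequality:
  assumes indep: "indep_seq H E Xs" and Xs: "\<And>n. n \<ge> 1 \<Longrightarrow> Xs n \<in> H"
    and h[measurable]: "\<And>i. h i \<in> borel_measurable borel" and h0: "\<And>i t. 0 \<le> h i t"
    and hH: "\<And>i. i \<ge> 1 \<Longrightarrow> (\<lambda>\<omega>. h i (Xs i \<omega>)) \<in> H"
    and h1: "\<And>i. i \<ge> 1 \<Longrightarrow> E (\<lambda>\<omega>. h i (Xs i \<omega>)) \<le> 1"
    and c: "0 < c"
  shows "ereal c * capacity E {\<omega>\<in>space M. \<exists>k\<in>{1..n}. (\<Prod>i=1..k. h i (Xs i \<omega>)) > c} \<le> 1"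
proof -
  have Xm: "i \<in> {1..n} \<Longrightarrow> Xs i \<in> borel_measurable M" for i n using H_meas Xs by auto
  define W where "W n \<omega> = stopped_prod h c n (\<lambda>i. Xs i \<omega>)" for n \<omega>
  define S where "S n = {\<omega>\<in>space M. crossed h c n (\<lambda>i. Xs i \<omega>)}" for n
  have S[measurable]: "S n \<in> sets M" for n unfolding S_def by (rule crossed_measurable[OF h]) (use Xm in auto)
  have W_Suc: "W (Suc n) \<omega> = W n \<omega> * (indicator (S n) \<omega> + indicator (space M - S n) \<omega> * h (Suc n) (Xs (Suc n) \<omega>))"
    if "\<omega> \<in> space M" for n \<omega>
    using that by (auto simp: W_def S_def indicator_def)
  have WH: "W n \<in> H" for n
  proof (induction n)
    case 0 then show ?case by (simp add: W_def[abs_def])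
  next
    case (Suc n)
    have "(\<lambda>\<omega>. W n \<omega> * (indicator (S n) \<omega> + indicator (space M - S n) \<omega> * h (Suc n) (Xs (Suc n) \<omega>))) \<in> H"
      by (intro H_mult H_add Suc H_indicator hH) auto
    then show ?case by (rule H_cong) (simp add: W_Suc)
  qed
  have W0: "0 \<le> W n \<omega>" for n \<omega> unfolding W_def by (rule stopped_prod_nonneg[OF h0])
  have EW: "E (W n) \<le> 1" for n
  proof (induction n)
    case 0 then show ?case using E_const[of 1] by (simp add: W_def[abs_def] one_ereal_def)
  next
    case (Suc n)
    show ?case
    proof (cases "n = 0")
      case True
      then have "W (Suc n) = (\<lambda>\<omega>. h 1 (Xs 1 \<omega>))" by (auto simp: W_def crossed_def fun_eq_iff)
      then show ?thesis using h1[of 1] by simp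
    next
      case False
      \<comment> \<open>The stopped product after \<open>n + 1\<close> steps as a function of the past \<open>x\<close> and of the new variable \<open>y 1\<close>.\<close>
      define \<psi> :: "(nat \<Rightarrow> real) \<times> (nat \<Rightarrow> real) \<Rightarrow> real"
        where "\<psi> = (\<lambda>(x, y). stopped_prod h c n x * (if crossed h c n x then 1 else h (Suc n) (y 1)))"
      define e where "e = real_of_ereal (E (\<lambda>\<omega>. h (Suc n) (Xs (Suc n) \<omega>)))"
      have "0 \<le> E (\<lambda>\<omega>. h (Suc n) (Xs (Suc n) \<omega>))"
        using E_ge_const[OF hH[of "Suc n"], of 0] h0 by (simp add: zero_ereal_def)
      with h1[of "Suc n"] have e: "E (\<lambda>\<omega>. h (Suc n) (Xs (Suc n) \<omega>)) = ereal e" "0 \<le> e" "e \<le> 1"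
        by (cases "E (\<lambda>\<omega>. h (Suc n) (Xs (Suc n) \<omega>))"; auto simp: e_def)+
      have cong: "stopped_prod h c n (rvec n Xs \<omega>) = W n \<omega>"
        "crossed h c n (rvec n Xs \<omega>) \<longleftrightarrow> crossed h c n (\<lambda>i. Xs i \<omega>)" for \<omega>
      proof -
        show "stopped_prod h c n (rvec n Xs \<omega>) = W n \<omega>"
          unfolding W_def by (rule stopped_prod_cong) (auto simp: rvec_def)
        show "crossed h c n (rvec n Xs \<omega>) \<longleftrightarrow> crossed h c n (\<lambda>i. Xs i \<omega>)"
          by (rule crossed_cong) (auto simp: rvec_def)
      qed
      let ?Y = "rvec 1 (\<lambda>_. Xs (n + 1))"
      have Y: "?Y \<omega> 1 = Xs (Suc n) \<omega>" for \<omega> by (simp add: rvec_def)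
      have comp: "i \<in> {1..n} \<Longrightarrow> (\<lambda>z. fst z i) \<in> borel_measurable (borel_vec n \<Otimes>\<^sub>M borel_vec 1)" for i
        by (rule measurable_compose[OF measurable_fst]) simp
      have \<psi>_meas: "\<psi> \<in> borel_measurable (borel_vec n \<Otimes>\<^sub>M borel_vec 1)"
      proof -
        let ?N = "borel_vec n \<Otimes>\<^sub>M borel_vec 1"
        have [measurable]: "(\<lambda>z. stopped_prod h c n (fst z)) \<in> borel_measurable ?N"
          by (rule stopped_prod_measurable[OF h]) (rule comp)
        have [measurable]: "Measurable.pred ?N (\<lambda>z. crossed h c n (fst z))"
          unfolding pred_def by (rule crossed_measurable[OF h]) (rule comp)
        have [measurable]: "(\<lambda>z. snd z 1) \<in> borel_measurable ?N"
          by (rule measurable_compose[OF measurable_snd]) simp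
        have "(\<lambda>z. stopped_prod h c n (fst z) * (if crossed h c n (fst z) then 1 else h (Suc n) (snd z 1))) \<in> borel_measurable ?N"
          by measurable
        then show ?thesis by (simp add: \<psi>_def case_prod_beta')
      qed
      have \<psi>0: "0 \<le> \<psi> z" for z
        unfolding \<psi>_def using h0 by (auto split: prod.splits intro!: mult_nonneg_nonneg stopped_prod_nonneg)
      have \<psi>H: "(\<lambda>\<omega>. \<psi> (x, ?Y \<omega>)) \<in> H" for x
        using H_cmult[OF hH[of "Suc n"]] unfolding \<psi>_def prod.case Y by (cases "crossed h c n x") auto
      have inner: "E (\<lambda>\<omega>. \<psi> (x, ?Y \<omega>)) = ereal (stopped_prod h c n x * (if crossed h c n x then 1 else e))" for x
      proof (cases "crossed h c n x")
        case True then show ?thesis by (simp add: \<psi>_def E_const)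
      next
        case False
        have "E (\<lambda>\<omega>. stopped_prod h c n x * h (Suc n) (Xs (Suc n) \<omega>)) = ereal (stopped_prod h c n x) * ereal e"
          using E_pos_homogeneous[OF hH[of "Suc n"] stopped_prod_nonneg[OF h0]] e by simp
        with False show ?thesis unfolding \<psi>_def prod.case Y by simp
      qed
      \<comment> \<open>\<open>Z\<close> is the inner expectation evaluated at the past. It is an algebraic expression in members of \<open>H\<close>,
        which gives the membership conditions of independence.\<close>
      define Z where "Z \<omega> = W n \<omega> * (if crossed h c n (\<lambda>i. Xs i \<omega>) then 1 else e)" for \<omega>
      have Zeq: "Z = (\<lambda>\<omega>. real_of_ereal (E (\<lambda>\<omega>'. \<psi> (rvec n Xs \<omega>, ?Y \<omega>'))))"
        unfolding inner cong Z_def by simp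
      have "(\<lambda>\<omega>. W n \<omega> * (indicator (S n) \<omega> + e * indicator (space M - S n) \<omega>)) \<in> H"
        by (intro H_mult H_add H_cmult WH H_indicator) auto
      then have ZH: "Z \<in> H" by (rule H_cong) (auto simp: Z_def S_def indicator_def)
      have Z0: "0 \<le> Z \<omega>" for \<omega> unfolding Z_def using W0 e by auto
      have ZW: "Z \<omega> \<le> W n \<omega>" for \<omega> unfolding Z_def using W0[of n \<omega>] e
        by (auto intro: mult_left_le)
      have EZ: "E Z \<le> 1" using E_mono[OF WH ZH ZW] Suc by (rule order_trans)
      have WSuc: "(\<lambda>\<omega>. \<psi> (rvec n Xs \<omega>, ?Y \<omega>)) = W (Suc n)"
        unfolding \<psi>_def prod.case Y cong by (simp add: W_def[abs_def])
      have "indep_vec H E 1 (\<lambda>_. Xs (n + 1)) n Xs" using indep False by (auto simp: indep_seq_def)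
      note D = this[unfolded indep_vec_def Let_def, THEN bspec, OF \<psi>_meas]
      have "E (W (Suc n)) = E Z"
        unfolding WSuc[symmetric] Zeq
      proof (rule D[THEN mp, THEN mp, THEN mp, THEN mp, THEN mp, THEN mp])
        have abs: "\<bar>\<psi> z\<bar> = \<psi> z" for z using \<psi>0[of z] by simp
        have absZ: "\<bar>Z \<omega>\<bar> = Z \<omega>" for \<omega> using Z0[of \<omega>] by simp
        show "(\<lambda>\<omega>. \<psi> (rvec n Xs \<omega>, ?Y \<omega>)) \<in> H" unfolding WSuc by (rule WH)
        show "\<forall>x\<in>space (borel_vec n). (\<lambda>\<omega>. \<psi> (x, ?Y \<omega>)) \<in> H" using \<psi>H by blast
        show "\<forall>x\<in>space (borel_vec n). E (\<lambda>\<omega>. \<bar>\<psi> (x, ?Y \<omega>)\<bar>) < \<infinity>" unfolding abs inner by simp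
        show Z': "(\<lambda>\<omega>. real_of_ereal (E (\<lambda>\<omega>'. \<bar>\<psi> (rvec n Xs \<omega>, ?Y \<omega>')\<bar>))) \<in> H"
          unfolding abs Zeq[symmetric] by (rule ZH)
        show "E (\<lambda>\<omega>. \<bar>real_of_ereal (E (\<lambda>\<omega>'. \<bar>\<psi> (rvec n Xs \<omega>, ?Y \<omega>')\<bar>))\<bar>) < \<infinity>"
          using EZ unfolding abs fun_cong[OF Zeq, symmetric] absZ by auto
        show "(\<lambda>\<omega>. real_of_ereal (E (\<lambda>\<omega>'. \<psi> (rvec n Xs \<omega>, ?Y \<omega>')))) \<in> H"
          unfolding Zeq[symmetric] by (rule ZH)
      qed
      then show ?thesis using EZ by simp
    qed
  qed
  have "ereal c * capacity E (S n) = E (\<lambda>\<omega>. c * indicator (S n) \<omega>)"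
    unfolding capacity_def using c by (intro E_pos_homogeneous[symmetric] H_indicator) auto
  also have "\<dots> \<le> E (W n)"
  proof (intro E_mono WH H_cmult H_indicator S)
    fix \<omega> show "c * indicator (S n) \<omega> \<le> W n \<omega>"
      using stopped_prod_crossed[of h c n "\<lambda>i. Xs i \<omega>"] W0[of n \<omega>]
      by (auto simp: S_def W_def indicator_def)
  qed
  also have "\<dots> \<le> 1" by (rule EW)
  finally show ?thesis by (simp add: S_def crossed_def)
qed

end

section \<open>Maximal bound for weighted sums\<close>

definition clamp_to :: "real \<Rightarrow> real \<Rightarrow> real" where
  "clamp_to z t = max (- z) (min z t)"

lemma clamp_to_measurable [measurable]: "clamp_to z \<in> borel_measurable borel"
  unfolding clamp_to_def[abs_def] by measurable

lemma abs_clamp_to_le: "0 \<le> z \<Longrightarrow> \<bar>clamp_to z t\<bar> \<le> z" "0 \<le> z \<Longrightarrow> \<bar>clamp_to z t\<bar> \<le> \<bar>t\<bar>"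
  by (auto simp: clamp_to_def)

lemma clamp_to_id: "\<bar>t\<bar> \<le> z \<Longrightarrow> clamp_to z t = t"
  by (auto simp: clamp_to_def)

lemma clamp_to_le: "clamp_to z t \<le> t + max 0 (\<bar>t\<bar> - z)"
  by (auto simp: clamp_to_def)

lemma clamp_to_lipschitz: "\<bar>clamp_to z s - clamp_to z t\<bar> \<le> \<bar>s - t\<bar>"
  by (auto simp: clamp_to_def)

text \<open>
  Taylor expansion of order one, where \<open>|v| / w \<le> 1\<close> allows the exponent to be lowered to \<open>\<theta>\<close>; the
  spare factor \<open>w\<close> is absorbed by a second \<open>exp w\<close>.
\<close>

lemma exp_le_1_plus_powr:
  fixes v w \<theta> :: real
  assumes w: "0 < w" and v: "\<bar>v\<bar> \<le> w" and \<theta>: "0 < \<theta>" "\<theta> \<le> 1"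
  shows "exp v \<le> 1 + exp (2 * w) * (\<bar>v\<bar> / w) powr \<theta>"
proof -
  obtain t where t: "\<bar>t\<bar> \<le> \<bar>v\<bar>" "exp v = 1 + exp t * v"
    using Maclaurin_exp_le[of v 1] by auto
  have "exp t * v \<le> exp t * \<bar>v\<bar>" by simp
  also have "\<dots> \<le> exp w * \<bar>v\<bar>"
    using t v by (intro mult_right_mono) auto
  also have "\<dots> = exp w * w * (\<bar>v\<bar> / w)" using w by simp
  also have "\<dots> \<le> exp w * exp w * (\<bar>v\<bar> / w) powr \<theta>"
  proof (intro mult_mono)
    show "w \<le> exp w" using exp_ge_add_one_self[of w] by linarith
    show "\<bar>v\<bar> / w \<le> (\<bar>v\<bar> / w) powr \<theta>"
      using powr_mono'[of \<theta> 1 "\<bar>v\<bar> / w"] w v \<theta> by (auto simp: divide_simps)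
  qed (use w in auto)
  finally show ?thesis using t by (simp flip: exp_add mult_2)
qed

text \<open>The analogue of order two. The linear term is kept, to be cancelled by a vanishing mean.\<close>

lemma exp_le_1_plus_id_plus_powr:
  fixes v w \<theta> :: real
  assumes w: "0 < w" and v: "\<bar>v\<bar> \<le> w" and \<theta>: "0 < \<theta>" "\<theta> \<le> 2"
  shows "exp v \<le> 1 + v + exp (2 * w) * (\<bar>v\<bar> / w) powr \<theta>"
proof -
  obtain t where t: "\<bar>t\<bar> \<le> \<bar>v\<bar>" "exp v = 1 + v + exp t / 2 * v\<^sup>2"
    using Maclaurin_exp_le[of v 2] by (auto simp: numeral_2_eq_2)
  have "exp t / 2 * v\<^sup>2 \<le> exp w / 2 * v\<^sup>2"
    using t v by (intro mult_right_mono) auto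
  also have "\<dots> = exp w * (w\<^sup>2 / 2) * (\<bar>v\<bar> / w)\<^sup>2" using w by (simp add: power_divide)
  also have "\<dots> \<le> exp w * exp w * (\<bar>v\<bar> / w) powr \<theta>"
  proof (intro mult_mono)
    show "w\<^sup>2 / 2 \<le> exp w" using exp_lower_Taylor_quadratic[of w] w by simp
    show "(\<bar>v\<bar> / w)\<^sup>2 \<le> (\<bar>v\<bar> / w) powr \<theta>"
    proof (cases "v = 0")
      case False
      then have "(\<bar>v\<bar> / w)\<^sup>2 = (\<bar>v\<bar> / w) powr 2" using w by (simp add: powr_numeral)
      also have "\<dots> \<le> (\<bar>v\<bar> / w) powr \<theta>"
        using powr_mono'[of \<theta> 2 "\<bar>v\<bar> / w"] w v \<theta> by (auto simp: divide_simps)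
      finally show ?thesis .
    qed simp
  qed (use w in auto)
  finally show ?thesis using t by (simp flip: exp_add mult_2)
qed

text \<open>
  \<open>\<kappa>\<close> plays the role of the moment of \<open>|X|\<close> of order \<open>\<theta>\<close>. The function \<open>|X| powr \<theta>\<close> need not belong
  to \<open>H\<close>, where \<open>E\<close> is meaningful, so the bound is stated for the members of \<open>H\<close> that it dominates.
\<close>

definition dominated_moment ::
    "'a measure \<Rightarrow> ('a \<Rightarrow> real) set \<Rightarrow> (('a \<Rightarrow> real) \<Rightarrow> ereal) \<Rightarrow> ('a \<Rightarrow> real) \<Rightarrow> real \<Rightarrow> real \<Rightarrow> bool" where
  "dominated_moment M H E X \<theta> \<kappa> \<longleftrightarrow> 0 \<le> \<kappa> \<and> (\<forall>Z\<in>H. \<forall>B\<ge>0.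
     (\<forall>\<omega>\<in>space M. 0 \<le> Z \<omega> \<and> Z \<omega> \<le> B * \<bar>X \<omega>\<bar> powr \<theta>) \<longrightarrow> E Z \<le> ereal (B * \<kappa>))"

lemma dominated_momentD:
  assumes "dominated_moment M H E X \<theta> \<kappa>"
  shows "0 \<le> \<kappa>"
    and "Z \<in> H \<Longrightarrow> 0 \<le> B \<Longrightarrow> (\<And>\<omega>. \<omega> \<in> space M \<Longrightarrow> 0 \<le> Z \<omega> \<and> Z \<omega> \<le> B * \<bar>X \<omega>\<bar> powr \<theta>)
      \<Longrightarrow> E Z \<le> ereal (B * \<kappa>)"
  using assms unfolding dominated_moment_def by auto

context sublinear_expectation_space
begin

text \<open>
  The power \<open>|X| powr \<theta>\<close> is at most \<open>1\<close> plus the sum over \<open>j\<close> of \<open>2 powr ((j + 1) \<theta>)\<close> times the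
  indicator of \<open>|X| > 2\<^sup>j\<close>. The terms are multiples of indicators, hence in \<open>H\<close>, and by the tail
  bound their expectations form a geometric series with ratio \<open>2 powr (\<theta> - s) < 1\<close>. Countable
  subadditivity of \<open>E\<close> does the rest.
\<close>

lemma dominated_moment_of_tail:
  assumes csub: "countably_subadditive_expectation M H E" and XH: "X \<in> H"
    and tail: "\<And>t. 1 \<le> t \<Longrightarrow> capacity E {\<omega>\<in>space M. \<bar>X \<omega>\<bar> > t} \<le> ereal (K * t powr - s)"
    and K: "0 \<le> K" and \<theta>: "0 < \<theta>" "\<theta> < s"
  obtains \<kappa> where "dominated_moment M H E X \<theta> \<kappa>"
proof -
  define \<rho> where "\<rho> = 2 powr (\<theta> - s)"
  have \<rho>: "0 < \<rho>" "\<rho> < 1" using \<theta> powr_less_mono[of "\<theta> - s" 0 2] by (auto simp: \<rho>_def)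
  define \<kappa> where "\<kappa> = 1 + K * 2 powr \<theta> / (1 - \<rho>)"
  have "dominated_moment M H E X \<theta> \<kappa>"
    unfolding dominated_moment_def
  proof (intro conjI ballI allI impI)
    show "0 \<le> \<kappa>" using K \<rho> by (simp add: \<kappa>_def)
    fix Z B assume ZH: "Z \<in> H" and B: "0 \<le> B"
      and "\<forall>\<omega>\<in>space M. 0 \<le> Z \<omega> \<and> Z \<omega> \<le> B * \<bar>X \<omega>\<bar> powr \<theta>"
    then have Z: "\<And>\<omega>. \<omega> \<in> space M \<Longrightarrow> 0 \<le> Z \<omega> \<and> Z \<omega> \<le> B * \<bar>X \<omega>\<bar> powr \<theta>" by blast
    have [measurable]: "X \<in> borel_measurable M" by (rule H_meas[OF XH])
    define A where "A j = {\<omega>\<in>space M. \<bar>X \<omega>\<bar> > 2 ^ j}" for j :: nat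
    have A: "A j \<in> sets M" for j unfolding A_def by measurable
    define Y where "Y n \<omega> = (case n of 0 \<Rightarrow> B | Suc j \<Rightarrow> B * (2 ^ Suc j) powr \<theta> * indicator (A j) \<omega>)"
      for n and \<omega> :: 'a
    define f where "f n = (case n of 0 \<Rightarrow> B | Suc j \<Rightarrow> B * K * 2 powr \<theta> * \<rho> ^ j)" for n
    have YH: "Y n \<in> H" for n
      unfolding Y_def[abs_def] by (cases n) (auto intro!: H_cmult H_indicator A)
    have Y0: "0 \<le> Y n \<omega>" for n \<omega> unfolding Y_def using B by (auto split: nat.splits)
    have EY: "E (Y n) \<le> ereal (f n)" for n
    proof (cases n)
      case 0 then show ?thesis by (simp add: Y_def[abs_def] f_def E_const)
    next
      case (Suc j)
      have "E (Y n) = ereal (B * (2 ^ Suc j) powr \<theta>) * capacity E (A j)"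
        unfolding capacity_def Y_def[abs_def] Suc nat.case
        using B by (intro E_pos_homogeneous H_indicator A) auto
      also have "\<dots> \<le> ereal (B * (2 ^ Suc j) powr \<theta>) * ereal (K * (2 ^ j) powr - s)"
        unfolding A_def using B by (intro ereal_mult_left_mono tail) auto
      also have "\<dots> = ereal (f n)"
        by (simp add: Suc f_def \<rho>_def powr_powr powr_mult powr_power powr_minus powr_diff
              divide_simps algebra_simps flip: powr_realpow)
      finally show ?thesis .
    qed
    have "(\<lambda>j. \<rho> ^ j) sums (1 / (1 - \<rho>))" using \<rho> by (intro geometric_sums) auto
    then have "(\<lambda>j. B * K * 2 powr \<theta> * \<rho> ^ j) sums (B * K * 2 powr \<theta> * (1 / (1 - \<rho>)))"
      by (rule sums_mult)
    then have "(\<lambda>j. f (Suc j)) sums (B * K * 2 powr \<theta> * (1 / (1 - \<rho>)))" by (simp add: f_def)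
    then have fs: "f sums (B * \<kappa>)"
      by (subst (asm) sums_Suc_iff) (simp add: f_def \<kappa>_def algebra_simps)
    have bound: "ereal (Z \<omega>) \<le> (\<Sum>n. ereal (Y n \<omega>))" if \<omega>: "\<omega> \<in> space M" for \<omega>
    proof -
      have "\<exists>n. Z \<omega> \<le> Y n \<omega>"
      proof (cases "\<bar>X \<omega>\<bar> \<le> 1")
        case True
        have "Z \<omega> \<le> B * \<bar>X \<omega>\<bar> powr \<theta>" using Z \<omega> by auto
        also have "\<dots> \<le> B * 1" using True \<theta> B by (intro mult_left_mono powr_le1) auto
        finally show ?thesis by (intro exI[of _ 0]) (simp add: Y_def)
      next
        case False
        obtain m0 where m0: "\<bar>X \<omega>\<bar> < 2 ^ m0" using real_arch_pow[of 2 "\<bar>X \<omega>\<bar>"] by auto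
        \<comment> \<open>The dyadic shell that contains \<open>|X|\<close>.\<close>
        define m where "m = (LEAST m. \<bar>X \<omega>\<bar> \<le> 2 ^ m)"
        have m: "\<bar>X \<omega>\<bar> \<le> 2 ^ m" unfolding m_def by (rule LeastI[of _ m0]) (use m0 in simp)
        with False obtain j where j: "m = Suc j" by (cases m) auto
        have "\<not> \<bar>X \<omega>\<bar> \<le> 2 ^ j" using not_less_Least[of j "\<lambda>m. \<bar>X \<omega>\<bar> \<le> 2 ^ m"] j by (simp add: m_def)
        then have "\<omega> \<in> A j" using \<omega> by (simp add: A_def)
        moreover have "\<bar>X \<omega>\<bar> powr \<theta> \<le> (2 ^ Suc j) powr \<theta>"
          using m j \<theta> by (intro powr_mono2) auto
        then have "Z \<omega> \<le> B * (2 ^ Suc j) powr \<theta>"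
          using Z[OF \<omega>] B by (meson mult_left_mono order_trans)
        ultimately show ?thesis by (intro exI[of _ "Suc j"]) (simp add: Y_def)
      qed
      then obtain n where "ereal (Z \<omega>) \<le> ereal (Y n \<omega>)" by auto
      also have "\<dots> \<le> (\<Sum>k<Suc n. ereal (Y k \<omega>))"
        using Y0 by (auto intro: sum_nonneg)
      also have "\<dots> \<le> (\<Sum>n. ereal (Y n \<omega>))" by (rule suminf_upper) (simp add: Y0)
      finally show ?thesis .
    qed
    have "E Z \<le> (\<Sum>n. E (Y n))"
      using csub[unfolded countably_subadditive_expectation_def, rule_format, of Z Y] ZH YH Y0 Z bound by blast
    also have "\<dots> \<le> (\<Sum>n. ereal (f n))"
    proof (rule suminf_le)
      have "0 \<le> E (Y n)" for n
        using E_ge_const[OF YH, of 0 n] Y0 by (simp add: zero_ereal_def)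
      then show "summable (\<lambda>n. E (Y n))" by (rule summable_ereal_pos)
      have "0 \<le> f n" for n unfolding f_def using B K \<rho> by (auto split: nat.splits)
      then show "summable (\<lambda>n. ereal (f n))" by (intro summable_ereal_pos) auto
    qed (rule EY)
    also have "\<dots> = ereal (B * \<kappa>)"
      by (rule sums_unique[symmetric]) (use fs in \<open>simp add: sums_ereal\<close>)
    finally show "E Z \<le> ereal (B * \<kappa>)" .
  qed
  then show ?thesis by (rule that)
qed

lemma H_exp_clamp:
  assumes "X \<in> H" "0 \<le> z"
  shows "(\<lambda>\<omega>. exp (l * clamp_to z (a * X \<omega>))) \<in> H"
proof (rule H_lipschitz[OF H_cmult[OF assms(1)], of "\<lambda>t. exp (l * clamp_to z t)" "exp (\<bar>l\<bar> * z) * \<bar>l\<bar>"])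
  fix s t :: real
  have le: "exp (l * clamp_to z s) - exp (l * clamp_to z t) \<le> exp (\<bar>l\<bar> * z) * \<bar>l\<bar> * \<bar>s - t\<bar>" for s t
  proof -
    let ?u = "l * clamp_to z s" and ?v = "l * clamp_to z t"
    have "exp ?u - exp ?v = exp ?u * (1 - exp (?v - ?u))" by (simp add: algebra_simps flip: exp_add)
    also have "\<dots> \<le> exp ?u * (?u - ?v)"
    proof (rule mult_left_mono)
      show "1 - exp (?v - ?u) \<le> ?u - ?v" using exp_ge_add_one_self[of "?v - ?u"] by linarith
    qed simp
    also have "\<dots> \<le> exp ?u * (\<bar>l\<bar> * \<bar>s - t\<bar>)"
    proof (rule mult_left_mono)
      have "?u - ?v \<le> \<bar>l\<bar> * \<bar>clamp_to z s - clamp_to z t\<bar>"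
        by (metis abs_ge_self abs_mult right_diff_distrib)
      also have "\<dots> \<le> \<bar>l\<bar> * \<bar>s - t\<bar>" by (intro mult_left_mono clamp_to_lipschitz) auto
      finally show "?u - ?v \<le> \<bar>l\<bar> * \<bar>s - t\<bar>" .
    qed simp
    also have "\<dots> \<le> exp (\<bar>l\<bar> * z) * (\<bar>l\<bar> * \<bar>s - t\<bar>)"
    proof (rule mult_right_mono)
      have "?u \<le> \<bar>l\<bar> * \<bar>clamp_to z s\<bar>" by (metis abs_ge_self abs_mult)
      also have "\<dots> \<le> \<bar>l\<bar> * z" using assms by (intro mult_left_mono abs_clamp_to_le) auto
      finally show "exp ?u \<le> exp (\<bar>l\<bar> * z)" by simp
    qed simp
    finally show ?thesis by simp
  qed
  show "\<bar>exp (l * clamp_to z s) - exp (l * clamp_to z t)\<bar> \<le> exp (\<bar>l\<bar> * z) * \<bar>l\<bar> * \<bar>s - t\<bar>"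
    using le[of s t] le[of t s] by (simp add: abs_le_iff abs_minus_commute)
qed

text \<open>If \<open>\<theta> \<le> 1\<close>, the expansion of order one is dominated by \<open>|X| powr \<theta>\<close>. Otherwise the linear term remains;
  truncating \<open>a X\<close> increases it by at most the excess of \<open>|a X|\<close> over \<open>z\<close>, which is again dominated by a
  multiple of \<open>|X| powr \<theta>\<close> because \<open>\<theta> \<ge> 1\<close>, so that a mean zero variable has a truncated mean of the same order.\<close>

lemma exp_clamp_expectation_le:
  assumes XH: "X \<in> H" and dom: "dominated_moment M H E X \<theta> \<kappa>"
    and \<theta>: "0 < \<theta>" "\<theta> \<le> 1 \<or> (1 \<le> \<theta> \<and> \<theta> \<le> 2 \<and> E X = 0 \<and> E (\<lambda>\<omega>. - X \<omega>) = 0)"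
    and z: "0 < z" and w: "0 < w"
  shows "E (\<lambda>\<omega>. exp (w / z * clamp_to z (a * X \<omega>))) \<le> ereal (1 + 2 * exp (2 * w) * (\<bar>a\<bar> / z) powr \<theta> * \<kappa>)"
proof -
  note \<kappa> = dominated_momentD(1)[OF dom] and moment = dominated_momentD(2)[OF dom]
  define v where "v \<omega> = w / z * clamp_to z (a * X \<omega>)" for \<omega>
  define B where "B = exp (2 * w) * (\<bar>a\<bar> / z) powr \<theta>"
  have B0: "0 \<le> B" by (simp add: B_def)
  have vH: "(\<lambda>\<omega>. exp (v \<omega>)) \<in> H" unfolding v_def using z by (intro H_exp_clamp XH) auto
  have YH: "(\<lambda>\<omega>. clamp_to z (a * X \<omega>)) \<in> H"
    by (rule H_lipschitz[OF H_cmult[OF XH], of "clamp_to z" 1]) (simp add: clamp_to_lipschitz)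
  then have vH': "v \<in> H" unfolding v_def[abs_def] by (rule H_cmult)
  have abs_v: "\<bar>v \<omega>\<bar> = w / z * \<bar>clamp_to z (a * X \<omega>)\<bar>" for \<omega>
    unfolding v_def using w z by (simp add: abs_mult)
  have v: "\<bar>v \<omega>\<bar> \<le> w" for \<omega>
    unfolding abs_v using mult_left_mono[OF abs_clamp_to_le(1)[of z "a * X \<omega>"], of "w / z"] w z by simp
  have vp: "exp (2 * w) * (\<bar>v \<omega>\<bar> / w) powr \<theta> \<le> B * \<bar>X \<omega>\<bar> powr \<theta>" for \<omega>
  proof -
    have "\<bar>v \<omega>\<bar> / w = \<bar>clamp_to z (a * X \<omega>)\<bar> / z" unfolding abs_v using w by simp
    also have "\<dots> \<le> \<bar>a\<bar> / z * \<bar>X \<omega>\<bar>"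
      using abs_clamp_to_le(2)[of z "a * X \<omega>"] z by (simp add: abs_mult divide_right_mono)
    finally have "(\<bar>v \<omega>\<bar> / w) powr \<theta> \<le> (\<bar>a\<bar> / z * \<bar>X \<omega>\<bar>) powr \<theta>"
      using w \<theta> by (intro powr_mono2) auto
    also have "\<dots> = (\<bar>a\<bar> / z) powr \<theta> * \<bar>X \<omega>\<bar> powr \<theta>"
      using z by (intro powr_mult)
    finally show ?thesis unfolding B_def by simp
  qed
  show ?thesis
    using \<theta>(2)
  proof
    assume le1: "\<theta> \<le> 1"
    define Z where "Z \<omega> = max 0 (exp (v \<omega>) + - 1)" for \<omega>
    have ZH: "Z \<in> H" unfolding Z_def[abs_def]
      by (rule H_lipschitz[OF vH, of "\<lambda>t. max 0 (t + - 1)" 1]) (auto simp: max_def)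
    have "E Z \<le> ereal (B * \<kappa>)"
    proof (rule moment[OF ZH B0])
      fix \<omega>
      show "0 \<le> Z \<omega> \<and> Z \<omega> \<le> B * \<bar>X \<omega>\<bar> powr \<theta>"
        using exp_le_1_plus_powr[OF w v \<theta>(1) le1, of \<omega>] vp[of \<omega>] B0 by (auto simp: Z_def)
    qed
    have "E (\<lambda>\<omega>. exp (v \<omega>)) \<le> E (\<lambda>\<omega>. Z \<omega> + 1)"
      by (intro E_mono H_add ZH H_const vH) (auto simp: Z_def)
    also have "\<dots> = E Z + ereal 1" by (rule E_add_const[OF ZH])
    also have "\<dots> \<le> ereal (B * \<kappa>) + ereal 1" by (intro add_right_mono) fact
    also have "\<dots> \<le> ereal (1 + 2 * B * \<kappa>)" using B0 \<kappa> by simp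
    finally show ?thesis by (simp add: v_def B_def mult.assoc)
  next
    assume A: "1 \<le> \<theta> \<and> \<theta> \<le> 2 \<and> E X = 0 \<and> E (\<lambda>\<omega>. - X \<omega>) = 0"
    define Z where "Z \<omega> = exp (v \<omega>) + (- 1 * v \<omega> + - 1)" for \<omega>
    have ZH: "Z \<in> H" unfolding Z_def[abs_def] by (intro H_add vH vH' H_cmult H_const)
    have Z0: "0 \<le> Z \<omega>" for \<omega> using exp_ge_add_one_self[of "v \<omega>"] unfolding Z_def by linarith
    have EZ: "E Z \<le> ereal (B * \<kappa>)"
    proof (rule moment[OF ZH B0])
      fix \<omega>
      show "0 \<le> Z \<omega> \<and> Z \<omega> \<le> B * \<bar>X \<omega>\<bar> powr \<theta>"
        using exp_le_1_plus_id_plus_powr[OF w v \<theta>(1), of \<omega>] A vp[of \<omega>] Z0[of \<omega>] by (auto simp: Z_def)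
    qed
    have EaX: "E (\<lambda>\<omega>. a * X \<omega>) = 0"
    proof (cases "0 \<le> a")
      case True then show ?thesis using E_pos_homogeneous[OF XH True] A by simp
    next
      case False
      then have "E (\<lambda>\<omega>. (- a) * (- 1 * X \<omega>)) = ereal (- a) * E (\<lambda>\<omega>. - 1 * X \<omega>)"
        by (intro E_pos_homogeneous H_cmult XH) auto
      then show ?thesis using A by simp
    qed
    define R where "R \<omega> = max 0 (\<bar>a * X \<omega>\<bar> - z)" for \<omega>
    have RH: "R \<in> H" unfolding R_def[abs_def]
      by (rule H_lipschitz[OF H_cmult[OF XH], of "\<lambda>t. max 0 (\<bar>t\<bar> - z)" 1]) auto
    have ER: "E R \<le> ereal (z * (\<bar>a\<bar> / z) powr \<theta> * \<kappa>)"
    proof (rule moment[OF RH])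
      fix \<omega>
      have "R \<omega> \<le> z * (\<bar>a\<bar> / z * \<bar>X \<omega>\<bar>) powr \<theta>"
      proof (cases "\<bar>a * X \<omega>\<bar> \<le> z")
        case False
        then have "1 \<le> \<bar>a\<bar> / z * \<bar>X \<omega>\<bar>" using z by (simp add: abs_mult field_simps)
        then have "\<bar>a\<bar> / z * \<bar>X \<omega>\<bar> \<le> (\<bar>a\<bar> / z * \<bar>X \<omega>\<bar>) powr \<theta>"
          using powr_mono[of 1 \<theta> "\<bar>a\<bar> / z * \<bar>X \<omega>\<bar>"] A z by simp
        then have "z * (\<bar>a\<bar> / z * \<bar>X \<omega>\<bar>) \<le> z * (\<bar>a\<bar> / z * \<bar>X \<omega>\<bar>) powr \<theta>"
          using z by (intro mult_left_mono) auto
        moreover have "R \<omega> \<le> z * (\<bar>a\<bar> / z * \<bar>X \<omega>\<bar>)" using z by (simp add: R_def abs_mult)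
        ultimately show ?thesis by linarith
      qed (use z in \<open>simp add: R_def\<close>)
      then show "0 \<le> R \<omega> \<and> R \<omega> \<le> z * (\<bar>a\<bar> / z) powr \<theta> * \<bar>X \<omega>\<bar> powr \<theta>"
        using z by (auto simp: R_def powr_mult[of "\<bar>a\<bar> / z" "\<bar>X \<omega>\<bar>"] mult.assoc simp del: times_divide_eq_left)
    qed (use z in auto)
    have R_fin: "\<bar>E R\<bar> \<noteq> \<infinity>"
      using ER E_ge_const[OF RH, of 0] by (auto simp: R_def)
    have "E (\<lambda>\<omega>. clamp_to z (a * X \<omega>)) \<le> E (\<lambda>\<omega>. a * X \<omega> + R \<omega>)"
      unfolding R_def by (intro E_mono YH H_add H_cmult XH RH[unfolded R_def[abs_def]] clamp_to_le)
    also have "\<dots> \<le> E (\<lambda>\<omega>. a * X \<omega>) + E R"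
      using R_fin by (intro E_subadditive RH H_cmult XH) (auto simp: EaX)
    also have "\<dots> \<le> ereal (z * (\<bar>a\<bar> / z) powr \<theta> * \<kappa>)" using ER by (simp add: EaX)
    finally have EY: "E (\<lambda>\<omega>. clamp_to z (a * X \<omega>)) \<le> ereal (z * (\<bar>a\<bar> / z) powr \<theta> * \<kappa>)" .
    have "E v = ereal (w / z) * E (\<lambda>\<omega>. clamp_to z (a * X \<omega>))"
      unfolding v_def[abs_def] using w z by (intro E_pos_homogeneous YH) auto
    also have "\<dots> \<le> ereal (w / z) * ereal (z * (\<bar>a\<bar> / z) powr \<theta> * \<kappa>)"
      using w z EY by (intro ereal_mult_left_mono) auto
    also have "\<dots> = ereal (w * ((\<bar>a\<bar> / z) powr \<theta> * \<kappa>))" using z by simp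
    also have "\<dots> \<le> ereal (exp (2 * w) * ((\<bar>a\<bar> / z) powr \<theta> * \<kappa>))"
    proof -
      have "w \<le> exp (2 * w)" using exp_ge_add_one_self[of "2 * w"] w by linarith
      then show ?thesis using \<kappa> by (auto intro!: mult_right_mono)
    qed
    finally have Ev: "E v \<le> ereal (B * \<kappa>)" by (simp add: B_def mult.assoc)
    have "E (\<lambda>\<omega>. exp (v \<omega>)) = E (\<lambda>\<omega>. (Z \<omega> + v \<omega>) + 1)" by (simp add: Z_def)
    also have "\<dots> = E (\<lambda>\<omega>. Z \<omega> + v \<omega>) + ereal 1" by (intro E_add_const H_add ZH vH')
    also have "\<dots> \<le> (E Z + E v) + ereal 1"
      using EZ Ev E_ge_const[OF ZH, of 0] Z0
      by (intro add_right_mono E_subadditive ZH vH') auto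
    also have "\<dots> \<le> (ereal (B * \<kappa>) + ereal (B * \<kappa>)) + ereal 1"
      by (intro add_mono EZ Ev order_refl)
    finally show ?thesis by (simp add: v_def B_def algebra_simps)
  qed
qed

lemma ident_distributed_capacity:
  assumes id: "ident_distributed H E Y X" and YH: "Y \<in> H" and XH: "X \<in> H"
    and [measurable]: "S \<in> sets borel"
  shows "capacity E {\<omega>\<in>space M. Y \<omega> \<in> S} = capacity E {\<omega>\<in>space M. X \<omega> \<in> S}"
proof -
  note [measurable] = H_meas[OF YH] H_meas[OF XH]
  have eq: "indicator {\<omega>\<in>space M. Z \<omega> \<in> S} \<omega> = (indicator S (Z \<omega>) :: real)"
    if "\<omega> \<in> space M" for Z and \<omega>
    using that by (auto simp: indicator_def)
  have H: "(\<lambda>\<omega>. indicator S (Z \<omega>)) \<in> H"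
    and cap: "capacity E {\<omega>\<in>space M. Z \<omega> \<in> S} = E (\<lambda>\<omega>. indicator S (Z \<omega>))"
    and fin: "\<bar>E (\<lambda>\<omega>. indicator S (Z \<omega>))\<bar> \<noteq> \<infinity>"
    if [measurable]: "Z \<in> borel_measurable M" for Z
  proof -
    have m: "{\<omega>\<in>space M. Z \<omega> \<in> S} \<in> sets M" by measurable
    show H: "(\<lambda>\<omega>. indicator S (Z \<omega>)) \<in> H"
      by (rule H_cong[OF H_indicator[OF m]]) (simp add: eq)
    show cap: "capacity E {\<omega>\<in>space M. Z \<omega> \<in> S} = E (\<lambda>\<omega>. indicator S (Z \<omega>))"
      unfolding capacity_def by (rule E_cong[OF H_indicator[OF m]]) (simp add: eq)
    show "\<bar>E (\<lambda>\<omega>. indicator S (Z \<omega>))\<bar> \<noteq> \<infinity>"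
      using capacity_nonneg[OF m] capacity_le_1[OF m] unfolding cap by auto
  qed
  have "E (\<lambda>\<omega>. indicator S (Y \<omega>)) = E (\<lambda>\<omega>. indicator S (X \<omega>))"
    by (rule id[unfolded ident_distributed_def, THEN bspec, rule_format]) (auto intro!: H fin)
  then show ?thesis by (simp add: cap)
qed

text \<open>
  Exponential Markov inequality, applied to the normalised factors \<open>exp ((w / z) Y i) / (1 + \<rho> i)\<close>,
  whose expectations are at most \<open>1\<close>. If a partial sum exceeds \<open>y\<close>, then the corresponding product
  exceeds \<open>exp (w y / z)\<close> divided by all the normalising constants.
\<close>

lemma clamped_sum_maximal_bound:
  assumes indep: "indep_seq H E Xs" and Xs: "\<And>n. n \<ge> 1 \<Longrightarrow> Xs n \<in> H" and XH: "X \<in> H"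
    and ident: "\<And>n. n \<ge> 1 \<Longrightarrow> ident_distributed H E (Xs n) X"
    and z: "0 < z" and w: "0 < w" and \<rho>0: "\<And>i. 0 \<le> \<rho> i"
    and \<rho>: "\<And>i. E (\<lambda>\<omega>. exp (w / z * clamp_to z (a i * X \<omega>))) \<le> ereal (1 + \<rho> i)"
  shows "capacity E {\<omega>\<in>space M. \<exists>k\<in>{1..n}. (\<Sum>i=1..k. clamp_to z (a i * Xs i \<omega>)) > y}
    \<le> ereal (exp ((\<Sum>i=1..n. \<rho> i) - w * y / z))"
proof -
  define h where "h i t = inverse (1 + \<rho> i) * exp (w / z * clamp_to z (a i * t))" for i t
  define P where "P = (\<Prod>i=1..n. 1 + \<rho> i)"
  define c where "c = exp (w * y / z) / P"
  have P0: "0 < P" unfolding P_def using \<rho>0 by (intro prod_pos) (auto intro: add_pos_nonneg)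
  have c0: "0 < c" unfolding c_def using P0 by simp
  have A0: "0 < 1 + \<rho> i" for i using \<rho>0[of i] by simp
  have hH: "(\<lambda>\<omega>. h i (Y \<omega>)) \<in> H" if "Y \<in> H" for i Y
    unfolding h_def using z by (intro H_cmult H_exp_clamp that) auto
  have h0: "0 \<le> h i t" for i t unfolding h_def using A0[of i] by simp
  have hm: "h i \<in> borel_measurable borel" for i unfolding h_def[abs_def] by measurable
  have hX: "E (\<lambda>\<omega>. h i (X \<omega>)) \<le> 1" for i
  proof -
    have "E (\<lambda>\<omega>. h i (X \<omega>)) = ereal (inverse (1 + \<rho> i)) * E (\<lambda>\<omega>. exp (w / z * clamp_to z (a i * X \<omega>)))"
      unfolding h_def using A0[of i] z by (intro E_pos_homogeneous H_exp_clamp XH) auto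
    also have "\<dots> \<le> ereal (inverse (1 + \<rho> i)) * ereal (1 + \<rho> i)"
      using A0[of i] by (intro ereal_mult_left_mono \<rho>) auto
    also have "\<dots> = 1" using A0[of i] by (simp add: one_ereal_def)
    finally show ?thesis .
  qed
  have hb: "h i t \<le> inverse (1 + \<rho> i) * exp w" for i t
  proof -
    have "w / z * clamp_to z (a i * t) \<le> w / z * z"
      using z w abs_clamp_to_le(1)[of z "a i * t"] by (intro mult_left_mono) auto
    then show ?thesis unfolding h_def using A0[of i] z by simp
  qed
  have fin: "\<bar>E (\<lambda>\<omega>. h i (Y \<omega>))\<bar> \<noteq> \<infinity>" if "Y \<in> H" for i Y
    using E_ge_const[OF hH[OF that], of 0 i] E_le_const[OF hH[OF that], of i "inverse (1 + \<rho> i) * exp w"] h0 hb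
    by auto
  have hXs: "E (\<lambda>\<omega>. h i (Xs i \<omega>)) \<le> 1" if "i \<ge> 1" for i
  proof -
    have "E (\<lambda>\<omega>. h i (Xs i \<omega>)) = E (\<lambda>\<omega>. h i (X \<omega>))"
      by (rule ident[OF that, unfolded ident_distributed_def, THEN bspec, rule_format])
        (auto intro!: hm hH fin XH Xs that)
    then show ?thesis using hX by simp
  qed
  have Xm: "Xs i \<in> borel_measurable M" if "i \<ge> 1" for i using H_meas Xs that by auto
  let ?S = "{\<omega>\<in>space M. \<exists>k\<in>{1..n}. (\<Sum>i=1..k. clamp_to z (a i * Xs i \<omega>)) > y}"
  let ?T = "{\<omega>\<in>space M. \<exists>k\<in>{1..n}. (\<Prod>i=1..k. h i (Xs i \<omega>)) > c}"
  have m: "(\<lambda>\<omega>. clamp_to z (a i * Xs i \<omega>)) \<in> borel_measurable M"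
    "(\<lambda>\<omega>. h i (Xs i \<omega>)) \<in> borel_measurable M" if "i \<ge> 1" for i
    using Xm[OF that] hm[of i] by measurable
  have S: "?S \<in> sets M"
    by (intro sets.sets_Collect_finite_Ex borel_measurable_less borel_measurable_const borel_measurable_sum m) auto
  have T: "?T \<in> sets M"
    by (intro sets.sets_Collect_finite_Ex borel_measurable_less borel_measurable_const borel_measurable_prod m) auto
  have sub: "?S \<subseteq> ?T"
  proof safe
    fix \<omega> k assume \<omega>: "\<omega> \<in> space M" and k: "k \<in> {1..n}" and gt: "y < (\<Sum>i=1..k. clamp_to z (a i * Xs i \<omega>))"
    have "(\<Prod>i=1..k. h i (Xs i \<omega>)) = exp (w / z * (\<Sum>i=1..k. clamp_to z (a i * Xs i \<omega>))) / (\<Prod>i=1..k. 1 + \<rho> i)"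
      unfolding h_def by (simp add: prod_dividef exp_sum sum_distrib_left field_simps)
    moreover have "(\<Prod>i=1..k. 1 + \<rho> i) \<le> P"
      unfolding P_def using k \<rho>0 by (intro prod_mono2) (auto intro: add_nonneg_nonneg)
    moreover have "0 < (\<Prod>i=1..k. 1 + \<rho> i)" using A0 by (intro prod_pos) auto
    moreover have "exp (w * y / z) < exp (w / z * (\<Sum>i=1..k. clamp_to z (a i * Xs i \<omega>)))"
      using w z gt by (simp add: divide_strict_right_mono)
    ultimately have "c < (\<Prod>i=1..k. h i (Xs i \<omega>))"
      unfolding c_def using P0 by (simp add: frac_less)
    then show "\<exists>k\<in>{1..n}. c < (\<Prod>i=1..k. h i (Xs i \<omega>))" using k by blast
  qed
  have "ereal c * capacity E ?T \<le> 1"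
    by (rule stopped_prod_maximal_inequality[OF indep Xs hm h0 hH hXs c0]) (auto intro: Xs)
  moreover obtain v where v: "capacity E ?T = ereal v" "0 \<le> v" "v \<le> 1" using capacity_eq_ereal[OF T] .
  ultimately have "v \<le> 1 / c" using c0 by (simp add: field_simps one_ereal_def)
  also have "\<dots> = P * exp (- (w * y / z))" unfolding c_def by (simp add: exp_minus field_simps)
  also have "\<dots> \<le> exp (\<Sum>i=1..n. \<rho> i) * exp (- (w * y / z))"
    unfolding P_def exp_sum[OF finite_atLeastAtMost]
    using A0 by (intro mult_right_mono prod_mono) (auto intro: less_imp_le)
  finally have "v \<le> exp ((\<Sum>i=1..n. \<rho> i) - w * y / z)" by (simp add: exp_diff exp_minus field_simps)
  then have "ereal v \<le> ereal (exp ((\<Sum>i=1..n. \<rho> i) - w * y / z))" by simp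
  with capacity_mono[OF S T sub] v show ?thesis by (auto intro: order_trans)
qed

text \<open>An inequality of Fuk-Nagaev type. Either some summand exceeds the truncation level \<open>z\<close>, or the partial
  sums agree with those of the truncated summands, and the exponential bound applies to them and to
  their negatives. The level \<open>2 N z\<close> is a multiple of \<open>z\<close>, which turns the exponential bound into the power \<open>N\<close>.\<close>

lemma weighted_sum_maximal_bound:
  assumes indep: "indep_seq H E Xs" and Xs: "\<And>n. n \<ge> 1 \<Longrightarrow> Xs n \<in> H" and XH: "X \<in> H"
    and ident: "\<And>n. n \<ge> 1 \<Longrightarrow> ident_distributed H E (Xs n) X"
    and dom: "dominated_moment M H E X \<theta> \<kappa>"
    and \<theta>: "0 < \<theta>" "\<theta> \<le> 1 \<or> (1 \<le> \<theta> \<and> \<theta> \<le> 2 \<and> E X = 0 \<and> E (\<lambda>\<omega>. - X \<omega>) = 0)"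
    and N: "0 < N" and z: "0 < z" and B: "(\<Sum>i=1..n. \<bar>a i\<bar> powr \<theta>) \<le> B" "0 < B" "B < z powr \<theta>"
  shows "capacity E {\<omega>\<in>space M. \<exists>k\<in>{1..n}. \<bar>\<Sum>i=1..k. a i * Xs i \<omega>\<bar> > 2 * N * z}
     \<le> (\<Sum>i=1..n. capacity E {\<omega>\<in>space M. \<bar>a i * X \<omega>\<bar> > z}) + ereal (2 * exp (2 * \<kappa>) * (B / z powr \<theta>) powr N)"
proof -
  note \<kappa> = dominated_momentD(1)[OF dom]
  \<comment> \<open>This choice makes the exponents \<open>\<rho> i\<close> below sum to at most \<open>2 \<kappa>\<close>, while \<open>exp (- 2 N w)\<close> is the
    power \<open>N\<close> of \<open>B / z powr \<theta>\<close>.\<close>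
  define w where "w = ln (z powr \<theta> / B) / 2"
  have "1 < z powr \<theta> / B" using B by simp
  then have w: "0 < w" unfolding w_def by (simp add: ln_gt_zero)
  have e2w: "exp (2 * w) = z powr \<theta> / B" unfolding w_def using B z by simp
  define \<rho> where "\<rho> i = 2 * exp (2 * w) * (\<bar>a i\<bar> / z) powr \<theta> * \<kappa>" for i
  have \<rho>0: "0 \<le> \<rho> i" for i unfolding \<rho>_def using \<kappa> by simp
  have "(\<Sum>i=1..n. \<rho> i) = 2 * \<kappa> / B * (\<Sum>i=1..n. \<bar>a i\<bar> powr \<theta>)"
    unfolding sum_distrib_left \<rho>_def e2w using z by (intro sum.cong) (auto simp: powr_divide field_simps)
  also have "\<dots> \<le> 2 * \<kappa> / B * B" using B \<kappa> by (intro mult_left_mono) auto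
  finally have sum\<rho>: "(\<Sum>i=1..n. \<rho> i) \<le> 2 * \<kappa>" using B by simp
  have expo: "exp ((\<Sum>i=1..n. \<rho> i) - w * (2 * N * z) / z) \<le> exp (2 * \<kappa>) * (B / z powr \<theta>) powr N"
  proof -
    have "exp (- (w * (2 * N * z) / z)) = (B / z powr \<theta>) powr N"
    proof -
      have "ln (B / z powr \<theta>) = - (2 * w)"
        unfolding w_def using z B by (simp add: ln_div field_simps)
      moreover have "(B / z powr \<theta>) powr N = exp (N * ln (B / z powr \<theta>))"
        using z B by (simp add: powr_def[of "B / z powr \<theta>"])
      ultimately show ?thesis using z by (simp add: mult_ac)
    qed
    then show ?thesis using sum\<rho> by (simp add: exp_diff exp_minus field_simps)
  qed
  let ?C = "\<lambda>s. {\<omega>\<in>space M. \<exists>k\<in>{1..n}. (\<Sum>i=1..k. clamp_to z (s * a i * Xs i \<omega>)) > 2 * N * z}"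
  let ?D = "\<lambda>i. {\<omega>\<in>space M. \<bar>a i * Xs i \<omega>\<bar> > z}"
  let ?U = "\<Union>i\<in>{1..n}. ?D i"
  let ?S = "{\<omega>\<in>space M. \<exists>k\<in>{1..n}. \<bar>\<Sum>i=1..k. a i * Xs i \<omega>\<bar> > 2 * N * z}"
  have Xm: "Xs i \<in> borel_measurable M" if "i \<ge> 1" for i using H_meas Xs that by auto
  have m: "(\<lambda>\<omega>. clamp_to z (s * a i * Xs i \<omega>)) \<in> borel_measurable M"
    "(\<lambda>\<omega>. a i * Xs i \<omega>) \<in> borel_measurable M" if "i \<ge> 1" for i and s :: real
    using Xm[OF that] by measurable
  have C: "?C s \<in> sets M" for s
    by (intro sets.sets_Collect_finite_Ex borel_measurable_less borel_measurable_const borel_measurable_sum m) auto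
  have D: "?D i \<in> sets M" if "i \<ge> 1" for i
    by (intro borel_measurable_less borel_measurable_const borel_measurable_abs m that)
  have S: "?S \<in> sets M"
    by (intro sets.sets_Collect_finite_Ex borel_measurable_less borel_measurable_const borel_measurable_abs
        borel_measurable_sum m) auto
  have U: "?U \<in> sets M" using D by (intro sets.finite_UN) auto
  have capC: "capacity E (?C s) \<le> ereal (exp (2 * \<kappa>) * (B / z powr \<theta>) powr N)" if "s = 1 \<or> s = -1" for s
  proof -
    have bound: "E (\<lambda>\<omega>. exp (w / z * clamp_to z (s * a i * X \<omega>))) \<le> ereal (1 + \<rho> i)" for i
    proof -
      have "E (\<lambda>\<omega>. exp (w / z * clamp_to z (s * a i * X \<omega>)))
          \<le> ereal (1 + 2 * exp (2 * w) * (\<bar>s * a i\<bar> / z) powr \<theta> * \<kappa>)"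
        by (rule exp_clamp_expectation_le[OF XH dom \<theta> z w])
      moreover have "\<bar>s * a i\<bar> = \<bar>a i\<bar>" using that by (auto simp: abs_mult)
      ultimately show ?thesis by (simp only: \<rho>_def)
    qed
    have "capacity E (?C s) \<le> ereal (exp ((\<Sum>i=1..n. \<rho> i) - w * (2 * N * z) / z))"
      by (rule clamped_sum_maximal_bound[OF indep Xs XH ident z w \<rho>0 bound])
    also have "\<dots> \<le> ereal (exp (2 * \<kappa>) * (B / z powr \<theta>) powr N)" using expo by simp
    finally show ?thesis .
  qed
  have sub: "?S \<subseteq> ?U \<union> (?C 1 \<union> ?C (-1))"
  proof
    fix \<omega> assume "\<omega> \<in> ?S"
    then obtain k where \<omega>: "\<omega> \<in> space M" and k: "k \<in> {1..n}" "2 * N * z < \<bar>\<Sum>i=1..k. a i * Xs i \<omega>\<bar>" by auto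
    show "\<omega> \<in> ?U \<union> (?C 1 \<union> ?C (-1))"
    proof (cases "\<omega> \<in> ?U")
      case False
      then have le: "\<bar>a i * Xs i \<omega>\<bar> \<le> z" if "i \<in> {1..k}" for i using that k \<omega> by force
      have "(\<Sum>i=1..k. clamp_to z (s * a i * Xs i \<omega>)) = s * (\<Sum>i=1..k. a i * Xs i \<omega>)" if "s = 1 \<or> s = -1" for s
        unfolding sum_distrib_left using le that by (intro sum.cong) (auto simp: clamp_to_id)
      note eq = this[of 1] this[of "-1"]
      show ?thesis
      proof (cases "0 \<le> (\<Sum>i=1..k. a i * Xs i \<omega>)")
        case True
        then have "\<omega> \<in> ?C 1" using k \<omega> eq(1) by (auto intro!: bexI[of _ k])
        then show ?thesis by blast
      next
        case False
        then have "\<omega> \<in> ?C (-1)" using k \<omega> eq(2) by (auto intro!: bexI[of _ k])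
        then show ?thesis by blast
      qed
    qed simp
  qed
  have "capacity E ?S \<le> capacity E (?U \<union> (?C 1 \<union> ?C (-1)))"
    by (rule capacity_mono[OF S _ sub]) (intro sets.Un U C)
  also have "\<dots> \<le> capacity E ?U + capacity E (?C 1 \<union> ?C (-1))"
    by (intro capacity_Un U C sets.Un)
  also have "\<dots> \<le> capacity E ?U + (capacity E (?C 1) + capacity E (?C (-1)))"
    by (intro add_left_mono capacity_Un C)
  also have "\<dots> \<le> (\<Sum>i=1..n. capacity E (?D i)) +
     (ereal (exp (2 * \<kappa>) * (B / z powr \<theta>) powr N) + ereal (exp (2 * \<kappa>) * (B / z powr \<theta>) powr N))"
    using D by (intro add_mono capacity_UN capC) auto
  also have "(\<Sum>i=1..n. capacity E (?D i)) = (\<Sum>i=1..n. capacity E {\<omega>\<in>space M. \<bar>a i * X \<omega>\<bar> > z})"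
  proof (intro sum.cong refl)
    fix i assume "i \<in> {1..n}"
    then have i: "i \<ge> 1" by simp
    have "{t. \<bar>a i * t\<bar> > z} \<in> sets borel" by measurable
    from ident_distributed_capacity[OF ident[OF i] Xs[OF i] XH this]
    show "capacity E (?D i) = capacity E {\<omega>\<in>space M. \<bar>a i * X \<omega>\<bar> > z}" by simp
  qed
  finally show ?thesis by (simp add: mult.assoc)
qed

end

section \<open>Series in the weights\<close>

text \<open>
  For \<open>\<gamma> < 1\<close> each term is compared with an increment of \<open>x powr \<gamma> / \<gamma>\<close> by the mean value theorem,
  and the increments telescope.
\<close>

lemma sum_powr_le:
  fixes \<gamma> :: real
  assumes \<gamma>: "0 < \<gamma>"
  shows "(\<Sum>n<N. real (Suc n) powr (\<gamma> - 1)) \<le> max 1 (1 / \<gamma>) * real N powr \<gamma>"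
proof (cases "1 \<le> \<gamma>")
  case True
  have "(\<Sum>n<N. real (Suc n) powr (\<gamma> - 1)) \<le> (\<Sum>n<N. real N powr (\<gamma> - 1))"
    using True by (intro sum_mono powr_mono2) auto
  also have "\<dots> = real N powr \<gamma>"
    by (cases "N = 0") (auto simp: powr_diff)
  also have "\<dots> = 1 * real N powr \<gamma>" by simp
  also have "\<dots> \<le> max 1 (1 / \<gamma>) * real N powr \<gamma>" by (intro mult_right_mono) auto
  finally show ?thesis .
next
  case False
  have step: "real (Suc n) powr (\<gamma> - 1) \<le> 1 / \<gamma> * (real (Suc n) powr \<gamma> - real n powr \<gamma>)" for n
  proof (cases "n = 0")
    case True then show ?thesis using False \<gamma> by simp
  next
    case n: False
    have "\<exists>\<xi>. real n < \<xi> \<and> \<xi> < real (Suc n) \<and>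
        real (Suc n) powr \<gamma> - real n powr \<gamma> = (real (Suc n) - real n) * (\<gamma> * \<xi> powr (\<gamma> - 1))"
      using n by (intro MVT2) (auto intro!: derivative_eq_intros)
    then obtain \<xi> where \<xi>: "real n < \<xi>" "\<xi> < real (Suc n)"
      "real (Suc n) powr \<gamma> - real n powr \<gamma> = \<gamma> * \<xi> powr (\<gamma> - 1)" by auto
    have "real (Suc n) powr (\<gamma> - 1) \<le> \<xi> powr (\<gamma> - 1)"
      using \<xi> False n by (intro powr_mono2') auto
    then show ?thesis unfolding \<xi>(3) using \<gamma> by simp
  qed
  have "(\<Sum>n<N. real (Suc n) powr (\<gamma> - 1)) \<le> (\<Sum>n<N. 1 / \<gamma> * (real (Suc n) powr \<gamma> - real n powr \<gamma>))"
    by (intro sum_mono step)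
  also have "\<dots> = 1 / \<gamma> * real N powr \<gamma>"
    unfolding sum_distrib_left[symmetric] by (subst sum_lessThan_telescope) simp
  also have "\<dots> \<le> max 1 (1 / \<gamma>) * real N powr \<gamma>" by (intro mult_right_mono) auto
  finally show ?thesis .
qed

lemma sum_inverse_le: "0 < N \<Longrightarrow> (\<Sum>n<N. 1 / real (Suc n)) \<le> 1 + ln (real N)"
proof (induction N)
  case (Suc N)
  show ?case
  proof (cases "N = 0")
    case False
    have "ln (real N / real (Suc N)) \<le> real N / real (Suc N) - 1"
      using False by (intro ln_le_minus_one) auto
    then have "1 / real (Suc N) \<le> ln (real (Suc N)) - ln (real N)"
      using False by (simp add: ln_div field_simps)
    then show ?thesis using Suc False by simp
  qed simp
qed simp

lemma sum_inverse_ge: "ln (real (Suc (m + k))) - ln (real (Suc m)) \<le> (\<Sum>n\<in>{m..<m+k}. 1 / real (Suc n))"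
proof (induction k)
  case (Suc k)
  have "ln (real (Suc (m + Suc k)) / real (Suc (m + k))) \<le> real (Suc (m + Suc k)) / real (Suc (m + k)) - 1"
    by (intro ln_le_minus_one) auto
  also have "\<dots> = 1 / real (Suc (m + k))" by (simp add: field_simps)
  finally have "ln (real (Suc (m + Suc k))) - ln (real (Suc (m + k))) \<le> 1 / real (Suc (m + k))"
    by (simp add: ln_div)
  then show ?case using Suc by simp
qed simp

text \<open>
  The order of \<open>row_term\<close> summed over \<open>n\<close>, as a function of \<open>u\<close>, when \<open>s = (r - 1) / \<alpha>\<close>. The maximum
  with \<open>0\<close> in the logarithmic case makes the function nonnegative and increasing; it exceeds the
  same nonnegative levels as the expression in the theorem.
\<close>

definition growth :: "real \<Rightarrow> real \<Rightarrow> real \<Rightarrow> real" where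
  "growth p s t = (if p > s then t powr p else if p = s then max 0 (t powr s * ln t) else t powr s)"

definition row_term :: "real \<Rightarrow> real \<Rightarrow> real \<Rightarrow> real \<Rightarrow> real \<Rightarrow> nat \<Rightarrow> real" where
  "row_term r \<alpha> p \<epsilon> u n = real (Suc n) powr (r - 2) * max 0 ((u * real (Suc n) powr - \<alpha>) powr p - \<epsilon>)"

lemma row_term_nonneg: "0 \<le> row_term r \<alpha> p \<epsilon> u n"
  by (simp add: row_term_def)

lemma ennreal_suminf_le_of_support:
  fixes f :: "nat \<Rightarrow> real"
  assumes "\<And>n. f n \<noteq> 0 \<Longrightarrow> n < N" "\<And>n. 0 \<le> f n" "(\<Sum>n<N. f n) \<le> c"
  shows "(\<Sum>n. ennreal (f n)) \<le> ennreal c"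
proof -
  have "(\<Sum>n. ennreal (f n)) = (\<Sum>n<N. ennreal (f n))"
    using assms(1) by (intro suminf_finite) force+
  also have "\<dots> = ennreal (\<Sum>n<N. f n)" using assms by (intro sum_ennreal) auto
  also have "\<dots> \<le> ennreal c" using assms by (intro ennreal_leI)
  finally show ?thesis .
qed

lemma row_term_power:
  assumes "0 \<le> u"
  shows "real (Suc n) powr (r - 2) * (u * real (Suc n) powr - \<alpha>) powr p = u powr p * real (Suc n) powr (r - 2 - \<alpha> * p)"
proof -
  let ?n = "real (Suc n)"
  have "(u * ?n powr - \<alpha>) powr p = u powr p * ?n powr (- \<alpha> * p)"
    using assms by (subst powr_mult) (auto simp: powr_powr)
  moreover have "?n powr (r - 2) * ?n powr (- \<alpha> * p) = ?n powr (r - 2 - \<alpha> * p)"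
    unfolding powr_add[symmetric] by simp
  ultimately show ?thesis by (simp only: mult_ac)
qed

text \<open>
  The \<open>n\<close>-th term is at most \<open>u powr p\<close> times \<open>n\<close> to the power \<open>r - 2 - \<alpha> p\<close>, and it vanishes when
  \<open>n\<close> exceeds \<open>(u / e) powr (1 / \<alpha>)\<close>, with \<open>e\<close> the \<open>p\<close>-th root of \<open>\<epsilon>\<close>. For \<open>p > s\<close> the power of \<open>n\<close>
  is summable; for \<open>p \<le> s\<close> its sum up to the cut-off is a positive power or a logarithm of the
  cut-off.
\<close>

lemma row_series_le:
  fixes r \<alpha> p \<epsilon> :: real
  assumes r: "1 < r" and \<alpha>: "0 < \<alpha>" and p: "0 < p" and \<epsilon>: "0 < \<epsilon>"
  defines "s \<equiv> (r - 1) / \<alpha>"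
  obtains C where "0 \<le> C" "\<And>u. 0 \<le> u \<Longrightarrow> (\<Sum>n. ennreal (row_term r \<alpha> p \<epsilon> u n)) \<le>
    ennreal (C * (if p > s then u powr p else if p = s then u powr s * (1 + max 0 (ln u)) else u powr s))"
proof -
  define e where "e = \<epsilon> powr (1 / p)"
  have e: "0 < e" "e powr p = \<epsilon>" using \<epsilon> p by (auto simp: e_def powr_powr)
  have s: "0 < s" using r \<alpha> by (simp add: s_def)
  define N where "N u = nat \<lfloor>(u / e) powr (1 / \<alpha>)\<rfloor>" for u
  have N: "real (N u) \<le> (u / e) powr (1 / \<alpha>)" if "0 \<le> u" for u
    unfolding N_def by (intro of_nat_floor) simp
  have support: "n < N u" if u: "0 \<le> u" and nz: "row_term r \<alpha> p \<epsilon> u n \<noteq> 0" for u n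
  proof -
    let ?n = "real (Suc n)"
    have "e powr p < (u * ?n powr - \<alpha>) powr p" using nz e by (auto simp: row_term_def)
    then have "e < u * ?n powr - \<alpha>"
      using powr_mono2[of p "u * ?n powr - \<alpha>" e] p u by (auto simp: not_le[symmetric])
    then have "?n powr \<alpha> < u / e" using e by (simp add: powr_minus field_simps)
    then have "(?n powr \<alpha>) powr (1 / \<alpha>) \<le> (u / e) powr (1 / \<alpha>)"
      using \<alpha> by (intro powr_mono2) auto
    then have "?n \<le> (u / e) powr (1 / \<alpha>)" using \<alpha> by (simp add: powr_powr)
    then show ?thesis unfolding N_def by linarith
  qed
  have le: "row_term r \<alpha> p \<epsilon> u n \<le> u powr p * real (Suc n) powr (r - 2 - \<alpha> * p)" if "0 \<le> u" for u n
    unfolding row_term_power[OF that, symmetric] row_term_def using \<epsilon> by (intro mult_left_mono) auto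
  have series: "(\<Sum>n. ennreal (row_term r \<alpha> p \<epsilon> u n)) \<le> ennreal c"
    if "0 \<le> u" "u powr p * (\<Sum>n<N u. real (Suc n) powr (r - 2 - \<alpha> * p)) \<le> c" for u c
  proof (rule ennreal_suminf_le_of_support[OF support[OF that(1)] row_term_nonneg])
    have "(\<Sum>n<N u. row_term r \<alpha> p \<epsilon> u n) \<le> (\<Sum>n<N u. u powr p * real (Suc n) powr (r - 2 - \<alpha> * p))"
      by (intro sum_mono le that)
    also have "\<dots> \<le> c" using that by (simp add: sum_distrib_left)
    finally show "(\<Sum>n<N u. row_term r \<alpha> p \<epsilon> u n) \<le> c" .
  qed
  consider "s < p" | "p < s" | "p = s" by linarith
  then show ?thesis
  proof cases
    case 1
    define C where "C = (\<Sum>n. real (Suc n) powr (r - 2 - \<alpha> * p))"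
    have "r - 2 - \<alpha> * p < -1" using 1 \<alpha> by (simp add: s_def field_simps)
    then have "summable (\<lambda>n. real n powr (r - 2 - \<alpha> * p))" by (simp add: summable_real_powr_iff)
    then have summ: "summable (\<lambda>n. real (Suc n) powr (r - 2 - \<alpha> * p))"
      by (subst summable_Suc_iff)
    have C0: "0 \<le> C" unfolding C_def by (intro suminf_nonneg summ) auto
    show ?thesis
    proof (rule that[OF C0])
      fix u :: real assume u: "0 \<le> u"
      have "row_term r \<alpha> p \<epsilon> u n \<le> u powr p * real (Suc n) powr (r - 2 - \<alpha> * p)" for n
        unfolding row_term_power[OF u, symmetric] row_term_def using \<epsilon> by (intro mult_left_mono) auto
      then have "(\<Sum>n. ennreal (row_term r \<alpha> p \<epsilon> u n)) \<le> (\<Sum>n. ennreal (u powr p * real (Suc n) powr (r - 2 - \<alpha> * p)))"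
        by (intro suminf_le summableI ennreal_leI)
      also have "\<dots> = ennreal (\<Sum>n. u powr p * real (Suc n) powr (r - 2 - \<alpha> * p))"
        by (intro suminf_ennreal2 summable_mult summ) auto
      also have "\<dots> = ennreal (C * u powr p)" unfolding C_def by (subst suminf_mult[OF summ]) (simp add: mult.commute)
      finally show "(\<Sum>n. ennreal (row_term r \<alpha> p \<epsilon> u n)) \<le>
        ennreal (C * (if p > s then u powr p else if p = s then u powr s * (1 + max 0 (ln u)) else u powr s))"
        using 1 by simp
    qed
  next
    case 2
    define \<gamma> where "\<gamma> = r - 1 - \<alpha> * p"
    have \<gamma>: "0 < \<gamma>" using 2 \<alpha> by (simp add: \<gamma>_def s_def field_simps)
    define C where "C = max 1 (1 / \<gamma>) * e powr - (s - p)"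
    show ?thesis
    proof (rule that[of C])
      show "0 \<le> C" by (simp add: C_def)
      fix u :: real assume u: "0 \<le> u"
      have "(\<Sum>n<N u. real (Suc n) powr (r - 2 - \<alpha> * p)) \<le> max 1 (1 / \<gamma>) * real (N u) powr \<gamma>"
      proof -
        have "r - 2 - \<alpha> * p = \<gamma> - 1" by (simp add: \<gamma>_def)
        then show ?thesis using sum_powr_le[OF \<gamma>, of "N u"] by (simp only:)
      qed
      also have "\<dots> \<le> max 1 (1 / \<gamma>) * ((u / e) powr (1 / \<alpha>)) powr \<gamma>"
        using N[OF u] \<gamma> by (intro mult_left_mono powr_mono2) auto
      also have "((u / e) powr (1 / \<alpha>)) powr \<gamma> = (u / e) powr (s - p)"
        using \<alpha> by (simp add: powr_powr \<gamma>_def s_def field_simps)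
      also have "\<dots> = u powr (s - p) * e powr - (s - p)"
        unfolding powr_minus by (subst powr_divide) (simp add: divide_inverse)
      finally have "u powr p * (\<Sum>n<N u. real (Suc n) powr (r - 2 - \<alpha> * p)) \<le> C * (u powr p * u powr (s - p))"
        unfolding C_def using mult_left_mono[of _ _ "u powr p"] by (fastforce simp: mult_ac)
      also have "u powr p * u powr (s - p) = u powr s" by (simp flip: powr_add)
      finally show "(\<Sum>n. ennreal (row_term r \<alpha> p \<epsilon> u n)) \<le>
        ennreal (C * (if p > s then u powr p else if p = s then u powr s * (1 + max 0 (ln u)) else u powr s))"
        using series[OF u] 2 by simp
    qed
  next
    case 3
    have expo: "r - 2 - \<alpha> * p = -1" using 3 \<alpha> by (simp add: s_def)
    define C where "C = 1 + (1 + \<bar>ln e\<bar>) / \<alpha>"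
    have C1: "1 \<le> C" using \<alpha> by (simp add: C_def)
    show ?thesis
    proof (rule that[of C])
      show "0 \<le> C" using C1 by simp
      fix u :: real assume u: "0 \<le> u"
      have "(\<Sum>n<N u. 1 / real (Suc n)) \<le> C * (1 + max 0 (ln u))"
      proof (cases "N u = 0")
        case True then show ?thesis using C1 by simp
      next
        case False
        then have u0: "u \<noteq> 0" using N[OF u] by (auto simp: N_def)
        have "(\<Sum>n<N u. 1 / real (Suc n)) \<le> 1 + ln (real (N u))"
          using False by (intro sum_inverse_le) auto
        also have "\<dots> \<le> 1 + ln ((u / e) powr (1 / \<alpha>))"
          using False N[OF u] u0 e u by (intro add_left_mono ln_mono) auto
        also have "\<dots> = 1 + (ln u - ln e) / \<alpha>" using u u0 e by (simp add: ln_powr ln_div)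
        also have "\<dots> \<le> 1 + (max 0 (ln u) + \<bar>ln e\<bar>) / \<alpha>"
          using \<alpha> by (intro add_left_mono divide_right_mono) auto
        also have "\<dots> \<le> C * (1 + max 0 (ln u))"
        proof -
          have "0 \<le> max 0 (ln u) * (1 + \<bar>ln e\<bar> / \<alpha>)" using \<alpha> by simp
          moreover have "0 \<le> 1 / \<alpha>" using \<alpha> by simp
          ultimately show ?thesis unfolding C_def by (simp add: add_divide_distrib algebra_simps)
        qed
        finally show ?thesis .
      qed
      then have "u powr p * (\<Sum>n<N u. real (Suc n) powr (r - 2 - \<alpha> * p)) \<le> u powr p * (C * (1 + max 0 (ln u)))"
        unfolding expo by (intro mult_left_mono) (auto simp: powr_minus divide_inverse)
      then show "(\<Sum>n. ennreal (row_term r \<alpha> p \<epsilon> u n)) \<le>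
        ennreal (C * (if p > s then u powr p else if p = s then u powr s * (1 + max 0 (ln u)) else u powr s))"
        using series[OF u] 3 by (simp add: mult_ac)
    qed
  qed
qed


lemma row_term_ge:
  assumes "0 \<le> u" "2 * \<epsilon> \<le> (u * real (Suc n) powr - \<alpha>) powr p" "0 < \<epsilon>"
  shows "u powr p * real (Suc n) powr (r - 2 - \<alpha> * p) / 2 \<le> row_term r \<alpha> p \<epsilon> u n"
    and "real (Suc n) powr (r - 2) * \<epsilon> \<le> row_term r \<alpha> p \<epsilon> u n"
proof -
  have "real (Suc n) powr (r - 2) * ((u * real (Suc n) powr - \<alpha>) powr p / 2) \<le> row_term r \<alpha> p \<epsilon> u n"
    unfolding row_term_def using assms by (intro mult_left_mono) auto
  then show "u powr p * real (Suc n) powr (r - 2 - \<alpha> * p) / 2 \<le> row_term r \<alpha> p \<epsilon> u n"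
    using row_term_power[OF assms(1), of n r \<alpha> p] by simp
  show "real (Suc n) powr (r - 2) * \<epsilon> \<le> row_term r \<alpha> p \<epsilon> u n"
    unfolding row_term_def using assms by (intro mult_left_mono) auto
qed

text \<open>
  It suffices to sum finitely many terms. As long as \<open>(c t n\<^sup>-\<^sup>\<alpha>)\<^sup>p \<ge> 2 \<epsilon>\<close>, that is for \<open>n \<le> N t\<close>,
  subtracting \<open>\<epsilon>
\<close>
  costs at most a factor \<open>2\<close>. For \<open>p > s\<close> the term \<open>n0\<close> is enough; for \<open>p < s\<close> a dyadic block just below
  \<open>N t\<close> has the right order; for \<open>p = s\<close> all \<open>n\<close> from \<open>n0\<close> to \<open>N t\<close> contribute a harmonic sum. Bounded \<open>t\<close>, for
  which these ranges may be empty, are covered by the additive constant.\<close>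

lemma growth_le_row_series:
  fixes r \<alpha> p c \<epsilon> :: real and n0 :: nat
  assumes r: "1 < r" and \<alpha>: "0 < \<alpha>" and p: "0 < p" and \<epsilon>: "0 < \<epsilon>" and c: "0 < c"
  defines "s \<equiv> (r - 1) / \<alpha>"
  obtains C where "0 \<le> C" "\<And>t. 0 \<le> t \<Longrightarrow> ennreal (growth p s t) \<le>
    ennreal C * (1 + (\<Sum>n. ennreal (if n0 \<le> n then row_term r \<alpha> p \<epsilon> (c * t) n else 0)))"
proof -
  define e where "e = (2 * \<epsilon>) powr (1 / p)"
  have e: "0 < e" "e powr p = 2 * \<epsilon>" using \<epsilon> p by (auto simp: e_def powr_powr)
  have s: "0 < s" using r \<alpha> by (simp add: s_def)
  let ?f = "\<lambda>t n. if n0 \<le> n then row_term r \<alpha> p \<epsilon> (c * t) n else 0"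
  have f0: "0 \<le> ?f t n" for t n by (simp add: row_term_nonneg)
  note result = that
  have main: ?thesis
    if C: "0 \<le> C" and bound: "\<And>t. 0 \<le> t \<Longrightarrow> \<exists>F. finite F \<and> growth p s t \<le> C * (1 + (\<Sum>n\<in>F. ?f t n))" for C
  proof (rule result[OF C])
    fix t :: real assume t: "0 \<le> t"
    then obtain F where F: "finite F" "growth p s t \<le> C * (1 + (\<Sum>n\<in>F. ?f t n))" using bound by blast
    have "ennreal (growth p s t) \<le> ennreal C * (1 + ennreal (\<Sum>n\<in>F. ?f t n))"
      using F C f0 by (simp add: ennreal_leI sum_nonneg flip: ennreal_mult ennreal_1 ennreal_plus)
    also have "ennreal (\<Sum>n\<in>F. ?f t n) = (\<Sum>n\<in>F. ennreal (?f t n))" using f0 by (intro sum_ennreal[symmetric])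
    also have "\<dots> \<le> (\<Sum>n. ennreal (?f t n))" using F by (intro sum_le_suminf) auto
    finally show "ennreal (growth p s t) \<le> ennreal C * (1 + (\<Sum>n. ennreal (?f t n)))"
      by (simp add: mult_left_mono add_left_mono)
  qed
  define N where "N t = (c * t / e) powr (1 / \<alpha>)" for t
  have large: "2 * \<epsilon> \<le> (c * t * real (Suc n) powr - \<alpha>) powr p" if "0 \<le> t" "real (Suc n) \<le> N t" for t n
  proof -
    have "real (Suc n) powr \<alpha> \<le> N t powr \<alpha>" using that \<alpha> by (intro powr_mono2) auto
    also have "\<dots> = c * t / e" unfolding N_def using \<alpha> c e that by (simp add: powr_powr)
    finally have "e \<le> c * t * real (Suc n) powr - \<alpha>" using e by (simp add: powr_minus field_simps)
    then show ?thesis unfolding e(2)[symmetric] using e p by (intro powr_mono2) auto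
  qed
  consider "s < p" | "p < s" | "p = s" by linarith
  then show ?thesis
  proof cases
    case 1
    let ?n = "real (Suc n0)"
    define D where "D = c powr - p * ?n powr (\<alpha> * p)"
    define C where "C = D * max \<epsilon> (?n powr (2 - r))"
    have D: "0 < D" using c by (simp add: D_def)
    show ?thesis
    proof (rule main[of C])
      show "0 \<le> C" unfolding C_def using D \<epsilon> by simp
      fix t :: real assume t: "0 \<le> t"
      define y where "y = (c * t * ?n powr - \<alpha>) powr p"
      have "y = c powr p * t powr p * ?n powr - (\<alpha> * p)"
        unfolding y_def using c t by (simp add: powr_mult powr_powr)
      then have "t powr p = D * y" unfolding D_def using c by (simp add: powr_minus field_simps)
      also have "\<dots> \<le> D * (\<epsilon> + max 0 (y - \<epsilon>))" using D by (intro mult_left_mono) auto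
      also have "max 0 (y - \<epsilon>) = ?n powr (2 - r) * row_term r \<alpha> p \<epsilon> (c * t) n0"
        unfolding row_term_def y_def[symmetric] mult.assoc[symmetric] powr_add[symmetric] by simp
      also have "D * (\<epsilon> + ?n powr (2 - r) * row_term r \<alpha> p \<epsilon> (c * t) n0)
          \<le> D * (max \<epsilon> (?n powr (2 - r)) * 1 + max \<epsilon> (?n powr (2 - r)) * row_term r \<alpha> p \<epsilon> (c * t) n0)"
        using D row_term_nonneg by (intro mult_left_mono add_mono mult_right_mono) auto
      finally have "growth p s t \<le> C * (1 + (\<Sum>n\<in>{n0}. ?f t n))"
        using 1 by (simp add: growth_def C_def algebra_simps)
      then show "\<exists>F. finite F \<and> growth p s t \<le> C * (1 + (\<Sum>n\<in>F. ?f t n))"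
        by (intro exI[of _ "{n0}"] conjI) simp
    qed
  next
    case 2
    define k where "k = \<epsilon> * min 1 (2 powr (r - 2))"
    have k: "0 < k" using \<epsilon> by (simp add: k_def)
    define D where "D = (e / c) powr s"
    have D: "0 < D" using e c by (simp add: D_def)
    define C where "C = D * max ((2 * real n0 + 2) powr (r - 1)) (4 powr (r - 1) / k)"
    have tN: "t powr s = D * N t powr (r - 1)" if "0 \<le> t" for t
    proof -
      have "N t powr (r - 1) = (c * t / e) powr s" unfolding N_def using \<alpha> by (simp add: powr_powr s_def)
      also have "\<dots> = (c / e) powr s * t powr s" using powr_mult[of "c / e" t s] by simp
      also have "D * \<dots> = ((e / c) * (c / e)) powr s * t powr s" unfolding D_def mult.assoc[symmetric]
        by (subst powr_mult) auto
      also have "\<dots> = t powr s" using c e by simp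
      finally show ?thesis by simp
    qed
    show ?thesis
    proof (rule main[of C])
      show "0 \<le> C" unfolding C_def using D by (simp add: le_max_iff_disj)
      fix t :: real assume t: "0 \<le> t"
      define m where "m = nat \<lfloor>N t / 2\<rfloor>"
      have N0: "0 \<le> N t" by (simp add: N_def)
      have "real m = real_of_int \<lfloor>N t / 2\<rfloor>" unfolding m_def using N0 by simp
      then have m: "real m \<le> N t / 2" "N t < 2 * real m + 2" by linarith+
      have "\<exists>F. finite F \<and> N t powr (r - 1) \<le> max ((2 * real n0 + 2) powr (r - 1)) (4 powr (r - 1) / k) * (1 + (\<Sum>n\<in>F. ?f t n))"
      proof (cases "m \<le> n0")
        case True
        then have "N t powr (r - 1) \<le> (2 * real n0 + 2) powr (r - 1)"
          using m N0 r by (intro powr_mono2) auto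
        then show ?thesis by (intro exI[of _ "{}"]) simp
      next
        case False
        have "k * real m powr (r - 2) \<le> ?f t n" if n: "n \<in> {m..<2*m}" for n
        proof -
          have "real (Suc n) \<le> N t" using n m by (auto simp: Suc_le_eq intro: order_trans[of _ "2 * real m"])
          then have "real (Suc n) powr (r - 2) * \<epsilon> \<le> row_term r \<alpha> p \<epsilon> (c * t) n"
            using t c \<epsilon> by (intro row_term_ge large) auto
          moreover have "min 1 (2 powr (r - 2)) * real m powr (r - 2) \<le> real (Suc n) powr (r - 2)"
          proof (cases "2 \<le> r")
            case True
            then have "real m powr (r - 2) \<le> real (Suc n) powr (r - 2)" using n by (intro powr_mono2) auto
            then show ?thesis by (meson min.cobounded1 mult_left_le_one_le order_trans powr_ge_zero mult_right_mono min.bounded_iff zero_le_one)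
          next
            case r2: False
            have "min 1 (2 powr (r - 2)) * real m powr (r - 2) \<le> 2 powr (r - 2) * real m powr (r - 2)"
              by (intro mult_right_mono) auto
            also have "\<dots> = (2 * real m) powr (r - 2)" by (simp add: powr_mult)
            also have "\<dots> \<le> real (Suc n) powr (r - 2)"
              using n r2 False by (intro powr_mono2') auto
            finally show ?thesis .
          qed
          then have "min 1 (2 powr (r - 2)) * real m powr (r - 2) * \<epsilon> \<le> real (Suc n) powr (r - 2) * \<epsilon>"
            using \<epsilon> by (intro mult_right_mono) auto
          ultimately have "min 1 (2 powr (r - 2)) * real m powr (r - 2) * \<epsilon> \<le> row_term r \<alpha> p \<epsilon> (c * t) n"
            by linarith
          then show ?thesis using n False by (simp add: k_def mult_ac)
        qed
        then have "(\<Sum>n\<in>{m..<2*m}. k * real m powr (r - 2)) \<le> (\<Sum>n\<in>{m..<2*m}. ?f t n)"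
          by (intro sum_mono)
        moreover have "(\<Sum>n\<in>{m..<2*m}. k * real m powr (r - 2)) = k * real m powr (r - 1)"
          using False by (simp add: powr_diff power2_eq_square)
        ultimately have ge: "k * real m powr (r - 1) \<le> (\<Sum>n\<in>{m..<2*m}. ?f t n)" by (simp only:)
        have "N t powr (r - 1) \<le> (4 * real m) powr (r - 1)"
          using m N0 r False by (intro powr_mono2) auto
        also have "\<dots> = 4 powr (r - 1) / k * (k * real m powr (r - 1))" using k by (simp add: powr_mult)
        also have "\<dots> \<le> 4 powr (r - 1) / k * (1 + (\<Sum>n\<in>{m..<2*m}. ?f t n))"
          using ge k by (intro mult_left_mono) auto
        also have "\<dots> \<le> max ((2 * real n0 + 2) powr (r - 1)) (4 powr (r - 1) / k) * (1 + (\<Sum>n\<in>{m..<2*m}. ?f t n))"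
          by (intro mult_right_mono add_nonneg_nonneg sum_nonneg f0) auto
        finally show ?thesis by (intro exI[of _ "{m..<2*m}"]) simp
      qed
      then obtain F where F: "finite F" "N t powr (r - 1) \<le> max ((2 * real n0 + 2) powr (r - 1)) (4 powr (r - 1) / k) * (1 + (\<Sum>n\<in>F. ?f t n))"
        by blast
      have "growth p s t = D * N t powr (r - 1)" using 2 tN[OF t] by (simp add: growth_def)
      also have "\<dots> \<le> C * (1 + (\<Sum>n\<in>F. ?f t n))"
        using mult_left_mono[OF F(2), of D] D by (simp add: C_def mult.assoc)
      finally show "\<exists>F. finite F \<and> growth p s t \<le> C * (1 + (\<Sum>n\<in>F. ?f t n))" using F(1) by blast
    qed
  next
    case 3
    have expo: "r - 2 - \<alpha> * p = -1" using 3 \<alpha> by (simp add: s_def)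
    define K where "K = \<bar>ln (c / e)\<bar> / \<alpha> + ln (real (Suc n0))"
    have K: "0 \<le> K" unfolding K_def using \<alpha> by simp
    \<comment> \<open>Beyond \<open>T\<close> the constant \<open>K\<close> is at most half of \<open>ln t / \<alpha>\<close>, so the harmonic sum is at least \<open>ln t / (2 \<alpha>)\<close>.\<close>
    define T where "T = exp (2 * \<alpha> * K)"
    define C where "C = max (T powr s * (2 * \<alpha> * K)) (4 * \<alpha> / c powr s)"
    have T1: "1 \<le> T" using K \<alpha> by (simp add: T_def)
    show ?thesis
    proof (rule main[of C])
      show C0: "0 \<le> C" unfolding C_def using K \<alpha> by (simp add: le_max_iff_disj)
      fix t :: real assume t: "0 \<le> t"
      show "\<exists>F. finite F \<and> growth p s t \<le> C * (1 + (\<Sum>n\<in>F. ?f t n))"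
      proof (cases "t \<le> T")
        case True
        have "growth p s t \<le> T powr s * (2 * \<alpha> * K)"
        proof (cases "t \<le> 1")
          case True
          then have "t powr s * ln t \<le> 0" using t by (cases "t = 0") (auto intro: mult_nonneg_nonpos)
          then show ?thesis using 3 K \<alpha> by (simp add: growth_def)
        next
          case False
          have "ln t \<le> ln T" using True False T1 by (intro ln_mono) auto
          then have "ln t \<le> 2 * \<alpha> * K" by (simp add: T_def)
          then have "t powr s * ln t \<le> T powr s * (2 * \<alpha> * K)"
            using True False s by (intro mult_mono powr_mono2) auto
          then show ?thesis using 3 K \<alpha> by (simp add: growth_def)
        qed
        then show ?thesis by (intro exI[of _ "{}"]) (simp add: C_def)
      next
        case False
        then have t1: "1 < t" using T1 by simp
        have lnt: "2 * \<alpha> * K \<le> ln t" using ln_mono[of T t] False T1 by (simp add: T_def)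
        define m where "m = nat \<lfloor>N t\<rfloor>"
        have Npos: "0 < N t" unfolding N_def using c e t1 by simp
        have lnN: "ln (N t) = (ln (c / e) + ln t) / \<alpha>"
          unfolding N_def using c e t1 by (simp add: ln_powr ln_mult ln_div add_divide_distrib diff_divide_distrib)
        also have "\<dots> \<ge> ln t / \<alpha> - \<bar>ln (c / e)\<bar> / \<alpha>"
          unfolding diff_divide_distrib[symmetric] using \<alpha> by (intro divide_right_mono) auto
        finally have lnN: "ln t / \<alpha> - K \<le> ln (N t) - ln (real (Suc n0))" unfolding K_def by simp
        have mN: "real m \<le> N t" "N t < real (Suc m)"
          unfolding m_def using Npos by (auto intro: of_nat_floor) linarith
        have half: "ln t / (2 * \<alpha>) \<le> ln (N t) - ln (real (Suc n0))"
        proof -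
          have "K \<le> ln t / (2 * \<alpha>)" using lnt \<alpha> by (simp add: field_simps)
          moreover have "ln t / \<alpha> = ln t / (2 * \<alpha>) + ln t / (2 * \<alpha>)" by simp
          ultimately show ?thesis using lnN by linarith
        qed
        have "0 < ln t / (2 * \<alpha>)" using t1 \<alpha> by simp
        then have "ln (real (Suc n0)) < ln (N t)" using half by linarith
        then have "real (Suc n0) < N t" using Npos by (subst (asm) ln_less_cancel_iff) auto
        then have n0m: "n0 \<le> m" using mN by simp
        have "ln (N t) - ln (real (Suc n0)) \<le> ln (real (Suc m)) - ln (real (Suc n0))"
          using mN Npos by (intro diff_right_mono) (subst ln_le_cancel_iff, auto)
        also have "\<dots> \<le> (\<Sum>n\<in>{n0..<m}. 1 / real (Suc n))"
          using sum_inverse_ge[of n0 "m - n0"] n0m by simp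
        finally have ge: "ln t / (2 * \<alpha>) \<le> (\<Sum>n\<in>{n0..<m}. 1 / real (Suc n))" using half by linarith
        have "(c * t) powr p / 2 * (1 / real (Suc n)) \<le> ?f t n" if n: "n \<in> {n0..<m}" for n
        proof -
          have "real (Suc n) \<le> N t" using n mN by (auto simp: Suc_le_eq intro: order_trans[of _ "real m"])
          then have "(c * t) powr p * real (Suc n) powr (r - 2 - \<alpha> * p) / 2 \<le> row_term r \<alpha> p \<epsilon> (c * t) n"
            using t c \<epsilon> by (intro row_term_ge large) auto
          moreover have "(c * t) powr p / 2 * (1 / real (Suc n)) = (c * t) powr p * real (Suc n) powr (r - 2 - \<alpha> * p) / 2"
            unfolding expo powr_minus by (simp add: field_simps)
          moreover have "?f t n = row_term r \<alpha> p \<epsilon> (c * t) n" using n by simp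
          ultimately show ?thesis by (simp only:)
        qed
        then have "(\<Sum>n\<in>{n0..<m}. (c * t) powr p / 2 * (1 / real (Suc n))) \<le> (\<Sum>n\<in>{n0..<m}. ?f t n)"
          by (intro sum_mono)
        moreover have "(c * t) powr p / 2 * (ln t / (2 * \<alpha>)) \<le> (c * t) powr p / 2 * (\<Sum>n\<in>{n0..<m}. 1 / real (Suc n))"
          by (rule mult_left_mono[OF ge]) simp
        ultimately have "(c * t) powr p / 2 * (ln t / (2 * \<alpha>)) \<le> (\<Sum>n\<in>{n0..<m}. ?f t n)"
          unfolding sum_distrib_left[symmetric] by linarith
        moreover have "growth p s t = 4 * \<alpha> / c powr s * ((c * t) powr p / 2 * (ln t / (2 * \<alpha>)))"
          using 3 t1 c \<alpha> by (simp add: growth_def powr_mult)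
        moreover have "0 \<le> 4 * \<alpha> / c powr s" using \<alpha> by simp
        ultimately have "growth p s t \<le> 4 * \<alpha> / c powr s * (1 + (\<Sum>n\<in>{n0..<m}. ?f t n))"
          using mult_left_mono[of "(c * t) powr p / 2 * (ln t / (2 * \<alpha>))" "1 + (\<Sum>n\<in>{n0..<m}. ?f t n)" "4 * \<alpha> / c powr s"]
          by linarith
        also have "\<dots> \<le> C * (1 + (\<Sum>n\<in>{n0..<m}. ?f t n))"
          unfolding C_def by (intro mult_right_mono add_nonneg_nonneg sum_nonneg f0) auto
        finally show ?thesis by blast
      qed
    qed
  qed
qed

lemma growth_nonneg: "0 \<le> growth p s t"
  by (simp add: growth_def)

lemma growth_log: "0 \<le> (t::real) \<Longrightarrow> max 0 (t powr s * ln t) = t powr s * ln (max 1 t)"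
proof (cases "t \<le> 1")
  case True
  assume "0 \<le> t"
  with True have "ln t \<le> 0" by (cases "t = 0") auto
  then have "t powr s * ln t \<le> 0" by (intro mult_nonneg_nonpos) auto
  with True show ?thesis by (simp add: max_def)
qed (simp add: max_def)

lemma growth_continuous: "0 < p \<Longrightarrow> 0 < s \<Longrightarrow> continuous_on {0..} (growth p s)"
proof -
  assume p: "0 < p" "0 < s"
  have c: "continuous_on {0..} (\<lambda>t::real. t powr a)" if "0 < a" for a
    using that by (intro continuous_on_powr' continuous_intros) auto
  have l: "continuous_on {0..} (\<lambda>t::real. t powr s * ln (max 1 t))"
    using p by (intro continuous_intros c) auto
  have "continuous_on {0..} (\<lambda>t. if p > s then t powr p else if p = s then t powr s * ln (max 1 t) else t powr s)"
    using p by (cases "p > s"; cases "p = s") (auto intro: c l)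
  then show ?thesis
    by (rule continuous_on_eq) (simp add: growth_def growth_log)
qed

lemma growth_mono: "0 < p \<Longrightarrow> 0 < s \<Longrightarrow> mono_on {0..} (growth p s)"
  by (auto intro!: mono_onI powr_mono2 mult_mono simp: growth_def growth_log)

text \<open>Beyond \<open>exp 1\<close> the logarithm is at least \<open>1\<close>.\<close>

lemma powr_le_growth:
  assumes t: "exp 1 \<le> t" and ps: "0 < p" "0 < s"
  shows "t powr s \<le> growth p s t" "t powr p \<le> growth p s t"
proof -
  have t1: "1 \<le> t" using t exp_ge_add_one_self[of 1] by linarith
  have ln1: "1 \<le> ln t" using ln_mono[of "exp 1" t] t t1 by simp
  have m: "t powr x * 1 \<le> t powr x * ln t" for x using ln1 by (intro mult_left_mono) auto
  have "0 \<le> ln t" using ln1 by simp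
  show "t powr s \<le> growth p s t" "t powr p \<le> growth p s t"
    using t1 m[of s] by (auto simp: growth_def intro!: powr_mono)
qed

lemma growth_comp_measurable [measurable]:
  "f \<in> borel_measurable N \<Longrightarrow> (\<lambda>x. growth p s (f x)) \<in> borel_measurable N"
  unfolding growth_def by (cases "p > s"; cases "p = s") auto

lemma ennreal_suminf_swap:
  fixes f :: "nat \<Rightarrow> nat \<Rightarrow> ennreal"
  shows "(\<Sum>i. \<Sum>j. f i j) = (\<Sum>j. \<Sum>i. f i j)"
proof -
  have "(\<Sum>i. \<Sum>j. f i j) = (\<Sum>i. \<integral>\<^sup>+j. f i j \<partial>count_space UNIV)"
    by (simp add: nn_integral_count_space_nat)
  also have "\<dots> = (\<integral>\<^sup>+j. (\<Sum>i. f i j) \<partial>count_space UNIV)"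
    by (rule nn_integral_suminf[symmetric]) simp
  also have "\<dots> = (\<Sum>j. \<Sum>i. f i j)" by (simp add: nn_integral_count_space_nat)
  finally show ?thesis .
qed

text \<open>
  After interchanging the sums, the bound for one row series is applied with \<open>u = D i\<^sup>-\<^sup>b t\<close>. It
  separates into a bound in \<open>t\<close> and the factor \<open>i\<close> to the power \<open>- b max p s\<close>, which is summable
  because \<open>b s > 1\<close>.
\<close>

lemma weighted_rows_le_growth:
  fixes r \<alpha> b p \<epsilon> D :: real
  assumes r: "1 < r" and \<alpha>: "0 < \<alpha>" and b: "0 < b" and p: "0 < p" and \<epsilon>: "0 < \<epsilon>" and D: "0 < D"
  defines "s \<equiv> (r - 1) / \<alpha>"
  assumes bs: "1 < b * s"
  obtains C where "0 \<le> C" "\<And>t. 0 \<le> t \<Longrightarrow>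
    (\<Sum>n. \<Sum>i=1..Suc n. ennreal (row_term r \<alpha> p \<epsilon> (D * real i powr - b * t) n)) \<le> ennreal (C * (1 + growth p s t))"
proof -
  have s: "0 < s" using r \<alpha> by (simp add: s_def)
  obtain C0 where C0: "0 \<le> C0" "\<And>u. 0 \<le> u \<Longrightarrow> (\<Sum>n. ennreal (row_term r \<alpha> p \<epsilon> u n)) \<le>
    ennreal (C0 * (if p > s then u powr p else if p = s then u powr s * (1 + max 0 (ln u)) else u powr s))"
    using row_series_le[OF r \<alpha> p \<epsilon>] unfolding s_def by blast
  define \<sigma> where "\<sigma> = max p s"
  have \<sigma>: "s \<le> \<sigma>" "p \<le> \<sigma>" by (auto simp: \<sigma>_def)
  define c where "c = 1 + max 0 (ln D)"
  define K where "K = D powr \<sigma> * c * exp s * 3"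
  have K: "0 \<le> K" by (simp add: K_def c_def)
  have term_le: "(if p > s then u powr p else if p = s then u powr s * (1 + max 0 (ln u)) else u powr s)
     \<le> real i powr - (b * \<sigma>) * (K * (1 + growth p s t))"
    if t: "0 \<le> t" and i: "1 \<le> i" and u: "u = D * real i powr - b * t" for t u and i :: nat
  proof -
    have u\<sigma>: "u powr \<sigma> = real i powr - (b * \<sigma>) * (D powr \<sigma> * t powr \<sigma>)"
      unfolding u using D t by (simp add: powr_mult powr_powr mult_ac)
    have c1: "1 \<le> c" by (simp add: c_def)
    have e1: "1 \<le> exp s" using s by simp
    have ce: "1 \<le> c * exp s" using mult_mono[of 1 c 1 "exp s"] c1 e1 by simp
    have K1: "D powr \<sigma> \<le> K"
      unfolding K_def using ce mult_left_mono[of 1 "c * exp s * 3" "D powr \<sigma>"] by (simp add: mult_ac)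
    show ?thesis
    proof (cases "p = s")
      case False
      then have g: "growth p s t = t powr \<sigma>" unfolding growth_def \<sigma>_def by auto
      have "D powr \<sigma> * t powr \<sigma> \<le> K * (1 + growth p s t)"
        unfolding g using K1 K by (intro mult_mono) auto
      then have "u powr \<sigma> \<le> real i powr - (b * \<sigma>) * (K * (1 + growth p s t))"
        unfolding u\<sigma> by (intro mult_left_mono) auto
      then show ?thesis using False by (auto simp: \<sigma>_def max_def split: if_splits)
    next
      case True
      then have \<sigma>s: "\<sigma> = s" by (simp add: \<sigma>_def)
      have g: "growth p s t = max 0 (t powr s * ln t)" unfolding growth_def using True by simp
      have ln_u: "1 + max 0 (ln u) \<le> c * (1 + max 0 (ln t))"
      proof (cases "t = 0")
        case True then show ?thesis using u c1 by simp
      next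
        case False
        then have t0: "0 < t" using t by simp
        have "ln u = ln D + ln (real i powr - b) + ln t" unfolding u using D t0 i by (simp add: ln_mult)
        moreover have "ln (real i powr - b) \<le> 0" using i b by (simp add: ln_powr)
        ultimately have "ln u \<le> max 0 (ln D) + max 0 (ln t)" by linarith
        moreover have "1 + (x + y) \<le> (1 + x) * (1 + y)" if "0 \<le> x" "0 \<le> y" for x y :: real
          using that by (simp add: algebra_simps)
        from this[of "max 0 (ln D)" "max 0 (ln t)"]
        have "1 + (max 0 (ln D) + max 0 (ln t)) \<le> c * (1 + max 0 (ln t))" unfolding c_def by simp
        moreover have "0 \<le> max 0 (ln D) + max 0 (ln t)" by simp
        ultimately show ?thesis by linarith
      qed
      have tg: "t powr s * (1 + max 0 (ln t)) \<le> exp s * 3 * (1 + growth p s t)"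
      proof -
        have le1: "t powr s * max 0 (ln t) \<le> growth p s t"
          unfolding g by (simp add: max_def)
        have le2: "t powr s \<le> exp s + growth p s t"
        proof (cases "t \<le> exp 1")
          case True
          then have "t powr s \<le> exp 1 powr s" using t s by (intro powr_mono2) auto
          then show ?thesis unfolding g by (simp add: exp_powr_real)
        next
          case False
          then have t0: "0 < t" using t exp_gt_zero[of "1::real"] by linarith
          then have "1 \<le> ln t" using False ln_mono[of "exp 1" t] by simp
          then have "t powr s * 1 \<le> t powr s * ln t" by (intro mult_left_mono) auto
          then have "t powr s \<le> growth p s t" unfolding g by simp
          then show ?thesis using exp_gt_zero[of s] by linarith
        qed
        have g0: "0 \<le> growth p s t" unfolding g by simp
        then have ge: "growth p s t \<le> exp s * growth p s t" using e1 mult_right_mono[of 1 "exp s" "growth p s t"] by simp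
        have "t powr s * (1 + max 0 (ln t)) = t powr s + t powr s * max 0 (ln t)" by (simp add: algebra_simps)
        moreover have "exp s * 3 * (1 + growth p s t) = 3 * exp s + 3 * (exp s * growth p s t)"
          by (simp add: algebra_simps)
        ultimately show ?thesis using le1 le2 e1 ge g0 by linarith
      qed
      have "u powr s * (1 + max 0 (ln u)) \<le> u powr s * (c * (1 + max 0 (ln t)))"
        by (intro mult_left_mono ln_u) auto
      also have "\<dots> = real i powr - (b * \<sigma>) * (D powr \<sigma> * c * (t powr s * (1 + max 0 (ln t))))"
        using u\<sigma> unfolding \<sigma>s by (simp add: mult_ac)
      also have "\<dots> \<le> real i powr - (b * \<sigma>) * (D powr \<sigma> * c * (exp s * 3 * (1 + growth p s t)))"
        using c1 by (intro mult_left_mono tg) auto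
      also have "\<dots> = real i powr - (b * \<sigma>) * (K * (1 + growth p s t))"
        unfolding K_def by (simp only: mult_ac)
      finally show ?thesis using True by simp
    qed
  qed
  have "1 < b * \<sigma>" using bs b \<sigma>(1) by (meson less_le_trans mult_left_mono less_imp_le)
  then have "summable (\<lambda>i. real i powr - (b * \<sigma>))" by (simp add: summable_real_powr_iff)
  then have summ: "summable (\<lambda>i. real (Suc i) powr - (b * \<sigma>))" by (subst summable_Suc_iff)
  define S where "S = (\<Sum>i. real (Suc i) powr - (b * \<sigma>))"
  have S0: "0 \<le> S" unfolding S_def by (intro suminf_nonneg summ) auto
  show ?thesis
  proof (rule that[of "S * C0 * K"])
    show "0 \<le> S * C0 * K" using S0 C0(1) K by simp
    fix t :: real assume t: "0 \<le> t"
    have g0: "0 \<le> growth p s t" by (simp add: growth_def)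
    let ?a = "\<lambda>i n. ennreal (row_term r \<alpha> p \<epsilon> (D * real i powr - b * t) n)"
    have "(\<Sum>i=1..Suc n. ?a i n) \<le> (\<Sum>i. ?a (Suc i) n)" for n
    proof -
      have "(\<Sum>i=1..Suc n. ?a i n) = (\<Sum>i<Suc n. ?a (Suc i) n)"
        by (rule sum.reindex_bij_witness[of _ Suc "\<lambda>i. i - 1"]) auto
      also have "\<dots> \<le> (\<Sum>i. ?a (Suc i) n)" by (intro sum_le_suminf) auto
      finally show ?thesis .
    qed
    then have "(\<Sum>n. \<Sum>i=1..Suc n. ?a i n) \<le> (\<Sum>n. \<Sum>i. ?a (Suc i) n)" by (intro suminf_le summableI)
    also have "\<dots> = (\<Sum>i. \<Sum>n. ?a (Suc i) n)" by (rule ennreal_suminf_swap)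
    also have "\<dots> \<le> (\<Sum>i. ennreal (real (Suc i) powr - (b * \<sigma>) * (C0 * K * (1 + growth p s t))))"
    proof (intro suminf_le summableI)
      fix i
      let ?u = "D * real (Suc i) powr - b * t"
      have "(\<Sum>n. ?a (Suc i) n) \<le> ennreal (C0 *
          (if p > s then ?u powr p else if p = s then ?u powr s * (1 + max 0 (ln ?u)) else ?u powr s))"
        using D t by (intro C0(2)) auto
      also have "\<dots> \<le> ennreal (C0 * (real (Suc i) powr - (b * \<sigma>) * (K * (1 + growth p s t))))"
        by (intro ennreal_leI mult_left_mono C0(1) term_le[OF t _ refl]) auto
      finally show "(\<Sum>n. ?a (Suc i) n) \<le> ennreal (real (Suc i) powr - (b * \<sigma>) * (C0 * K * (1 + growth p s t)))"
        by (simp add: mult_ac)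
    qed
    also have "\<dots> = ennreal (\<Sum>i. real (Suc i) powr - (b * \<sigma>) * (C0 * K * (1 + growth p s t)))"
      using C0(1) K g0 by (intro suminf_ennreal2 summable_mult2 summ) auto
    also have "\<dots> = ennreal (S * C0 * K * (1 + growth p s t))"
      unfolding S_def by (subst suminf_mult2[OF summ, symmetric]) (simp add: mult_ac)
    finally show "(\<Sum>n. \<Sum>i=1..Suc n. ?a i n) \<le> ennreal (S * C0 * K * (1 + growth p s t))" .
  qed
qed

text \<open>
  The exponents are chosen so that \<open>- b \<theta> \<le> \<gamma> - 1\<close> with \<open>\<gamma> > 0\<close>; the sum over \<open>i\<close> is then at most of
  order \<open>n\<^sup>\<gamma>\<close>, and \<open>\<gamma> - \<alpha> \<theta> = - \<eta>\<close>. The condition \<open>(\<alpha> + b) \<theta> > 1\<close> leaves room for \<open>\<eta> > 0\<close>.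
\<close>

lemma weight_power_sum_le:
  fixes \<alpha> b \<theta> :: real
  assumes \<alpha>: "0 < \<alpha>" and b: "0 < b" and \<theta>: "0 < \<theta>" and q: "1 < (\<alpha> + b) * \<theta>"
  obtains \<eta> C where "0 < \<eta>" "0 < C"
    "\<And>n. (\<Sum>i=1..Suc n. (real i powr - b * real (Suc n) powr - \<alpha>) powr \<theta>) \<le> C * real (Suc n) powr - \<eta>"
proof -
  define \<eta> where "\<eta> = min (\<alpha> * \<theta> / 2) ((\<alpha> + b) * \<theta> - 1)"
  define \<gamma> where "\<gamma> = \<alpha> * \<theta> - \<eta>"
  have \<eta>: "0 < \<eta>" using \<alpha> \<theta> q by (simp add: \<eta>_def)
  have "\<eta> \<le> \<alpha> * \<theta> / 2" unfolding \<eta>_def by (rule min.cobounded1)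
  moreover have "0 < \<alpha> * \<theta>" using \<alpha> \<theta> by simp
  ultimately have \<gamma>: "0 < \<gamma>" unfolding \<gamma>_def by linarith
  have \<gamma>b: "1 - b * \<theta> \<le> \<gamma>" unfolding \<gamma>_def \<eta>_def by (simp add: min_def algebra_simps)
  show ?thesis
  proof (rule that[of \<eta> "max 1 (1 / \<gamma>)"])
    fix n
    have "(\<Sum>i=1..Suc n. (real i powr - b * real (Suc n) powr - \<alpha>) powr \<theta>)
       = (\<Sum>i<Suc n. (real (Suc i) powr - b * real (Suc n) powr - \<alpha>) powr \<theta>)"
      by (rule sum.reindex_bij_witness[of _ Suc "\<lambda>i. i - 1"]) auto
    also have "\<dots> \<le> (\<Sum>i<Suc n. real (Suc i) powr (\<gamma> - 1) * real (Suc n) powr - (\<alpha> * \<theta>))"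
    proof (rule sum_mono)
      fix i
      have "(real (Suc i) powr - b * real (Suc n) powr - \<alpha>) powr \<theta>
          = real (Suc i) powr - (b * \<theta>) * real (Suc n) powr - (\<alpha> * \<theta>)"
        by (simp add: powr_mult powr_powr)
      also have "\<dots> \<le> real (Suc i) powr (\<gamma> - 1) * real (Suc n) powr - (\<alpha> * \<theta>)"
        using \<gamma>b by (intro mult_right_mono powr_mono) auto
      finally show "(real (Suc i) powr - b * real (Suc n) powr - \<alpha>) powr \<theta>
        \<le> real (Suc i) powr (\<gamma> - 1) * real (Suc n) powr - (\<alpha> * \<theta>)" .
    qed
    also have "\<dots> = (\<Sum>i<Suc n. real (Suc i) powr (\<gamma> - 1)) * real (Suc n) powr - (\<alpha> * \<theta>)"
      by (rule sum_distrib_right[symmetric])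
    also have "\<dots> \<le> (max 1 (1 / \<gamma>) * real (Suc n) powr \<gamma>) * real (Suc n) powr - (\<alpha> * \<theta>)"
      by (intro mult_right_mono sum_powr_le \<gamma>) auto
    also have "\<dots> = max 1 (1 / \<gamma>) * real (Suc n) powr - \<eta>"
      unfolding mult.assoc powr_add[symmetric] by (simp add: \<gamma>_def)
    finally show "(\<Sum>i=1..Suc n. (real i powr - b * real (Suc n) powr - \<alpha>) powr \<theta>)
      \<le> max 1 (1 / \<gamma>) * real (Suc n) powr - \<eta>" .
  qed (use \<eta> in \<open>auto simp: less_max_iff_disj\<close>)
qed

section \<open>Row sums and the moment condition\<close>

lemma nn_integral_shifted_powr_finite:
  fixes \<epsilon> m :: real
  assumes \<epsilon>: "0 < \<epsilon>" and m: "1 < m"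
  shows "(\<integral>\<^sup>+x\<in>{0..}. ennreal ((x + \<epsilon>) powr - m) \<partial>lborel) < \<infinity>"
proof -
  define F where "F x = - ((x + \<epsilon>) powr (1 - m)) / (m - 1)" for x :: real
  have "filterlim (\<lambda>x::real. x + \<epsilon>) at_top at_top"
    by (rule filterlim_tendsto_add_at_top[OF tendsto_const filterlim_ident, of \<epsilon>, simplified add.commute])
  then have "((\<lambda>x. (x + \<epsilon>) powr (1 - m)) \<longlongrightarrow> 0) at_top"
    using m by (intro tendsto_neg_powr) auto
  then have lim: "(F \<longlongrightarrow> 0) at_top"
    unfolding F_def using tendsto_divide[OF tendsto_minus tendsto_const, of _ 0 at_top "m - 1"] m by fastforce
  have "(\<integral>\<^sup>+x\<in>{0..}. ennreal ((x + \<epsilon>) powr - m) \<partial>lborel) = ennreal (0 - F 0)"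
  proof (rule nn_integral_FTC_atLeast[OF _ _ _ lim])
    fix x :: real assume x: "0 \<le> x"
    have "(F has_real_derivative - ((1 - m) * (x + \<epsilon>) powr (1 - m - 1)) / (m - 1)) (at x)"
      unfolding F_def using x \<epsilon> m by (auto intro!: derivative_eq_intros)
    moreover have "- ((1 - m) * (x + \<epsilon>) powr (1 - m - 1)) / (m - 1) = (x + \<epsilon>) powr - m"
      using m by (simp add: field_simps)
    ultimately show "(F has_real_derivative (x + \<epsilon>) powr - m) (at x)" by simp
  qed auto
  then show ?thesis by simp
qed

text \<open>
  The weight \<open>n powr (r - 2)\<close> of the series enters the integrand, which becomes \<open>row_term\<close>.
\<close>

lemma is_quantile_row:
  assumes T: "is_quantile M E X T" and p: "0 < p" and d: "0 \<le> d"
  shows "ennreal (real (Suc n) powr (r - 2)) *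
      choquet_pos M E (\<lambda>\<omega>. max 0 ((d * \<bar>X \<omega>\<bar> * real (Suc n) powr - \<alpha>) powr p - \<epsilon>))
    = (\<integral>\<^sup>+l\<in>{0<..<1}. ennreal (row_term r \<alpha> p \<epsilon> (d * T l) n) \<partial>lborel)"
proof -
  note [measurable] = is_quantileD(1)[OF T]
  let ?\<phi> = "\<lambda>t. max 0 ((d * t * real (Suc n) powr - \<alpha>) powr p - \<epsilon>)"
  have "choquet_pos M E (\<lambda>\<omega>. ?\<phi> \<bar>X \<omega>\<bar>) = (\<integral>\<^sup>+l\<in>{0<..<1}. ennreal (?\<phi> (T l)) \<partial>lborel)"
  proof (rule is_quantileD(3)[OF T])
    show "continuous_on {0..} ?\<phi>" using p d by (intro continuous_intros continuous_on_powr') auto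
    show "mono_on {0..} ?\<phi>" using p d
      by (intro mono_onI max.mono diff_right_mono powr_mono2 mult_right_mono mult_left_mono) auto
  qed auto
  then have "ennreal (real (Suc n) powr (r - 2)) * choquet_pos M E (\<lambda>\<omega>. ?\<phi> \<bar>X \<omega>\<bar>)
      = (\<integral>\<^sup>+l. ennreal (real (Suc n) powr (r - 2)) * (ennreal (?\<phi> (T l)) * indicator {0<..<1} l) \<partial>lborel)"
    by (simp add: nn_integral_cmult)
  also have "\<dots> = (\<integral>\<^sup>+l\<in>{0<..<1}. ennreal (row_term r \<alpha> p \<epsilon> (d * T l) n) \<partial>lborel)"
    by (intro nn_integral_cong) (simp add: row_term_def ennreal_mult mult.assoc)
  finally show ?thesis .
qed

definition row_excess :: "(nat \<Rightarrow> nat \<Rightarrow> real) \<Rightarrow> (nat \<Rightarrow> 'a \<Rightarrow> real) \<Rightarrow> real \<Rightarrow> real \<Rightarrow> nat \<Rightarrow> 'a \<Rightarrow> real" where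
  "row_excess a Xs p \<epsilon> m \<omega> = max (Max ((\<lambda>k. \<bar>\<Sum>i=1..k. a m i * Xs i \<omega>\<bar> powr p) ` {1..m}) - \<epsilon>) 0"

lemma row_excess_nonneg: "0 \<le> row_excess a Xs p \<epsilon> m \<omega>"
  by (simp add: row_excess_def)

lemma row_excess_gt_iff:
  "1 \<le> m \<Longrightarrow> 0 \<le> x \<Longrightarrow> x < row_excess a Xs p \<epsilon> m \<omega> \<longleftrightarrow>
     (\<exists>k\<in>{1..m}. x + \<epsilon> < \<bar>\<Sum>i=1..k. a m i * Xs i \<omega>\<bar> powr p)"
  unfolding row_excess_def less_max_iff_disj less_diff_eq by (subst Max_gr_iff) auto

context sublinear_expectation_space
begin

text \<open>
  The positive integral sees a function at levels \<open>x \<ge> 0\<close>, where \<open>|X|\<^sup>s ln |X|\<close> and its positive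
  part have the same superlevel sets.
\<close>

lemma moment_conditions_iff_growth:
  "(p > s \<longrightarrow> choquet M E (\<lambda>\<omega>. \<bar>X \<omega>\<bar> powr p) < \<infinity>) \<and>
   (p = s \<longrightarrow> choquet M E (\<lambda>\<omega>. \<bar>X \<omega>\<bar> powr s * ln \<bar>X \<omega>\<bar>) < \<infinity>) \<and>
   (p < s \<longrightarrow> choquet M E (\<lambda>\<omega>. \<bar>X \<omega>\<bar> powr s) < \<infinity>)
   \<longleftrightarrow> choquet_pos M E (\<lambda>\<omega>. growth p s \<bar>X \<omega>\<bar>) < \<infinity>"
proof -
  have "choquet_pos M E (\<lambda>\<omega>. max 0 (\<bar>X \<omega>\<bar> powr s * ln \<bar>X \<omega>\<bar>)) = choquet_pos M E (\<lambda>\<omega>. \<bar>X \<omega>\<bar> powr s * ln \<bar>X \<omega>\<bar>)"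
    by (rule choquet_pos_cong_tail) (auto simp: less_max_iff_disj intro!: arg_cong[where f = "capacity E"])
  then show ?thesis
    unfolding choquet_finite_iff_pos growth_def
    by (cases "p > s"; cases "p = s") (auto simp del: infinity_ennreal_def)
qed

lemma ident_distributed_choquet_pos:
  assumes id: "ident_distributed H E Y X" and YH: "Y \<in> H" and XH: "X \<in> H"
    and g[measurable]: "g \<in> borel_measurable borel"
  shows "choquet_pos M E (\<lambda>\<omega>. g (Y \<omega>)) = choquet_pos M E (\<lambda>\<omega>. g (X \<omega>))"
proof (rule choquet_pos_cong_tail)
  fix x :: real
  have "{t. g t > x} \<in> sets borel" by measurable
  from ident_distributed_capacity[OF id YH XH this]
  show "capacity E {\<omega>\<in>space M. g (Y \<omega>) > x} = capacity E {\<omega>\<in>space M. g (X \<omega>) > x}" by simp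
qed

text \<open>
  Necessity. A single row with finite Choquet integral shows that \<open>|X|\<close> has a quantile function \<open>T\<close>.
  The lower bound of the row series by \<open>growth\<close> is then integrated along \<open>T\<close>.
\<close>

lemma growth_finite_of_rows:
  assumes XH: "X \<in> H" and r: "1 < r" and \<alpha>: "0 < \<alpha>" and p: "0 < p" and \<epsilon>: "0 < \<epsilon>" and c: "0 < c"
    and fin: "(\<Sum>n. ennreal (real (Suc n) powr (r - 2)) * \<Phi> n) < \<infinity>"
    and \<Phi>: "\<And>n. n0 \<le> n \<Longrightarrow>
      choquet_pos M E (\<lambda>\<omega>. max 0 ((c * \<bar>X \<omega>\<bar> * real (Suc n) powr - \<alpha>) powr p - \<epsilon>)) \<le> \<Phi> n"
  shows "choquet_pos M E (\<lambda>\<omega>. growth p ((r - 1) / \<alpha>) \<bar>X \<omega>\<bar>) < \<infinity>"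
proof -
  define s where "s = (r - 1) / \<alpha>"
  have s: "0 < s" using r \<alpha> by (simp add: s_def)
  have X[measurable]: "X \<in> borel_measurable M" by (rule H_meas[OF XH])
  let ?\<phi> = "\<lambda>n t. max 0 ((c * t * real (Suc n) powr - \<alpha>) powr p - \<epsilon>)"
  have fin1: "\<Phi> n < \<infinity>" for n
  proof -
    have "ennreal (real (Suc n) powr (r - 2)) * \<Phi> n < \<infinity>" using fin by (rule ennreal_suminf_lessD)
    then show ?thesis by (auto simp: ennreal_mult_less_top)
  qed
  have tight: "\<exists>t\<ge>0. capacity E {\<omega>\<in>space M. \<bar>X \<omega>\<bar> > t} \<le> ereal l" if "0 < l" for l
  proof (rule tight_of_choquet_pos[of X "?\<phi> n0"])
    show "choquet_pos M E (\<lambda>\<omega>. ?\<phi> n0 \<bar>X \<omega>\<bar>) < \<infinity>"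
      using \<Phi>[of n0] fin1[of n0] by (simp add: le_less_trans)
    fix x :: real
    let ?d = "c * real (Suc n0) powr - \<alpha>"
    have d: "0 < ?d" using c by simp
    let ?y = "(\<bar>x\<bar> + \<epsilon>) powr (1 / p)"
    show "\<exists>t\<ge>0. \<forall>u>t. x < ?\<phi> n0 u"
    proof (intro exI[of _ "?y / ?d"] conjI allI impI)
      show "0 \<le> ?y / ?d" using d by simp
      fix u assume "?y / ?d < u"
      then have "?y < c * u * real (Suc n0) powr - \<alpha>" using d by (simp add: pos_divide_less_eq mult_ac)
      then have "?y powr p < (c * u * real (Suc n0) powr - \<alpha>) powr p" using p by (intro powr_less_mono2) auto
      moreover have "?y powr p = \<bar>x\<bar> + \<epsilon>" using p \<epsilon> by (simp add: powr_powr)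
      ultimately show "x < ?\<phi> n0 u" by auto
    qed
  qed (use that in measurable)
  obtain T where T: "is_quantile M E X T" using quantile_representation[OF X tight] .
  note [measurable] = is_quantileD(1)[OF T]
  let ?R = "\<lambda>n l. if n0 \<le> n then row_term r \<alpha> p \<epsilon> (c * T l) n else 0"
  have R[measurable]: "?R n \<in> borel_measurable borel" for n unfolding row_term_def by measurable
  have row: "(\<integral>\<^sup>+l\<in>{0<..<1}. ennreal (?R n l) \<partial>lborel) \<le> ennreal (real (Suc n) powr (r - 2)) * \<Phi> n" for n
  proof (cases "n0 \<le> n")
    case True
    then have "(\<integral>\<^sup>+l\<in>{0<..<1}. ennreal (?R n l) \<partial>lborel)
        = (\<integral>\<^sup>+l\<in>{0<..<1}. ennreal (row_term r \<alpha> p \<epsilon> (c * T l) n) \<partial>lborel)" by simp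
    also have "\<dots> = ennreal (real (Suc n) powr (r - 2)) * choquet_pos M E (\<lambda>\<omega>. ?\<phi> n \<bar>X \<omega>\<bar>)"
      by (rule is_quantile_row[OF T p, symmetric]) (use c in simp)
    also have "\<dots> \<le> ennreal (real (Suc n) powr (r - 2)) * \<Phi> n"
      by (intro mult_left_mono \<Phi> True) auto
    finally show ?thesis .
  qed simp
  obtain C where C: "0 \<le> C" "\<And>t. 0 \<le> t \<Longrightarrow> ennreal (growth p s t) \<le>
    ennreal C * (1 + (\<Sum>n. ennreal (if n0 \<le> n then row_term r \<alpha> p \<epsilon> (c * t) n else 0)))"
    using growth_le_row_series[OF r \<alpha> p \<epsilon> c, of n0] unfolding s_def by blast
  have "choquet_pos M E (\<lambda>\<omega>. growth p s \<bar>X \<omega>\<bar>) = (\<integral>\<^sup>+l\<in>{0<..<1}. ennreal (growth p s (T l)) \<partial>lborel)"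
    by (intro is_quantileD(3)[OF T] growth_continuous growth_mono growth_nonneg p s)
  also have "\<dots> \<le> (\<integral>\<^sup>+l. ennreal C * (indicator {0<..<1} l + (\<Sum>n. ennreal (?R n l) * indicator {0<..<1} l)) \<partial>lborel)"
    using C(2)[OF is_quantileD(2)[OF T]] by (intro nn_integral_mono) (auto simp: indicator_def)
  also have "\<dots> = ennreal C * ((\<integral>\<^sup>+l. indicator {0<..<1::real} l \<partial>lborel) + (\<Sum>n. \<integral>\<^sup>+l\<in>{0<..<1}. ennreal (?R n l) \<partial>lborel))"
    by (subst nn_integral_cmult, measurable, subst nn_integral_add, measurable, subst nn_integral_suminf) measurable
  also have "\<dots> \<le> ennreal C * (1 + (\<Sum>n. ennreal (real (Suc n) powr (r - 2)) * \<Phi> n))"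
    by (intro mult_left_mono add_mono suminf_le summableI row) auto
  also have "\<dots> < \<infinity>" using fin by (auto simp: ennreal_mult_less_top)
  finally show ?thesis by (simp add: s_def)
qed



text \<open>
  For \<open>t \<ge> exp 1\<close> this is the Markov inequality for \<open>growth p s |X| \<ge> |X|\<^sup>s\<close>; for smaller \<open>t\<close> the
  constant \<open>exp s\<close> makes the right side at least \<open>1\<close>.
\<close>

lemma tail_of_growth:
  assumes XH: "X \<in> H" and p: "0 < p" and s: "0 < s"
    and fin: "choquet_pos M E (\<lambda>\<omega>. growth p s \<bar>X \<omega>\<bar>) < \<infinity>"
  obtains K where "0 \<le> K"
    "\<And>t. 1 \<le> t \<Longrightarrow> capacity E {\<omega>\<in>space M. \<bar>X \<omega>\<bar> > t} \<le> ereal (K * t powr - s)"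
proof -
  have X[measurable]: "X \<in> borel_measurable M" by (rule H_meas[OF XH])
  obtain I where I: "choquet_pos M E (\<lambda>\<omega>. growth p s \<bar>X \<omega>\<bar>) = ennreal I" "0 \<le> I"
    using fin by (cases "choquet_pos M E (\<lambda>\<omega>. growth p s \<bar>X \<omega>\<bar>)") auto
  show ?thesis
  proof (rule that[of "max I (exp s)"])
    show "0 \<le> max I (exp s)" by (simp add: le_max_iff_disj)
    fix t :: real assume t: "1 \<le> t"
    let ?A = "{\<omega>\<in>space M. \<bar>X \<omega>\<bar> > t}" and ?B = "{\<omega>\<in>space M. growth p s \<bar>X \<omega>\<bar> > t powr s}"
    have A: "?A \<in> sets M" and B: "?B \<in> sets M" by measurable
    obtain v where v: "capacity E ?A = ereal v" "0 \<le> v" "v \<le> 1" using capacity_eq_ereal[OF A] .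
    obtain v' where v': "capacity E ?B = ereal v'" "0 \<le> v'" using capacity_eq_ereal[OF B] .
    have "t powr s * v \<le> max I (exp s)"
    proof (cases "exp 1 \<le> t")
      case True
      have "?A \<subseteq> ?B"
      proof safe
        fix \<omega> assume "t < \<bar>X \<omega>\<bar>"
        then have "t powr s < \<bar>X \<omega>\<bar> powr s" using t s by (intro powr_less_mono2) auto
        also have "\<dots> \<le> growth p s \<bar>X \<omega>\<bar>" using True \<open>t < \<bar>X \<omega>\<bar>\<close> p s by (intro powr_le_growth) auto
        finally show "t powr s < growth p s \<bar>X \<omega>\<bar>" .
      qed
      then have "v \<le> v'" using capacity_mono[OF A B] v v' by simp
      then have "t powr s * v \<le> t powr s * v'" by (intro mult_left_mono) auto
      also have "ennreal (t powr s) * ennreal v' \<le> ennreal I"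
        using choquet_pos_markov[of "\<lambda>\<omega>. growth p s \<bar>X \<omega>\<bar>" "t powr s"] v' I by simp
      then have "t powr s * v' \<le> I" using v' I by (simp flip: ennreal_mult)
      finally show ?thesis by simp
    next
      case False
      then have "t powr s \<le> exp 1 powr s" using t s by (intro powr_mono2) auto
      then have "t powr s * v \<le> exp s * 1" using v by (intro mult_mono) (auto simp: exp_powr_real)
      then show ?thesis by simp
    qed
    then have "v \<le> max I (exp s) * t powr - s" using t by (simp add: powr_minus field_simps)
    then show "capacity E ?A \<le> ereal (max I (exp s) * t powr - s)" using v by simp
  qed
qed

lemma row_excess_measurable:
  assumes "\<And>n. n \<ge> 1 \<Longrightarrow> Xs n \<in> H"
  shows "row_excess a Xs p \<epsilon> m \<in> borel_measurable M"
proof -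
  have "(\<lambda>\<omega>. \<bar>\<Sum>i=1..k. a m i * Xs i \<omega>\<bar> powr p) \<in> borel_measurable M" for k
  proof -
    have "(\<lambda>\<omega>. a m i * Xs i \<omega>) \<in> borel_measurable M" if "i \<in> {1..k}" for i
      using H_meas[OF assms[of i]] that by simp
    then have "(\<lambda>\<omega>. \<Sum>i=1..k. a m i * Xs i \<omega>) \<in> borel_measurable M" by (rule borel_measurable_sum)
    then show ?thesis by measurable
  qed
  then show ?thesis
    unfolding row_excess_def[abs_def] by (intro borel_measurable_max borel_measurable_diff borel_measurable_Max) auto
qed

text \<open>
  For one fixed row, whose weights may be arbitrary. A partial sum of at most \<open>m\<close> summands exceeds a
  level only when some summand exceeds the \<open>m\<close>-th part of it, and \<open>|X|\<^sup>p\<close> is dominated by \<open>growth p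
  s |X|\<close> up to a constant.
\<close>

lemma row_excess_choquet_finite:
  assumes Xs: "\<And>n. n \<ge> 1 \<Longrightarrow> Xs n \<in> H" and XH: "X \<in> H"
    and ident: "\<And>n. n \<ge> 1 \<Longrightarrow> ident_distributed H E (Xs n) X"
    and p: "0 < p" and s: "0 < s" and \<epsilon>: "0 < \<epsilon>"
    and T: "is_quantile M E X T"
    and fin: "choquet_pos M E (\<lambda>\<omega>. growth p s \<bar>X \<omega>\<bar>) < \<infinity>" and m: "1 \<le> m"
  shows "choquet_pos M E (row_excess a Xs p \<epsilon> m) < \<infinity>"
proof -
  note Tm[measurable] = is_quantileD(1)[OF T]
  have finT: "(\<integral>\<^sup>+l\<in>{0<..<1}. ennreal (growth p s (T l)) \<partial>lborel) < \<infinity>"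
    using fin is_quantileD(3)[OF T growth_continuous[OF p s] growth_mono[OF p s] growth_nonneg] by simp
  have single: "choquet_pos M E (\<lambda>\<omega>. (d * \<bar>X \<omega>\<bar>) powr p) < \<infinity>" if d: "0 \<le> d" for d
  proof -
    have "choquet_pos M E (\<lambda>\<omega>. (d * \<bar>X \<omega>\<bar>) powr p) = (\<integral>\<^sup>+l\<in>{0<..<1}. ennreal ((d * T l) powr p) \<partial>lborel)"
    proof (rule is_quantileD(3)[OF T])
      show "continuous_on {0..} (\<lambda>t. (d * t) powr p)" using p d by (intro continuous_intros continuous_on_powr') auto
      show "mono_on {0..} (\<lambda>t. (d * t) powr p)" using p d by (intro mono_onI powr_mono2 mult_left_mono) auto
    qed auto
    also have "\<dots> \<le> (\<integral>\<^sup>+l. ennreal (d powr p * exp p) * indicator {0<..<1} l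
        + ennreal (d powr p) * (ennreal (growth p s (T l)) * indicator {0<..<1} l) \<partial>lborel)"
    proof (intro nn_integral_mono)
      fix l
      have T0: "0 \<le> T l" by (rule is_quantileD(2)[OF T])
      have "T l powr p \<le> exp p + growth p s (T l)"
      proof (cases "exp 1 \<le> T l")
        case True
        then show ?thesis using powr_le_growth(2)[OF True p s] by (simp add: add_increasing)
      next
        case False
        then have "T l powr p \<le> exp 1 powr p" using T0 p by (intro powr_mono2) auto
        then show ?thesis using growth_nonneg[of p s "T l"] by (simp add: exp_powr_real)
      qed
      then have "d powr p * T l powr p \<le> d powr p * (exp p + growth p s (T l))" by (intro mult_left_mono) auto
      then have "(d * T l) powr p \<le> d powr p * exp p + d powr p * growth p s (T l)"
        by (simp add: powr_mult algebra_simps)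
      then have "ennreal ((d * T l) powr p) \<le> ennreal (d powr p * exp p + d powr p * growth p s (T l))" by (rule ennreal_leI)
      also have "\<dots> = ennreal (d powr p * exp p) + ennreal (d powr p) * ennreal (growth p s (T l))"
        using growth_nonneg by (simp add: ennreal_plus ennreal_mult)
      finally show "ennreal ((d * T l) powr p) * indicator {0<..<1} l \<le> ennreal (d powr p * exp p) * indicator {0<..<1} l
        + ennreal (d powr p) * (ennreal (growth p s (T l)) * indicator {0<..<1} l)"
        by (auto simp: indicator_def)
    qed
    also have "\<dots> = (\<integral>\<^sup>+l. ennreal (d powr p * exp p) * indicator {0<..<1::real} l \<partial>lborel)
        + ennreal (d powr p) * (\<integral>\<^sup>+l\<in>{0<..<1}. ennreal (growth p s (T l)) \<partial>lborel)"
      by (subst nn_integral_add) (auto simp: nn_integral_cmult)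
    also have "\<dots> < \<infinity>" using finT by (simp add: nn_integral_cmult ennreal_mult_less_top)
    finally show ?thesis .
  qed
  define d where "d i = real m * \<bar>a m i\<bar>" for i
  let ?g = "\<lambda>i \<omega>. (d i * \<bar>Xs i \<omega>\<bar>) powr p"
  have Xm: "Xs i \<in> borel_measurable M" if "i \<in> {1..m}" for i using H_meas Xs that by auto
  have gmeas: "?g i \<in> borel_measurable M" if "i \<in> {1..m}" for i using Xm[OF that] by measurable
  have "choquet_pos M E (row_excess a Xs p \<epsilon> m) \<le> (\<Sum>i\<in>{1..m}. choquet_pos M E (?g i)) + (\<integral>\<^sup>+x\<in>{0::real..}. ennreal 0 \<partial>lborel)"
  proof (rule choquet_pos_bound[where h = "\<lambda>_. 0"])
    show "row_excess a Xs p \<epsilon> m \<in> borel_measurable M" by (rule row_excess_measurable[OF Xs])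
    show "?g i \<in> borel_measurable M" if "i \<in> {1..m}" for i by (rule gmeas[OF that])
    fix x :: real assume x: "0 \<le> x"
    let ?A = "{\<omega>\<in>space M. row_excess a Xs p \<epsilon> m \<omega> > x}" and ?G = "\<lambda>i. {\<omega>\<in>space M. ?g i \<omega> > x}"
    have A: "?A \<in> sets M"
      by (rule borel_measurable_less[OF borel_measurable_const row_excess_measurable[OF Xs]])
    have G: "?G i \<in> sets M" if "i \<in> {1..m}" for i
      by (rule borel_measurable_less[OF borel_measurable_const gmeas[OF that]])
    have sub: "?A \<subseteq> (\<Union>i\<in>{1..m}. ?G i)"
    proof
      fix \<omega> assume "\<omega> \<in> ?A"
      then have \<omega>: "\<omega> \<in> space M" and "x < row_excess a Xs p \<epsilon> m \<omega>" by simp_all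
      from row_excess_gt_iff[OF m x, THEN iffD1, OF this(2)]
      obtain k where k: "k \<in> {1..m}" "x + \<epsilon> < \<bar>\<Sum>i=1..k. a m i * Xs i \<omega>\<bar> powr p" ..
      show "\<omega> \<in> (\<Union>i\<in>{1..m}. ?G i)"
      proof (rule ccontr)
        assume "\<omega> \<notin> (\<Union>i\<in>{1..m}. ?G i)"
        then have le: "(d i * \<bar>Xs i \<omega>\<bar>) powr p \<le> x" if "i \<in> {1..m}" for i using that \<omega> by (auto simp: not_less)
        have "\<bar>a m i * Xs i \<omega>\<bar> \<le> x powr (1 / p) / real m" if "i \<in> {1..m}" for i
        proof -
          have "((d i * \<bar>Xs i \<omega>\<bar>) powr p) powr (1 / p) \<le> x powr (1 / p)"
            using le[OF that] p by (intro powr_mono2) auto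
          then have "d i * \<bar>Xs i \<omega>\<bar> \<le> x powr (1 / p)" using p by (simp add: powr_powr d_def)
          then show ?thesis using m by (simp add: d_def abs_mult field_simps)
        qed
        then have "(\<Sum>i=1..k. \<bar>a m i * Xs i \<omega>\<bar>) \<le> (\<Sum>i=1..k. x powr (1 / p) / real m)"
          using k by (intro sum_mono) auto
        also have "\<dots> = real k / real m * x powr (1 / p)" by simp
        also have "\<dots> \<le> 1 * x powr (1 / p)" using k by (intro mult_right_mono) auto
        finally have "\<bar>\<Sum>i=1..k. a m i * Xs i \<omega>\<bar> \<le> x powr (1 / p)"
          using sum_abs[of "\<lambda>i. a m i * Xs i \<omega>" "{1..k}"] by linarith
        then have "\<bar>\<Sum>i=1..k. a m i * Xs i \<omega>\<bar> powr p \<le> (x powr (1 / p)) powr p" using p by (intro powr_mono2) auto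
        also have "\<dots> = x" using p x by (simp add: powr_powr)
        finally show False using k \<epsilon> by linarith
      qed
    qed
    have "capacity E ?A \<le> capacity E (\<Union>i\<in>{1..m}. ?G i)"
      by (rule capacity_mono[OF A sets.finite_UN[OF finite_atLeastAtMost G] sub])
    also have "\<dots> \<le> (\<Sum>i\<in>{1..m}. capacity E (?G i))"
      by (rule capacity_UN[OF finite_atLeastAtMost G])
    finally show "capacity E ?A \<le> (\<Sum>i\<in>{1..m}. capacity E (?G i)) + ereal 0" by simp
  qed auto
  also have "\<dots> = (\<Sum>i\<in>{1..m}. choquet_pos M E (\<lambda>\<omega>. (d i * \<bar>X \<omega>\<bar>) powr p))"
  proof -
    have "choquet_pos M E (?g i) = choquet_pos M E (\<lambda>\<omega>. (d i * \<bar>X \<omega>\<bar>) powr p)" if "i \<in> {1..m}" for i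
      using that by (intro ident_distributed_choquet_pos[OF ident Xs XH, of i "\<lambda>t. (d i * \<bar>t\<bar>) powr p"]) auto
    then show ?thesis by simp
  qed
  also have "\<dots> < \<infinity>" using single by (simp add: d_def less_top[symmetric])
  finally show ?thesis .
qed

text \<open>
  The maximal inequality at the level \<open>(x + \<epsilon>) powr (1 / p)\<close>, integrated over \<open>x \<ge> 0\<close>. The condition
  on \<open>B\<close> is the case \<open>x = 0\<close> of the requirement \<open>B < z powr \<theta>\<close>, and it implies the other cases.
\<close>

lemma row_excess_choquet_le:
  assumes indep: "indep_seq H E Xs" and Xs: "\<And>n. n \<ge> 1 \<Longrightarrow> Xs n \<in> H" and XH: "X \<in> H"
    and ident: "\<And>n. n \<ge> 1 \<Longrightarrow> ident_distributed H E (Xs n) X"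
    and dom: "dominated_moment M H E X \<theta> \<kappa>"
    and \<theta>: "0 < \<theta>" "\<theta> \<le> 1 \<or> (1 \<le> \<theta> \<and> \<theta> \<le> 2 \<and> E X = 0 \<and> E (\<lambda>\<omega>. - X \<omega>) = 0)"
    and N: "0 < N" and p: "0 < p" and \<epsilon>: "0 < \<epsilon>" and m: "1 \<le> m"
    and d: "\<And>i. i \<in> {1..m} \<Longrightarrow> \<bar>a m i\<bar> \<le> d i"
    and B: "(\<Sum>i=1..m. d i powr \<theta>) \<le> B" "0 < B" "B < (\<epsilon> powr (1 / p) / (2 * N)) powr \<theta>"
  shows "choquet_pos M E (row_excess a Xs p \<epsilon> m) \<le>
      (\<Sum>i=1..m. choquet_pos M E (\<lambda>\<omega>. max 0 ((2 * N * d i * \<bar>X \<omega>\<bar>) powr p - \<epsilon>)))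
      + ennreal (2 * exp (2 * \<kappa>) * (B * (2 * N) powr \<theta>) powr N)
        * (\<integral>\<^sup>+x\<in>{0..}. ennreal ((x + \<epsilon>) powr - (\<theta> * N / p)) \<partial>lborel)"
proof -
  let ?g = "\<lambda>i \<omega>. max 0 ((2 * N * d i * \<bar>X \<omega>\<bar>) powr p - \<epsilon>)"
  let ?c = "2 * exp (2 * \<kappa>) * (B * (2 * N) powr \<theta>) powr N"
  let ?h = "\<lambda>x. ?c * (x + \<epsilon>) powr - (\<theta> * N / p)"
  have [measurable]: "X \<in> borel_measurable M" by (rule H_meas[OF XH])
  have d0: "0 \<le> d i" if "i \<in> {1..m}" for i using d[OF that] by linarith
  have "choquet_pos M E (row_excess a Xs p \<epsilon> m) \<le>
      (\<Sum>i\<in>{1..m}. choquet_pos M E (?g i)) + (\<integral>\<^sup>+x\<in>{0..}. ennreal (?h x) \<partial>lborel)"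
  proof (rule choquet_pos_bound)
    show "row_excess a Xs p \<epsilon> m \<in> borel_measurable M" by (rule row_excess_measurable[OF Xs])
    fix x :: real assume x: "0 \<le> x"
    define z where "z = (x + \<epsilon>) powr (1 / p) / (2 * N)"
    have z: "0 < z" unfolding z_def using x \<epsilon> N by simp
    have Nz: "2 * N * z = (x + \<epsilon>) powr (1 / p)" unfolding z_def using N by simp
    have z_p: "t powr p > x + \<epsilon> \<longleftrightarrow> t > 2 * N * z" if "0 \<le> t" for t
    proof -
      have e: "((x + \<epsilon>) powr (1 / p)) powr p = x + \<epsilon>" using p x \<epsilon> by (simp add: powr_powr)
      show ?thesis
        unfolding Nz
      proof
        assume gt: "x + \<epsilon> < t powr p"
        show "(x + \<epsilon>) powr (1 / p) < t"
        proof (rule ccontr)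
          assume "\<not> (x + \<epsilon>) powr (1 / p) < t"
          then have "t powr p \<le> ((x + \<epsilon>) powr (1 / p)) powr p"
            using p that by (intro powr_mono2) auto
          then show False using e gt by linarith
        qed
      next
        assume "(x + \<epsilon>) powr (1 / p) < t"
        then have "((x + \<epsilon>) powr (1 / p)) powr p < t powr p" using p by (intro powr_less_mono2) auto
        then show "x + \<epsilon> < t powr p" unfolding e .
      qed
    qed
    have Bz: "B < z powr \<theta>"
    proof -
      have "\<epsilon> powr (1 / p) \<le> (x + \<epsilon>) powr (1 / p)" using x \<epsilon> p by (intro powr_mono2) auto
      then have "\<epsilon> powr (1 / p) / (2 * N) \<le> z" unfolding z_def using N by (intro divide_right_mono) auto
      then have "(\<epsilon> powr (1 / p) / (2 * N)) powr \<theta> \<le> z powr \<theta>"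
        using N \<theta> by (intro powr_mono2) auto
      then show ?thesis using B by linarith
    qed
    have Ba: "(\<Sum>i=1..m. \<bar>a m i\<bar> powr \<theta>) \<le> B"
    proof -
      have "(\<Sum>i=1..m. \<bar>a m i\<bar> powr \<theta>) \<le> (\<Sum>i=1..m. d i powr \<theta>)"
        using d \<theta> by (intro sum_mono powr_mono2) auto
      then show ?thesis using B by linarith
    qed
    have eq: "{\<omega>\<in>space M. row_excess a Xs p \<epsilon> m \<omega> > x} = {\<omega>\<in>space M. \<exists>k\<in>{1..m}. \<bar>\<Sum>i=1..k. a m i * Xs i \<omega>\<bar> > 2 * N * z}"
      using row_excess_gt_iff[OF m x, of a Xs p \<epsilon>] z_p by simp
    have "capacity E {\<omega>\<in>space M. row_excess a Xs p \<epsilon> m \<omega> > x} \<le>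
        (\<Sum>i=1..m. capacity E {\<omega>\<in>space M. \<bar>a m i * X \<omega>\<bar> > z}) + ereal (2 * exp (2 * \<kappa>) * (B / z powr \<theta>) powr N)"
      unfolding eq
      by (rule weighted_sum_maximal_bound[OF indep Xs XH ident dom \<theta> N z Ba B(2) Bz])
    also have "\<dots> \<le> (\<Sum>i=1..m. capacity E {\<omega>\<in>space M. ?g i \<omega> > x}) + ereal (?h x)"
    proof (intro add_mono sum_mono capacity_mono)
      fix i assume i: "i \<in> {1..m}"
      show "{\<omega>\<in>space M. \<bar>a m i * X \<omega>\<bar> > z} \<subseteq> {\<omega>\<in>space M. ?g i \<omega> > x}"
      proof safe
        fix \<omega> assume "z < \<bar>a m i * X \<omega>\<bar>"
        also have "\<dots> \<le> d i * \<bar>X \<omega>\<bar>" unfolding abs_mult by (intro mult_right_mono d i) auto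
        finally have "2 * N * z < 2 * N * d i * \<bar>X \<omega>\<bar>" using N by simp
        then have "x + \<epsilon> < (2 * N * d i * \<bar>X \<omega>\<bar>) powr p"
          using z_p[of "2 * N * d i * \<bar>X \<omega>\<bar>"] N d0[OF i] by simp
        then show "x < ?g i \<omega>" by simp
      qed
    next
      have "B / z powr \<theta> = B * (2 * N) powr \<theta> * (x + \<epsilon>) powr - (\<theta> / p)"
        unfolding z_def using x \<epsilon> N by (simp add: powr_divide powr_powr powr_minus divide_simps)
      then have "(B / z powr \<theta>) powr N = (B * (2 * N) powr \<theta>) powr N * (x + \<epsilon>) powr - (\<theta> * N / p)"
        using B N by (simp add: powr_mult powr_powr)
      then show "ereal (2 * exp (2 * \<kappa>) * (B / z powr \<theta>) powr N) \<le> ereal (?h x)" by simp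
    qed measurable
    finally show "capacity E {\<omega>\<in>space M. row_excess a Xs p \<epsilon> m \<omega> > x} \<le>
      (\<Sum>i=1..m. capacity E {\<omega>\<in>space M. ?g i \<omega> > x}) + ereal (?h x)" .
  qed (auto)
  also have "(\<integral>\<^sup>+x\<in>{0..}. ennreal (?h x) \<partial>lborel) =
      (\<integral>\<^sup>+x. ennreal ?c * (ennreal ((x + \<epsilon>) powr - (\<theta> * N / p)) * indicator {0..} x) \<partial>lborel)"
    by (intro nn_integral_cong) (simp add: ennreal_mult mult.assoc)
  also have "\<dots> = ennreal ?c * (\<integral>\<^sup>+x\<in>{0..}. ennreal ((x + \<epsilon>) powr - (\<theta> * N / p)) \<partial>lborel)"
    by (intro nn_integral_cmult) measurable
  finally show ?thesis .
qed

text \<open>Sufficiency. The finitely many rows before the weights are controlled and \<open>B n\<close> is small are finite one by one.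
  Each later row is bounded by \<open>G n\<close>, the contribution of single large summands, and by a remainder of order
  \<open>n powr (- \<eta> N)\<close>. The series of the \<open>G n\<close> is integrated along the quantile function.\<close>

lemma rows_finite_of_growth:
  assumes csub: "countably_subadditive_expectation M H E"
    and indep: "indep_seq H E Xs" and Xs: "\<And>n. n \<ge> 1 \<Longrightarrow> Xs n \<in> H" and XH: "X \<in> H"
    and ident: "\<And>n. n \<ge> 1 \<Longrightarrow> ident_distributed H E (Xs n) X"
    and p: "0 < p" and r: "1 < r" and \<alpha>: "0 < \<alpha>" and b: "0 < b" and D: "0 < D" and \<epsilon>: "0 < \<epsilon>"
    and half: "1 / 2 < \<alpha> + b" and bs: "1 < b * ((r - 1) / \<alpha>)"
    and mean: "\<alpha> + b \<le> 1 \<Longrightarrow> E X = 0 \<and> E (\<lambda>\<omega>. - X \<omega>) = 0"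
    and fin: "choquet_pos M E (\<lambda>\<omega>. growth p ((r - 1) / \<alpha>) \<bar>X \<omega>\<bar>) < \<infinity>"
    and a: "\<And>n i. n0 \<le> n \<Longrightarrow> i \<in> {1..Suc n} \<Longrightarrow> \<bar>a (Suc n) i\<bar> \<le> D * (real i powr - b * real (Suc n) powr - \<alpha>)"
  shows "(\<Sum>n. ennreal (real (Suc n) powr (r - 2)) * choquet_pos M E (row_excess a Xs p \<epsilon> (Suc n))) < \<infinity>"
proof -
  define s where "s = (r - 1) / \<alpha>"
  have s: "0 < s" using r \<alpha> by (simp add: s_def)
  note fin = fin[folded s_def] and bs = bs[folded s_def]
  have [measurable]: "X \<in> borel_measurable M" by (rule H_meas[OF XH])
  \<comment> \<open>The exponent \<open>\<theta>\<close> lies strictly between \<open>1 / (\<alpha> + b)\<close>, above which the weights decay, and \<open>s\<close>, below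
    which moments are finite. The additional upper bound \<open>2\<close> or \<open>1\<close> selects the version of the exponential
    estimate; it exceeds \<open>1 / (\<alpha> + b)\<close> because \<open>\<alpha> + b > 1 / 2\<close> or \<open>\<alpha> + b > 1\<close>.\<close>
  define \<theta>1 where "\<theta>1 = min s (if \<alpha> + b \<le> 1 then 2 else 1)"
  define \<theta> where "\<theta> = (1 / (\<alpha> + b) + \<theta>1) / 2"
  have ab: "0 < \<alpha> + b" using \<alpha> b by simp
  have "0 < \<alpha> * s" using \<alpha> s by simp
  then have "1 < (\<alpha> + b) * s" using bs by (simp add: distrib_right)
  then have "1 / (\<alpha> + b) < s" using ab by (simp add: field_simps)
  moreover have "1 / (\<alpha> + b) < (if \<alpha> + b \<le> 1 then 2 else 1)" using half ab by (simp add: field_simps)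
  ultimately have \<theta>1: "1 / (\<alpha> + b) < \<theta>1" by (simp add: \<theta>1_def)
  have \<theta>l: "1 / (\<alpha> + b) < \<theta>" and \<theta>u: "\<theta> < \<theta>1" using \<theta>1 by (auto simp: \<theta>_def)
  have \<theta>0: "0 < \<theta>" using \<theta>l ab by (meson divide_pos_pos less_trans zero_less_one)
  have \<theta>s: "\<theta> < s" using \<theta>u by (simp add: \<theta>1_def)
  have \<theta>q: "1 < (\<alpha> + b) * \<theta>" using \<theta>l ab by (simp add: field_simps)
  have \<theta>c: "\<theta> \<le> 1 \<or> (1 \<le> \<theta> \<and> \<theta> \<le> 2 \<and> E X = 0 \<and> E (\<lambda>\<omega>. - X \<omega>) = 0)"
  proof (cases "\<alpha> + b \<le> 1")
    case True
    then have "1 \<le> 1 / (\<alpha> + b)" using ab by simp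
    then show ?thesis using \<theta>l \<theta>u True mean by (simp add: \<theta>1_def)
  next
    case False
    then show ?thesis using \<theta>u by (simp add: \<theta>1_def)
  qed
  obtain K where K: "0 \<le> K"
    "\<And>t. 1 \<le> t \<Longrightarrow> capacity E {\<omega>\<in>space M. \<bar>X \<omega>\<bar> > t} \<le> ereal (K * t powr - s)"
    by (rule tail_of_growth[OF XH p s fin]) blast
  obtain \<kappa> where dom: "dominated_moment M H E X \<theta> \<kappa>"
    using dominated_moment_of_tail[OF csub XH K(2) K(1) \<theta>0 \<theta>s] by blast
  have tight: "\<exists>t\<ge>0. capacity E {\<omega>\<in>space M. \<bar>X \<omega>\<bar> > t} \<le> ereal l" if l: "0 < l" for l
  proof -
    define t where "t = max 1 ((K / l) powr (1 / s))"
    have t1: "1 \<le> t" by (simp add: t_def)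
    have "((K / l) powr (1 / s)) powr s \<le> t powr s" using s by (intro powr_mono2) (auto simp: t_def)
    then have "K / l \<le> t powr s" using s K l by (simp add: powr_powr)
    then have "K * t powr - s \<le> l" using l t1 by (simp add: powr_minus field_simps)
    then show ?thesis using K(2)[OF t1] t1 by (intro exI[of _ t]) (auto intro: order_trans)
  qed
  obtain T where T: "is_quantile M E X T" using quantile_representation[OF _ tight] by auto
  note Tm[measurable] = is_quantileD(1)[OF T]
  obtain \<eta> C1 where \<eta>: "0 < \<eta>" and C1: "0 < C1"
    and wsum: "\<And>n. (\<Sum>i=1..Suc n. (real i powr - b * real (Suc n) powr - \<alpha>) powr \<theta>) \<le> C1 * real (Suc n) powr - \<eta>"
    using weight_power_sum_le[OF \<alpha> b \<theta>0 \<theta>q] by blast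
  \<comment> \<open>The first summand makes the remainder integrable in \<open>x\<close>, the second one summable in \<open>n\<close>.\<close>
  define N where "N = 2 * p / \<theta> + r / \<eta>"
  have N: "0 < N" unfolding N_def using p \<theta>0 r \<eta> by (intro add_pos_pos) auto
  have "2 * p / \<theta> \<le> N" "r / \<eta> \<le> N" unfolding N_def using p \<theta>0 r \<eta> by auto
  then have N1: "1 < \<theta> * N / p" and N2: "r \<le> \<eta> * N" using p \<theta>0 \<eta> by (auto simp: field_simps)
  define J where "J = (\<integral>\<^sup>+x\<in>{0..}. ennreal ((x + \<epsilon>) powr - (\<theta> * N / p)) \<partial>lborel)"
  have J: "J < \<infinity>" unfolding J_def by (rule nn_integral_shifted_powr_finite[OF \<epsilon> N1])
  define B where "B n = D powr \<theta> * C1 * real (Suc n) powr - \<eta>" for n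
  have B0: "0 < B n" for n unfolding B_def using D C1 by simp
  have "(\<lambda>n. real (Suc n) powr - \<eta>) \<longlonglongrightarrow> 0"
    using \<eta> by (intro tendsto_neg_powr filterlim_compose[OF filterlim_real_sequentially filterlim_Suc]) auto
  then have "B \<longlonglongrightarrow> D powr \<theta> * C1 * 0" unfolding B_def by (intro tendsto_mult tendsto_const)
  moreover have "D powr \<theta> * C1 * 0 < (\<epsilon> powr (1 / p) / (2 * N)) powr \<theta>" using \<epsilon> N by simp
  ultimately have "\<forall>\<^sub>F n in sequentially. B n < (\<epsilon> powr (1 / p) / (2 * N)) powr \<theta>" by (rule order_tendstoD)
  then obtain n1 where n1: "\<And>n. n1 \<le> n \<Longrightarrow> B n < (\<epsilon> powr (1 / p) / (2 * N)) powr \<theta>"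
    by (auto simp: eventually_sequentially)
  define n2 where "n2 = max n0 n1"
  define w where "w n = ennreal (real (Suc n) powr (r - 2))" for n
  define \<Phi> where "\<Phi> n = choquet_pos M E (row_excess a Xs p \<epsilon> (Suc n))" for n
  define D' where "D' = 2 * N * D"
  have D': "0 < D'" using N D by (simp add: D'_def)
  define G where "G n = (\<Sum>i=1..Suc n. choquet_pos M E (\<lambda>\<omega>. max 0 ((D' * real i powr - b * \<bar>X \<omega>\<bar> * real (Suc n) powr - \<alpha>) powr p - \<epsilon>)))" for n
  define Q where "Q = 2 * exp (2 * \<kappa>) * (D powr \<theta> * C1 * (2 * N) powr \<theta>) powr N"
  have Q0: "0 \<le> Q" by (simp add: Q_def)
  have large: "\<Phi> n \<le> G n + ennreal (Q * real (Suc n) powr - (\<eta> * N)) * J" if n: "n2 \<le> n" for n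
  proof -
    define d where "d i = D * (real i powr - b * real (Suc n) powr - \<alpha>)" for i :: nat
    have "(\<Sum>i=1..Suc n. d i powr \<theta>) = D powr \<theta> * (\<Sum>i=1..Suc n. (real i powr - b * real (Suc n) powr - \<alpha>) powr \<theta>)"
      unfolding d_def sum_distrib_left using D by (intro sum.cong refl powr_mult)
    also have "\<dots> \<le> D powr \<theta> * (C1 * real (Suc n) powr - \<eta>)" by (intro mult_left_mono wsum) auto
    finally have Bd: "(\<Sum>i=1..Suc n. d i powr \<theta>) \<le> B n" by (simp add: B_def mult.assoc)
    have "\<Phi> n \<le> (\<Sum>i=1..Suc n. choquet_pos M E (\<lambda>\<omega>. max 0 ((2 * N * d i * \<bar>X \<omega>\<bar>) powr p - \<epsilon>)))
      + ennreal (2 * exp (2 * \<kappa>) * (B n * (2 * N) powr \<theta>) powr N) * J"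
      unfolding \<Phi>_def J_def
    proof (rule row_excess_choquet_le[OF indep Xs XH ident dom \<theta>0 \<theta>c N p \<epsilon> _ _ Bd B0])
      show "B n < (\<epsilon> powr (1 / p) / (2 * N)) powr \<theta>" using n by (intro n1) (simp add: n2_def)
      show "\<bar>a (Suc n) i\<bar> \<le> d i" if "i \<in> {1..Suc n}" for i
        unfolding d_def using n that by (intro a) (auto simp: n2_def)
    qed auto
    also have "(\<Sum>i=1..Suc n. choquet_pos M E (\<lambda>\<omega>. max 0 ((2 * N * d i * \<bar>X \<omega>\<bar>) powr p - \<epsilon>))) = G n"
      unfolding G_def d_def D'_def by (simp only: mult_ac)
    also have "2 * exp (2 * \<kappa>) * (B n * (2 * N) powr \<theta>) powr N = Q * real (Suc n) powr - (\<eta> * N)"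
    proof -
      have "B n * (2 * N) powr \<theta> = (D powr \<theta> * C1 * (2 * N) powr \<theta>) * real (Suc n) powr - \<eta>"
        unfolding B_def by simp
      then have "(B n * (2 * N) powr \<theta>) powr N = (D powr \<theta> * C1 * (2 * N) powr \<theta>) powr N * real (Suc n) powr - (\<eta> * N)"
        by (simp only: powr_mult powr_powr mult_minus_left)
      then show ?thesis by (simp add: Q_def)
    qed
    finally show ?thesis .
  qed
  have small: "\<Phi> n < \<infinity>" for n
    unfolding \<Phi>_def by (rule row_excess_choquet_finite[OF Xs XH ident p s \<epsilon> T fin]) auto
  have sum1: "(\<Sum>n. if n < n2 then w n * \<Phi> n else 0) < \<infinity>"
  proof -
    have "(\<Sum>n. if n < n2 then w n * \<Phi> n else 0) = (\<Sum>n<n2. if n < n2 then w n * \<Phi> n else 0)"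
      by (intro suminf_finite) auto
    also have "\<dots> < \<infinity>" using small by (simp add: w_def ennreal_mult_less_top)
    finally show ?thesis .
  qed
  have sum2: "(\<Sum>n. w n * G n) < \<infinity>"
  proof -
    let ?R = "\<lambda>n i l. ennreal (row_term r \<alpha> p \<epsilon> (D' * real i powr - b * T l) n)"
    have Rm: "?R n i \<in> borel_measurable lborel" for n i unfolding row_term_def by measurable
    have "w n * G n = (\<integral>\<^sup>+l. (\<Sum>i=1..Suc n. ?R n i l) * indicator {0<..<1} l \<partial>lborel)" for n
    proof -
      have "w n * G n = (\<Sum>i=1..Suc n. \<integral>\<^sup>+l\<in>{0<..<1}. ?R n i l \<partial>lborel)"
        unfolding G_def w_def sum_distrib_left using D'
        by (intro sum.cong refl is_quantile_row[OF T p]) auto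
      also have "\<dots> = (\<integral>\<^sup>+l. (\<Sum>i=1..Suc n. ?R n i l * indicator {0<..<1} l) \<partial>lborel)"
        using Rm by (intro nn_integral_sum[symmetric]) auto
      finally show ?thesis by (simp only: sum_distrib_right)
    qed
    then have "(\<Sum>n. w n * G n) = (\<Sum>n. \<integral>\<^sup>+l. (\<Sum>i=1..Suc n. ?R n i l) * indicator {0<..<1} l \<partial>lborel)" by simp
    also have "\<dots> = (\<integral>\<^sup>+l. (\<Sum>n. (\<Sum>i=1..Suc n. ?R n i l) * indicator {0<..<1} l) \<partial>lborel)"
      using Rm by (intro nn_integral_suminf[symmetric] borel_measurable_times_ennreal borel_measurable_sum) auto
    also have "\<dots> = (\<integral>\<^sup>+l. (\<Sum>n. \<Sum>i=1..Suc n. ?R n i l) * indicator {0<..<1} l \<partial>lborel)" by simp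
    also obtain C where C: "0 \<le> C" "\<And>t. 0 \<le> t \<Longrightarrow>
      (\<Sum>n. \<Sum>i=1..Suc n. ennreal (row_term r \<alpha> p \<epsilon> (D' * real i powr - b * t) n)) \<le> ennreal (C * (1 + growth p s t))"
      using weighted_rows_le_growth[OF r \<alpha> b p \<epsilon> D', folded s_def, OF bs] by blast
    have "(\<integral>\<^sup>+l. (\<Sum>n. \<Sum>i=1..Suc n. ?R n i l) * indicator {0<..<1} l \<partial>lborel)
        \<le> (\<integral>\<^sup>+l\<in>{0<..<1}. ennreal (C * (1 + growth p s (T l))) \<partial>lborel)"
      using C(2)[OF is_quantileD(2)[OF T]] by (intro nn_integral_mono mult_right_mono) auto
    also have "\<dots> = (\<integral>\<^sup>+l. ennreal C * indicator {0<..<1} l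
        + ennreal C * (ennreal (growth p s (T l)) * indicator {0<..<1} l) \<partial>lborel)"
      using C(1) growth_nonneg
      by (intro nn_integral_cong) (auto simp: indicator_def distrib_left ennreal_plus ennreal_mult)
    also have "\<dots> = (\<integral>\<^sup>+l. ennreal C * indicator {0<..<1::real} l \<partial>lborel)
        + ennreal C * (\<integral>\<^sup>+l\<in>{0<..<1}. ennreal (growth p s (T l)) \<partial>lborel)"
      by (subst nn_integral_add) (auto simp: nn_integral_cmult)
    also have "(\<integral>\<^sup>+l\<in>{0<..<1}. ennreal (growth p s (T l)) \<partial>lborel) = choquet_pos M E (\<lambda>\<omega>. growth p s \<bar>X \<omega>\<bar>)"
      by (intro is_quantileD(3)[OF T, symmetric] growth_continuous growth_mono growth_nonneg p s)
    also have "(\<integral>\<^sup>+l. ennreal C * indicator {0<..<1::real} l \<partial>lborel) + ennreal C * \<dots> < \<infinity>"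
      using fin by (simp add: nn_integral_cmult ennreal_mult_less_top)
    finally show ?thesis .
  qed
  have sum3: "(\<Sum>n. w n * (ennreal (Q * real (Suc n) powr - (\<eta> * N)) * J)) < \<infinity>"
  proof -
    have "summable (\<lambda>n. real n powr (r - 2 - \<eta> * N))" using N2 by (simp add: summable_real_powr_iff)
    then have summ: "summable (\<lambda>n. real (Suc n) powr (r - 2 - \<eta> * N))" by (subst summable_Suc_iff)
    have "w n * (ennreal (Q * real (Suc n) powr - (\<eta> * N)) * J) = ennreal (Q * real (Suc n) powr (r - 2 - \<eta> * N)) * J" for n
    proof -
      have "real (Suc n) powr (r - 2 - \<eta> * N) = real (Suc n) powr (r - 2) * real (Suc n) powr - (\<eta> * N)"
        unfolding powr_add[symmetric] by simp
      then have "ennreal (Q * real (Suc n) powr (r - 2 - \<eta> * N)) = w n * ennreal (Q * real (Suc n) powr - (\<eta> * N))"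
        unfolding w_def using Q0 by (simp add: mult_ac flip: ennreal_mult)
      then show ?thesis by (simp only: mult.assoc)
    qed
    then have "(\<Sum>n. w n * (ennreal (Q * real (Suc n) powr - (\<eta> * N)) * J)) = (\<Sum>n. ennreal (Q * real (Suc n) powr (r - 2 - \<eta> * N))) * J"
      by simp
    also have "(\<Sum>n. ennreal (Q * real (Suc n) powr (r - 2 - \<eta> * N))) = ennreal (\<Sum>n. Q * real (Suc n) powr (r - 2 - \<eta> * N))"
      using Q0 by (intro suminf_ennreal2 summable_mult summ) auto
    also have "\<dots> * J < \<infinity>" using J by (simp add: ennreal_mult_less_top)
    finally show ?thesis .
  qed
  have "w n * \<Phi> n \<le> (if n < n2 then w n * \<Phi> n else 0) + (w n * G n + w n * (ennreal (Q * real (Suc n) powr - (\<eta> * N)) * J))" for n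
    using mult_left_mono[OF large[of n], of "w n"] by (simp add: distrib_left not_less)
  then have "(\<Sum>n. w n * \<Phi> n) \<le> (\<Sum>n. (if n < n2 then w n * \<Phi> n else 0) + (w n * G n + w n * (ennreal (Q * real (Suc n) powr - (\<eta> * N)) * J)))"
    by (intro suminf_le summableI)
  also have "\<dots> = (\<Sum>n. if n < n2 then w n * \<Phi> n else 0) + ((\<Sum>n. w n * G n) + (\<Sum>n. w n * (ennreal (Q * real (Suc n) powr - (\<eta> * N)) * J)))"
    by (subst suminf_add[symmetric, OF summableI summableI], subst suminf_add[symmetric, OF summableI summableI]) simp
  also have "\<dots> < \<infinity>" using sum1 sum2 sum3 by simp
  finally show ?thesis by (simp add: w_def \<Phi>_def)
qed

lemma row_series_finite_iff:
  assumes Xs: "\<And>n. n \<ge> 1 \<Longrightarrow> Xs n \<in> H"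
  shows "(\<Sum>n. ereal (real (Suc n) powr (r - 2)) * choquet M E (row_excess a Xs p \<epsilon> (Suc n))) < \<infinity> \<longleftrightarrow>
    (\<Sum>n. ennreal (real (Suc n) powr (r - 2)) * choquet_pos M E (row_excess a Xs p \<epsilon> (Suc n))) < \<infinity>"
proof -
  have "ereal (real (Suc n) powr (r - 2)) * choquet M E (row_excess a Xs p \<epsilon> (Suc n))
    = enn2ereal (ennreal (real (Suc n) powr (r - 2)) * choquet_pos M E (row_excess a Xs p \<epsilon> (Suc n)))" for n
    by (subst choquet_eq_pos[OF row_excess_measurable[OF Xs] row_excess_nonneg]) (auto simp: times_ennreal.rep_eq enn2ereal_ennreal)
  then have "(\<Sum>n. ereal (real (Suc n) powr (r - 2)) * choquet M E (row_excess a Xs p \<epsilon> (Suc n)))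
    = enn2ereal (\<Sum>n. ennreal (real (Suc n) powr (r - 2)) * choquet_pos M E (row_excess a Xs p \<epsilon> (Suc n)))"
    by simp
  then show ?thesis by (simp add: less_top)
qed

end

section \<open>The equivalence\<close>

theorem theorem3p3:
  fixes M :: "'a measure" and H :: "('a \<Rightarrow> real) set" and E :: "('a \<Rightarrow> real) \<Rightarrow> ereal"
    and Xs :: "nat \<Rightarrow> 'a \<Rightarrow> real" and X :: "'a \<Rightarrow> real"
    and a :: "nat \<Rightarrow> nat \<Rightarrow> real" and p r q \<beta> :: real
  assumes "sublinear_expectation_space M H E"
    and "countably_subadditive_expectation M H E"
    and "X \<in> H" and "\<And>n. n \<ge> 1 \<Longrightarrow> Xs n \<in> H"
    and "indep_seq H E Xs"
    and "\<And>n. n \<ge> 1 \<Longrightarrow> ident_distributed H E (Xs n) X"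
    and "p > 0" and "r > 1" and "q > 1/2"
    and "- q < \<beta>" and "\<beta> < - q / r" and "- q / r < 0"
    and "q \<le> 1 \<Longrightarrow> E X = 0 \<and> - E (\<lambda>\<omega>. - X \<omega>) = 0"
    and "array_approx a (\<lambda>n i. (real i / real n) powr \<beta> * (1 / real n powr q))"
  shows "(\<forall>\<epsilon>>0. (\<Sum>n. ereal (real (Suc n) powr (r - 2)) *
              choquet M E (\<lambda>\<omega>. max (Max ((\<lambda>k. \<bar>\<Sum>i=1..k. a (Suc n) i * Xs i \<omega>\<bar> powr p) ` {1..Suc n}) - \<epsilon>) 0))
            < \<infinity>)
         \<longleftrightarrow>
         (p > (r - 1) / (q + \<beta>) \<longrightarrow>
            choquet M E (\<lambda>\<omega>. \<bar>X \<omega>\<bar> powr p) < \<infinity>) \<and>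
         (p = (r - 1) / (q + \<beta>) \<longrightarrow>
            choquet M E (\<lambda>\<omega>. \<bar>X \<omega>\<bar> powr ((r - 1) / (q + \<beta>)) * ln \<bar>X \<omega>\<bar>) < \<infinity>) \<and>
         (p < (r - 1) / (q + \<beta>) \<longrightarrow>
            choquet M E (\<lambda>\<omega>. \<bar>X \<omega>\<bar> powr ((r - 1) / (q + \<beta>))) < \<infinity>)"
proof -
  interpret sublinear_expectation_space M H E by fact
  define \<alpha> where "\<alpha> = q + \<beta>"
  define b where "b = - \<beta>"
  define s where "s = (r - 1) / \<alpha>"
  note p = \<open>p > 0\<close> and r = \<open>r > 1\<close>
  note XH = \<open>X \<in> H\<close> and Xs = \<open>\<And>n. n \<ge> 1 \<Longrightarrow> Xs n \<in> H\<close>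
  note ident = \<open>\<And>n. n \<ge> 1 \<Longrightarrow> ident_distributed H E (Xs n) X\<close>
  have \<alpha>: "0 < \<alpha>" using \<open>- q < \<beta>\<close> by (simp add: \<alpha>_def)
  have b: "0 < b" using \<open>\<beta> < - q / r\<close> \<open>- q / r < 0\<close> by (simp add: b_def)
  have q: "\<alpha> + b = q" by (simp add: \<alpha>_def b_def)
  have "q / r < b" using \<open>\<beta> < - q / r\<close> by (simp add: b_def)
  then have "\<alpha> + b < b * r" using r q by (simp add: field_simps)
  \<comment> \<open>The hypothesis \<open>\<beta> < - q / r\<close> becomes the summability condition \<open>b s > 1\<close>.\<close>
  then have bs: "1 < b * ((r - 1) / \<alpha>)" using \<alpha> by (simp add: field_simps)
  obtain C n1 where C: "1 \<le> C" and a: "\<And>n i. n1 \<le> n \<Longrightarrow> i \<in> {1..n} \<Longrightarrow>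
      inverse C * ((real i / real n) powr \<beta> * (1 / real n powr q)) \<le> a n i \<and>
      a n i \<le> C * ((real i / real n) powr \<beta> * (1 / real n powr q))"
    using \<open>array_approx a _\<close> unfolding array_approx_def eventually_sequentially by blast
  have weight: "(real i / real n) powr \<beta> * (1 / real n powr q) = real i powr - b * real n powr - \<alpha>"
    if "1 \<le> n" for i n
  proof -
    have "real n powr - \<alpha> = real n powr - \<beta> * real n powr - q"
      unfolding powr_add[symmetric] by (simp add: \<alpha>_def algebra_simps)
    then show ?thesis by (simp add: powr_divide powr_minus b_def field_simps)
  qed
  have bounds: "inverse C * (real i powr - b * real (Suc n) powr - \<alpha>) \<le> a (Suc n) i"
      "a (Suc n) i \<le> C * (real i powr - b * real (Suc n) powr - \<alpha>)"
    if "n1 \<le> n" "i \<in> {1..Suc n}" for n i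
  proof -
    have "n1 \<le> Suc n" using that by simp
    from a[OF this that(2), unfolded weight[OF le_add1[of 1 n, unfolded plus_1_eq_Suc]]]
    show "inverse C * (real i powr - b * real (Suc n) powr - \<alpha>) \<le> a (Suc n) i"
      "a (Suc n) i \<le> C * (real i powr - b * real (Suc n) powr - \<alpha>)" by blast+
  qed
  have upper: "\<bar>a (Suc n) i\<bar> \<le> C * (real i powr - b * real (Suc n) powr - \<alpha>)"
    if "n1 \<le> n" "i \<in> {1..Suc n}" for n i
  proof -
    have "0 \<le> inverse C * (real i powr - b * real (Suc n) powr - \<alpha>)" using C by simp
    then have "0 \<le> a (Suc n) i" using bounds(1)[OF that] by (rule order_trans)
    then show ?thesis using bounds(2)[OF that] by (simp only: abs_of_nonneg)
  qed
  have lower: "inverse C * real (Suc n) powr - \<alpha> \<le> \<bar>a (Suc n) 1\<bar>" if "n1 \<le> n" for n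
  proof -
    have "1 \<in> {1..Suc n}" by simp
    from bounds(1)[OF that this] show ?thesis by simp
  qed
  let ?series = "\<lambda>\<epsilon>. \<Sum>n. ennreal (real (Suc n) powr (r - 2)) * choquet_pos M E (row_excess a Xs p \<epsilon> (Suc n))"
  have "(\<forall>\<epsilon>>0. ?series \<epsilon> < \<infinity>) \<longleftrightarrow> choquet_pos M E (\<lambda>\<omega>. growth p s \<bar>X \<omega>\<bar>) < \<infinity>"
  proof
    assume "\<forall>\<epsilon>>0. ?series \<epsilon> < \<infinity>"
    then have fin: "?series 1 < \<infinity>" by simp
    show "choquet_pos M E (\<lambda>\<omega>. growth p s \<bar>X \<omega>\<bar>) < \<infinity>"
      unfolding s_def
    proof (rule growth_finite_of_rows[OF XH r \<alpha> p zero_less_one _ fin])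
      show "0 < inverse C" using C by simp
      fix n assume n: "n1 \<le> n"
      let ?g = "\<lambda>t. max 0 ((\<bar>a (Suc n) 1\<bar> * \<bar>t\<bar>) powr p - 1)"
      have g[measurable]: "?g \<in> borel_measurable borel" by measurable
      note [measurable] = H_meas[OF XH] H_meas[OF Xs[OF order_refl]]
      have "choquet_pos M E (\<lambda>\<omega>. max 0 ((inverse C * \<bar>X \<omega>\<bar> * real (Suc n) powr - \<alpha>) powr p - 1))
          \<le> choquet_pos M E (\<lambda>\<omega>. ?g (X \<omega>))"
      proof (rule choquet_pos_mono)
        fix \<omega>
        have "inverse C * \<bar>X \<omega>\<bar> * real (Suc n) powr - \<alpha> = inverse C * real (Suc n) powr - \<alpha> * \<bar>X \<omega>\<bar>"
          by (simp only: mult_ac)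
        also have "\<dots> \<le> \<bar>a (Suc n) 1\<bar> * \<bar>X \<omega>\<bar>" by (intro mult_right_mono lower n) simp
        finally show "max 0 ((inverse C * \<bar>X \<omega>\<bar> * real (Suc n) powr - \<alpha>) powr p - 1) \<le> ?g (X \<omega>)"
          using C p by (intro max.mono diff_right_mono powr_mono2) auto
      qed measurable
      also have "\<dots> = choquet_pos M E (\<lambda>\<omega>. ?g (Xs 1 \<omega>))"
        by (rule ident_distributed_choquet_pos[OF ident Xs XH g, symmetric]) auto
      also have "\<dots> \<le> choquet_pos M E (row_excess a Xs p 1 (Suc n))"
      proof (rule choquet_pos_mono)
        show "row_excess a Xs p 1 (Suc n) \<in> borel_measurable M" by (rule row_excess_measurable[OF Xs])
        fix \<omega>
        have "\<bar>\<Sum>i=1..1. a (Suc n) i * Xs i \<omega>\<bar> powr p \<le>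
            Max ((\<lambda>k. \<bar>\<Sum>i=1..k. a (Suc n) i * Xs i \<omega>\<bar> powr p) ` {1..Suc n})"
          by (intro Max_ge imageI) auto
        then show "?g (Xs 1 \<omega>) \<le> row_excess a Xs p 1 (Suc n) \<omega>"
          by (simp add: row_excess_def abs_mult)
      qed measurable
      finally show "choquet_pos M E (\<lambda>\<omega>. max 0 ((inverse C * \<bar>X \<omega>\<bar> * real (Suc n) powr - \<alpha>) powr p - 1))
        \<le> choquet_pos M E (row_excess a Xs p 1 (Suc n))" .
    qed
  next
    assume fin: "choquet_pos M E (\<lambda>\<omega>. growth p s \<bar>X \<omega>\<bar>) < \<infinity>"
    have mean: "E X = 0 \<and> E (\<lambda>\<omega>. - X \<omega>) = 0" if "\<alpha> + b \<le> 1"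
      using \<open>q \<le> 1 \<Longrightarrow> E X = 0 \<and> - E (\<lambda>\<omega>. - X \<omega>) = 0\<close> that q by (simp add: ereal_uminus_eq_reorder)
    have half: "1 / 2 < \<alpha> + b" using \<open>q > 1/2\<close> q by simp
    show "\<forall>\<epsilon>>0. ?series \<epsilon> < \<infinity>"
    proof (intro allI impI)
      fix \<epsilon> :: real assume "0 < \<epsilon>"
      with C show "?series \<epsilon> < \<infinity>"
        by (intro rows_finite_of_growth[OF \<open>countably_subadditive_expectation M H E\<close> \<open>indep_seq H E Xs\<close>
              Xs XH ident p r \<alpha> b _ _ half bs mean fin[unfolded s_def] upper]) auto
    qed
  qed
  then have "(\<forall>\<epsilon>>0. (\<Sum>n. ereal (real (Suc n) powr (r - 2)) * choquet M E (row_excess a Xs p \<epsilon> (Suc n))) < \<infinity>)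
      \<longleftrightarrow> choquet_pos M E (\<lambda>\<omega>. growth p s \<bar>X \<omega>\<bar>) < \<infinity>"
    by (simp only: row_series_finite_iff[OF Xs])
  then show ?thesis
    unfolding moment_conditions_iff_growth[symmetric] row_excess_def[abs_def] s_def \<alpha>_def .
qed

end
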